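(* Let $R=\bigoplus_{i=1}^n\mathbb F_i$ be a semisimple ring, where each $\mathbb F_i$ is a field, and let $G=Q_8\times A$ with $A$ a finite abelian group. Let $*$ be the canonical involution of $G$ as an SLC-group, and suppose that the characteristic $\mathrm{char}(R)$ does not divide $|G|$. Then $RG$ is $*$-clean (with respect to the $R$-linear extension of $*$) if and only if, for every $i\in\{1,\dots,n\}$ and every positive integer $d$ such that $A$ has an element of order $d$, the equation $X^2+Y^2+Z^2+1=0$ has no solution in $\mathbb F_i(\zeta_d)$, where $\zeta_d$ is a primitive $d$-th root of $1$.
   Context: $Q_8$ is the quaternion group of order $8$. An SLC-group is a group $G$ with $G/\mathcal Z(G)\cong C_2\times C_2$, where $\mathcal Z(G)$ is the center; then $G'=\{1,s\}$ with $s$ central of order $2$. Its canonical involution is the map $*:G\to G$ with $g^*=g$ if $g\in\mathcal Z(G)$ and $g^*=sg$ if $g\notin\mathcal Z(G)$; it is extended $R$-linearly to a ring involution of $RG$. A projection is an element $p$ with $p^2=p=p^*$. A unital ring with involution $*$ is $*$-clean if each of its elements is the sum of a unit and a projection.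
   Formalization: "char(R) does not divide |G|" is read as: char(F_i) does not divide |G| for every i (|G| is invertible in R); with the literal char(R) the claim fails for R = Q ⊕ F_2, G = Q_8. *)

theory Defs
  imports "HOL-Algebra.Algebra"
begin

section \<open>The quaternion group of order 8\<close>

datatype quat_unit = U1 | UI | UJ | UK

text \<open>
  The element \<open>(b, u)\<close> stands for \<open>- u\<close> if \<open>b\<close> is true and for \<open>u\<close> otherwise.
\<close>

fun quat_unit_mult :: "quat_unit \<Rightarrow> quat_unit \<Rightarrow> bool \<times> quat_unit" where
  "quat_unit_mult U1 v = (False, v)"
| "quat_unit_mult u U1 = (False, u)"
| "quat_unit_mult UI UI = (True, U1)"
| "quat_unit_mult UJ UJ = (True, U1)"
| "quat_unit_mult UK UK = (True, U1)"
| "quat_unit_mult UI UJ = (False, UK)"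
| "quat_unit_mult UJ UK = (False, UI)"
| "quat_unit_mult UK UI = (False, UJ)"
| "quat_unit_mult UJ UI = (True, UK)"
| "quat_unit_mult UK UJ = (True, UI)"
| "quat_unit_mult UI UK = (True, UJ)"

definition Q8 :: "(bool \<times> quat_unit) monoid" where
  "Q8 = \<lparr> carrier = UNIV,
          monoid.mult = (\<lambda>(a, u) (b, v). case quat_unit_mult u v of (c, w) \<Rightarrow> ((a \<noteq> b) \<noteq> c, w)),
          monoid.one = (False, U1) \<rparr>"


section \<open>SLC-groups\<close>

definition group_center :: "('g, 'n) monoid_scheme \<Rightarrow> 'g set" where
  "group_center G = {z \<in> carrier G. \<forall>g \<in> carrier G. z \<otimes>\<^bsub>G\<^esub> g = g \<otimes>\<^bsub>G\<^esub> z}"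

definition SLC_group :: "('g, 'n) monoid_scheme \<Rightarrow> bool" where
  "SLC_group G \<longleftrightarrow>
     group G \<and> (G Mod group_center G) \<cong> (integer_mod_group 2 \<times>\<times> integer_mod_group 2)"

definition SLC_commutator :: "('g, 'n) monoid_scheme \<Rightarrow> 'g" where
  "SLC_commutator G = (THE s. s \<noteq> \<one>\<^bsub>G\<^esub> \<and> derived G (carrier G) = {\<one>\<^bsub>G\<^esub>, s})"

definition canonical_involution :: "('g, 'n) monoid_scheme \<Rightarrow> 'g \<Rightarrow> 'g" where
  "canonical_involution G g =
     (if g \<in> group_center G then g else SLC_commutator G \<otimes>\<^bsub>G\<^esub> g)"


section \<open>Group rings\<close>

text \<open>
  The element \<open>\<Sum>g. f g \<cdot> g\<close> of the group ring is represented by its finitely supported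
  coefficient function \<open>f\<close>, which is undefined outside the carrier of the group.
\<close>

definition group_ring :: "('r, 'm) ring_scheme \<Rightarrow> ('g, 'n) monoid_scheme \<Rightarrow> ('g \<Rightarrow> 'r) ring" where
  "group_ring R G =
     \<lparr> carrier = {f \<in> carrier G \<rightarrow>\<^sub>E carrier R. finite {g \<in> carrier G. f g \<noteq> \<zero>\<^bsub>R\<^esub>}},
       monoid.mult = (\<lambda>f h. \<lambda>x \<in> carrier G.
                 \<Oplus>\<^bsub>R\<^esub>y \<in> {y \<in> carrier G. f y \<noteq> \<zero>\<^bsub>R\<^esub>}. f y \<otimes>\<^bsub>R\<^esub> h (inv\<^bsub>G\<^esub> y \<otimes>\<^bsub>G\<^esub> x)),
       monoid.one = (\<lambda>x \<in> carrier G. if x = \<one>\<^bsub>G\<^esub> then \<one>\<^bsub>R\<^esub> else \<zero>\<^bsub>R\<^esub>),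
       ring.zero = (\<lambda>x \<in> carrier G. \<zero>\<^bsub>R\<^esub>),
       ring.add = (\<lambda>f h. \<lambda>x \<in> carrier G. f x \<oplus>\<^bsub>R\<^esub> h x) \<rparr>"

text \<open>
  The linear extension of \<open>\<sigma>\<close>, sending \<open>\<Sum>g. f g \<cdot> g\<close> to \<open>\<Sum>g. f g \<cdot> \<sigma> g\<close>.
\<close>

definition linear_extension ::
  "('r, 'm) ring_scheme \<Rightarrow> ('g, 'n) monoid_scheme \<Rightarrow> ('g \<Rightarrow> 'g) \<Rightarrow> ('g \<Rightarrow> 'r) \<Rightarrow> ('g \<Rightarrow> 'r)" where
  "linear_extension R G \<sigma> f =
     (\<lambda>x \<in> carrier G. \<Oplus>\<^bsub>R\<^esub>g \<in> {g \<in> carrier G. f g \<noteq> \<zero>\<^bsub>R\<^esub> \<and> \<sigma> g = x}. f g)"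


section \<open>Rings with involution\<close>

definition ring_involution :: "('a, 'm) ring_scheme \<Rightarrow> ('a \<Rightarrow> 'a) \<Rightarrow> bool" where
  "ring_involution S \<sigma> \<longleftrightarrow>
     \<sigma> \<in> carrier S \<rightarrow> carrier S \<and>
     (\<forall>x \<in> carrier S. \<forall>y \<in> carrier S.
        \<sigma> (x \<oplus>\<^bsub>S\<^esub> y) = \<sigma> x \<oplus>\<^bsub>S\<^esub> \<sigma> y \<and> \<sigma> (x \<otimes>\<^bsub>S\<^esub> y) = \<sigma> y \<otimes>\<^bsub>S\<^esub> \<sigma> x) \<and>
     (\<forall>x \<in> carrier S. \<sigma> (\<sigma> x) = x)"

definition projections :: "('a, 'm) ring_scheme \<Rightarrow> ('a \<Rightarrow> 'a) \<Rightarrow> 'a set" where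
  "projections S \<sigma> = {p \<in> carrier S. p \<otimes>\<^bsub>S\<^esub> p = p \<and> \<sigma> p = p}"

definition star_clean :: "('a, 'm) ring_scheme \<Rightarrow> ('a \<Rightarrow> 'a) \<Rightarrow> bool" where
  "star_clean S \<sigma> \<longleftrightarrow>
     ring S \<and> ring_involution S \<sigma> \<and>
     (\<forall>x \<in> carrier S. \<exists>u \<in> Units S. \<exists>p \<in> projections S \<sigma>. x = u \<oplus>\<^bsub>S\<^esub> p)"


section \<open>Characteristic and cyclotomic extensions\<close>

text \<open>
  \<^const>\<open>group.ord\<close> is 0 for elements of infinite order, as required in characteristic 0.
\<close>

definition ring_characteristic :: "('a, 'm) ring_scheme \<Rightarrow> nat" where
  "ring_characteristic R = group.ord (add_monoid R) \<one>\<^bsub>R\<^esub>"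

definition primitive_root_of_one :: "('a, 'm) ring_scheme \<Rightarrow> nat \<Rightarrow> 'a \<Rightarrow> bool" where
  "primitive_root_of_one K d \<zeta> \<longleftrightarrow>
     d > 0 \<and> \<zeta> \<in> carrier K \<and> \<zeta> [^]\<^bsub>K\<^esub> d = \<one>\<^bsub>K\<^esub> \<and> (\<forall>k. 0 < k \<and> k < d \<longrightarrow> \<zeta> [^]\<^bsub>K\<^esub> k \<noteq> \<one>\<^bsub>K\<^esub>)"

text \<open>
  \<open>K\<close> is the field \<open>F(\<zeta>)\<close> for a primitive \<open>d\<close>-th root of unity \<open>\<zeta>\<close>; this determines \<open>K\<close>
  up to \<open>F\<close>-isomorphism, as \<open>K\<close> is then a splitting field of \<open>X^d - 1\<close> over \<open>F\<close>.
\<close>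

definition cyclotomic_extension ::
  "('a, 'm) ring_scheme \<Rightarrow> nat \<Rightarrow> ('k, 'l) ring_scheme \<Rightarrow> bool" where
  "cyclotomic_extension F d K \<longleftrightarrow>
     field K \<and>
     (\<exists>\<iota> \<zeta>. \<iota> \<in> ring_hom F K \<and> primitive_root_of_one K d \<zeta> \<and>
            carrier K = generate_field K (insert \<zeta> (\<iota> ` carrier F)))"


section \<open>The groups under consideration are SLC-groups\<close>

lemma Q8_simps [simp]:
  "carrier Q8 = UNIV" "\<one>\<^bsub>Q8\<^esub> = (False, U1)"
  "(a, u) \<otimes>\<^bsub>Q8\<^esub> (b, v) = ((a \<noteq> b) \<noteq> fst (quat_unit_mult u v), snd (quat_unit_mult u v))"
  by (auto simp: Q8_def split: prod.split)

lemma group_Q8: "group Q8"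
proof (rule groupI)
  fix x y z :: "bool \<times> quat_unit"
  show "x \<otimes>\<^bsub>Q8\<^esub> y \<otimes>\<^bsub>Q8\<^esub> z = x \<otimes>\<^bsub>Q8\<^esub> (y \<otimes>\<^bsub>Q8\<^esub> z)"
    by (cases x; cases y; cases z; cases "snd x"; cases "snd y"; cases "snd z") auto
next
  fix x :: "bool \<times> quat_unit"
  obtain a u where x: "x = (a, u)" by (cases x)
  have "(a \<noteq> (u \<noteq> U1), u) \<otimes>\<^bsub>Q8\<^esub> x = \<one>\<^bsub>Q8\<^esub>"
    unfolding x by (cases u) auto
  then show "\<exists>y \<in> carrier Q8. y \<otimes>\<^bsub>Q8\<^esub> x = \<one>\<^bsub>Q8\<^esub>" by auto
qed auto

lemma inv_Q8: "inv\<^bsub>Q8\<^esub> (a, u) = (a \<noteq> (u \<noteq> U1), u)"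
  by (rule group.inv_equality[OF group_Q8]) (cases u; auto)+

lemma group_center_Q8_times:
  assumes "comm_group A"
  shows "group_center (Q8 \<times>\<times> A) = {(a, u). u = U1} \<times> carrier A"
proof -
  interpret A: comm_group A by fact
  have "u = U1"
    if "\<forall>b v. (a, u) \<otimes>\<^bsub>Q8\<^esub> (b, v) = (b, v) \<otimes>\<^bsub>Q8\<^esub> (a, u)" for a u
    using that[rule_format, of False UI] that[rule_format, of False UJ] by (cases u) auto
  moreover have "(a, U1) \<otimes>\<^bsub>Q8\<^esub> (b, v) = (b, v) \<otimes>\<^bsub>Q8\<^esub> (a, U1)" for a b v
    by (cases v) auto
  ultimately show ?thesis
    using A.one_closed
    by (fastforce simp: group_center_def DirProd_def A.m_comm simp del: Q8_simps(3))
qed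

lemma derived_Q8_times:
  assumes "comm_group A"
  shows "derived (Q8 \<times>\<times> A) (carrier (Q8 \<times>\<times> A)) = {\<one>\<^bsub>Q8 \<times>\<times> A\<^esub>, ((True, U1), \<one>\<^bsub>A\<^esub>)}"
    (is "derived ?G _ = ?D")
proof -
  interpret A: comm_group A by fact
  interpret Q: group Q8 by (rule group_Q8)
  interpret G: group ?G by (rule DirProd_group[OF group_Q8 A.group_axioms])
  have comm: "g \<otimes>\<^bsub>?G\<^esub> h \<otimes>\<^bsub>?G\<^esub> inv\<^bsub>?G\<^esub> g \<otimes>\<^bsub>?G\<^esub> inv\<^bsub>?G\<^esub> h \<in> ?D"
    if "g \<in> carrier ?G" "h \<in> carrier ?G" for g h
  proof -
    obtain a u x b v y where gh: "g = ((a, u), x)" "h = ((b, v), y)" by (metis surj_pair)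
    have xy: "x \<in> carrier A" "y \<in> carrier A" using that gh by auto
    have "x \<otimes>\<^bsub>A\<^esub> y \<otimes>\<^bsub>A\<^esub> inv\<^bsub>A\<^esub> x \<otimes>\<^bsub>A\<^esub> inv\<^bsub>A\<^esub> y = \<one>\<^bsub>A\<^esub>"
      using xy by (simp add: A.m_comm[of x y] A.m_assoc A.inv_mult_group flip: A.inv_mult)
    moreover have "(a, u) \<otimes>\<^bsub>Q8\<^esub> (b, v) \<otimes>\<^bsub>Q8\<^esub> inv\<^bsub>Q8\<^esub> (a, u) \<otimes>\<^bsub>Q8\<^esub> inv\<^bsub>Q8\<^esub> (b, v)
        \<in> {(False, U1), (True, U1)}"
      by (cases u; cases v) (auto simp: inv_Q8)
    ultimately show ?thesis
      using xy by (auto simp: gh inv_DirProd[OF group_Q8 A.group_axioms] simp del: Q8_simps(3))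
  qed
  have sub: "subgroup ?D ?G"
    by (rule G.subgroupI) (auto simp: inv_DirProd[OF group_Q8 A.group_axioms] inv_Q8)
  have "((True, U1), \<one>\<^bsub>A\<^esub>) \<in> derived_set ?G (carrier ?G)"
    by (rule UN_I[of "((False, UI), \<one>\<^bsub>A\<^esub>)"], simp, rule UN_I[of "((False, UJ), \<one>\<^bsub>A\<^esub>)"])
      (auto simp: inv_DirProd[OF group_Q8 A.group_axioms] inv_Q8)
  then have "?D \<subseteq> derived ?G (carrier ?G)"
    unfolding derived_def by (simp only: insert_subset empty_subsetI generate.one generate.incl simp_thms)
  moreover have "derived ?G (carrier ?G) \<subseteq> ?D"
    unfolding derived_def using comm by (intro G.generate_subgroup_incl[OF _ sub]) blast
  ultimately show ?thesis by blast
qed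

lemma SLC_commutator_Q8_times:
  assumes "comm_group A"
  shows "SLC_commutator (Q8 \<times>\<times> A) = ((True, U1), \<one>\<^bsub>A\<^esub>)"
  unfolding SLC_commutator_def derived_Q8_times[OF assms]
  by (rule the_equality) (auto simp: doubleton_eq_iff)

lemma SLC_group_Q8_times:
  assumes "comm_group A"
  shows "SLC_group (Q8 \<times>\<times> A)"
proof -
  interpret A: comm_group A by fact
  let ?G = "Q8 \<times>\<times> A" and ?V = "integer_mod_group 2 \<times>\<times> integer_mod_group 2"
  define \<phi> :: "(bool \<times> quat_unit) \<times> 'a \<Rightarrow> int \<times> int" where
    "\<phi> = (\<lambda>((a, u), x). case u of U1 \<Rightarrow> (0, 0) | UI \<Rightarrow> (1, 0) | UJ \<Rightarrow> (0, 1) | UK \<Rightarrow> (1, 1))"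
  have G: "group ?G" by (rule DirProd_group[OF group_Q8 A.group_axioms])
  have V: "group ?V" by (intro DirProd_group group_integer_mod_group)
  have "\<phi> \<in> hom ?G ?V"
  proof (rule homI)
    fix g h assume "g \<in> carrier ?G" "h \<in> carrier ?G"
    obtain a u x b v y where gh: "g = ((a, u), x)" "h = ((b, v), y)" by (metis surj_pair)
    show "\<phi> (g \<otimes>\<^bsub>?G\<^esub> h) = \<phi> g \<otimes>\<^bsub>?V\<^esub> \<phi> h"
      by (cases u; cases v) (auto simp: gh \<phi>_def)
  qed (auto simp: \<phi>_def carrier_integer_mod_group split: quat_unit.split)
  then interpret group_hom ?G ?V \<phi>
    by (intro group_hom.intro group_hom_axioms.intro G V)
  have "kernel ?G ?V \<phi> = group_center ?G"
    unfolding group_center_Q8_times[OF assms]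
    by (auto simp: kernel_def \<phi>_def split: quat_unit.splits)
  moreover have "\<phi> ` carrier ?G = carrier ?V"
  proof
    show "carrier ?V \<subseteq> \<phi> ` carrier ?G"
    proof
      fix z assume "z \<in> carrier ?V"
      then have "z \<in> {(0, 0), (1, 0), (0, 1), (1, 1)}"
        by (auto simp: carrier_integer_mod_group)
      moreover have "\<phi> ((False, U1), \<one>\<^bsub>A\<^esub>) = (0, 0)" "\<phi> ((False, UI), \<one>\<^bsub>A\<^esub>) = (1, 0)"
        "\<phi> ((False, UJ), \<one>\<^bsub>A\<^esub>) = (0, 1)" "\<phi> ((False, UK), \<one>\<^bsub>A\<^esub>) = (1, 1)"
        by (simp_all add: \<phi>_def)
      moreover have "((False, u), \<one>\<^bsub>A\<^esub>) \<in> carrier ?G" for u by simp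
      ultimately show "z \<in> \<phi> ` carrier ?G" by (metis (no_types, lifting) image_eqI insertE empty_iff)
    qed
  qed (use hom_closed in blast)
  ultimately show ?thesis
    using FactGroup_iso G by (auto simp: SLC_group_def)
qed

end

theory Submission
  imports Defs "HOL-Number_Theory.Cong"
begin

text \<open>
  The group ring over a finite product of rings is the product of the group rings, and a product is
  star-clean iff its factors are (\<open>star_clean_product\<close>). So let the coefficients form a field
  \<open>F\<close>; its characteristic is not 2. Let \<open>m\<close> be the exponent of \<open>A\<close>, which is the order
  of an element \<open>g\<close>.

  A homomorphism from \<open>A\<close> to the multiplicative group of an extension field \<open>K\<close> of \<open>F\<close>
  turns elements of the group ring of \<open>Q8 \<times>\<times> A\<close> over \<open>F\<close> into elements of the group
  ring of \<open>Q8\<close> over \<open>K\<close> (\<open>twist\<close>), compatibly with the involutions. As 2 is invertible,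
  the latter ring is the sum of four copies of \<open>K\<close>, fixed by the involution, and of the quaternion
  algebra over \<open>K\<close>, where the involution is the usual conjugation and only scalars are fixed.
  The norm of that algebra is a sum of four squares, and it has a nontrivial zero iff
  \<open>X\<^sup>2 + Y\<^sup>2 + Z\<^sup>2 + 1 = 0\<close> is solvable in \<open>K\<close>.

  Suppose that there is no solution in the field generated by an \<open>m\<close>-th root of unity \<open>\<zeta>\<close>.
  Then the group ring of \<open>Q8\<close> over that field is reduced, and the involution fixes its idempotents.
  The characters of \<open>A\<close> with values in the powers of \<open>\<zeta>\<close> separate the elements of the
  group ring of \<open>A\<close> (\<open>characters_separate\<close>), so the group ring of \<open>Q8 \<times>\<times> A\<close>
  over \<open>F\<close> has the same two properties. It also has finite dimension, so for each element \<open>x\<close>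
  there are \<open>k\<close> and \<open>q\<close> with \<open>x\<^sup>k = x\<^sup>k x q\<close> and \<open>x q = q x\<close>
  (\<open>strongly_pi_regular\<close>). In a reduced ring
  this improves to \<open>x = x\<^sup>2 q\<close>; then \<open>e = x q\<close> is idempotent, and \<open>x\<close> is the sum of the
  unit \<open>x - (1 - e)\<close> and the projection \<open>1 - e\<close> (\<open>star_clean_of_reduced\<close>).

  Conversely, let \<open>(x, y, z)\<close> be a solution in the field \<open>K\<close> generated by a primitive
  \<open>d\<close>-th root of unity, where \<open>d\<close> is the order of an element, so that \<open>d\<close> divides \<open>m\<close>.
  Some character of \<open>A\<close> sends \<open>g\<close> to that root
  (\<open>exists_character_of_generator\<close>). It maps the group ring of \<open>A\<close> onto \<open>K\<close>, hence
  \<open>twist\<close> is onto as well. Lift an element with quaternion part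
  \<open>(1 + x i + y j + z k) / 2\<close>. The quaternion part of a projection is 0 or 1, and subtracting
  either leaves a quaternion of norm 0. So the lift is not the sum of a unit and a projection
  (\<open>not_unit_plus_projection\<close>).
\<close>

section \<open>Finite sums\<close>

context abelian_monoid
begin

lemma finsum_swap:
  assumes "finite I" "finite J" "\<And>i j. i \<in> I \<Longrightarrow> j \<in> J \<Longrightarrow> f i j \<in> carrier G"
  shows "(\<Oplus>i\<in>I. \<Oplus>j\<in>J. f i j) = (\<Oplus>j\<in>J. \<Oplus>i\<in>I. f i j)"
  using assms(1,3)
proof (induction I rule: finite_induct)
  case empty
  then show ?case by (simp add: finsum_zero)
next
  case (insert i I)
  have "(\<Oplus>j\<in>J. \<Oplus>i\<in>insert i I. f i j) = (\<Oplus>j\<in>J. f i j \<oplus> (\<Oplus>i\<in>I. f i j))"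
    using insert by (intro finsum_cong') (auto simp: finsum_insert Pi_def intro!: finsum_closed)
  also have "\<dots> = (\<Oplus>j\<in>J. f i j) \<oplus> (\<Oplus>j\<in>J. \<Oplus>i\<in>I. f i j)"
    using insert by (intro finsum_addf) (auto simp: Pi_def intro!: finsum_closed)
  finally show ?case
    using insert by (simp add: finsum_insert Pi_def finsum_closed)
qed

lemma finsum_bij:
  assumes "bij_betw h I J" "\<And>j. j \<in> J \<Longrightarrow> f j \<in> carrier G"
  shows "(\<Oplus>i\<in>I. f (h i)) = (\<Oplus>j\<in>J. f j)"
proof -
  have "finsum G f (h ` I) = (\<Oplus>i\<in>I. f (h i))"
    using assms by (intro finsum_reindex) (auto simp: bij_betw_def)
  then show ?thesis using assms by (simp add: bij_betw_def)
qed

lemma finsum_eqI: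
  assumes "\<And>i. i \<in> I \<Longrightarrow> f i \<in> carrier G" "\<And>i. i \<in> I \<Longrightarrow> f i = g i"
  shows "finsum G f I = finsum G g I"
  using assms by (intro finsum_cong') (auto simp: Pi_def)

lemma finsum_Times:
  assumes "finite I" "finite J" "\<And>i j. i \<in> I \<Longrightarrow> j \<in> J \<Longrightarrow> f (i, j) \<in> carrier G"
  shows "(\<Oplus>p\<in>I \<times> J. f p) = (\<Oplus>i\<in>I. \<Oplus>j\<in>J. f (i, j))"
  using assms(1,3)
proof (induction I rule: finite_induct)
  case empty
  then show ?case by simp
next
  case (insert i I)
  have eq: "insert i I \<times> J = {i} \<times> J \<union> I \<times> J" by auto
  have row: "(\<Oplus>p\<in>{i} \<times> J. f p) = (\<Oplus>j\<in>J. f (i, j))"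
    using insert by (subst finsum_bij[of "\<lambda>j. (i, j)" J "{i} \<times> J" f, symmetric])
      (auto simp: bij_betw_def inj_on_def)
  have "finsum G f (insert i I \<times> J) = (\<Oplus>p\<in>{i} \<times> J. f p) \<oplus> (\<Oplus>p\<in>I \<times> J. f p)"
    unfolding eq using insert assms(2) by (intro finsum_Un_disjoint) auto
  then show ?case
    using insert by (simp add: row finsum_insert Pi_def finsum_closed)
qed

end

section \<open>The group ring of a finite group\<close>

locale finite_group_ring = cring R + G: group G for R (structure) and G (structure) +
  assumes finite_G: "finite (carrier G)"
begin

abbreviation RG where "RG \<equiv> group_ring R G"

lemma carrier_RG: "carrier RG = carrier G \<rightarrow>\<^sub>E carrier R"
  using finite_G by (auto simp: group_ring_def)

lemma RG_closed [simp, intro]: "f \<in> carrier RG \<Longrightarrow> x \<in> carrier G \<Longrightarrow> f x \<in> carrier R"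
  by (auto simp: carrier_RG)

lemma RG_memI: "(\<And>x. x \<in> carrier G \<Longrightarrow> f x \<in> carrier R) \<Longrightarrow> (\<lambda>x\<in>carrier G. f x) \<in> carrier RG"
  by (auto simp: carrier_RG)

lemma RG_eqI:
  "f \<in> carrier RG \<Longrightarrow> h \<in> carrier RG \<Longrightarrow> (\<And>x. x \<in> carrier G \<Longrightarrow> f x = h x) \<Longrightarrow> f = h"
  unfolding carrier_RG by (rule PiE_ext)

text \<open>
  Summing over the whole group instead of the support of \<open>f\<close> makes the index set
  invariant under translation.
\<close>

lemma RG_mult:
  assumes "f \<in> carrier RG" "h \<in> carrier RG" "x \<in> carrier G"
  shows "(f \<otimes>\<^bsub>RG\<^esub> h) x = (\<Oplus>y\<in>carrier G. f y \<otimes> h (inv\<^bsub>G\<^esub> y \<otimes>\<^bsub>G\<^esub> x))"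
proof -
  have "(\<Oplus>y\<in>{y \<in> carrier G. f y \<noteq> \<zero>}. f y \<otimes> h (inv\<^bsub>G\<^esub> y \<otimes>\<^bsub>G\<^esub> x))
      = (\<Oplus>y\<in>carrier G. f y \<otimes> h (inv\<^bsub>G\<^esub> y \<otimes>\<^bsub>G\<^esub> x))"
    using assms finite_G by (intro add.finprod_mono_neutral_cong_left) auto
  then show ?thesis using assms by (simp add: group_ring_def)
qed

lemma RG_mult_closed [simp, intro]:
  assumes "f \<in> carrier RG" "h \<in> carrier RG"
  shows "f \<otimes>\<^bsub>RG\<^esub> h \<in> carrier RG"
proof -
  have "f \<otimes>\<^bsub>RG\<^esub> h = (\<lambda>x\<in>carrier G. (\<Oplus>y\<in>carrier G. f y \<otimes> h (inv\<^bsub>G\<^esub> y \<otimes>\<^bsub>G\<^esub> x)))"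
    using RG_mult[OF assms] by (auto simp: fun_eq_iff) (simp add: group_ring_def)
  also have "\<dots> \<in> carrier RG"
    using assms by (intro RG_memI finsum_closed) auto
  finally show ?thesis .
qed

lemma RG_add: "x \<in> carrier G \<Longrightarrow> (f \<oplus>\<^bsub>RG\<^esub> h) x = f x \<oplus> h x"
  and RG_zero: "x \<in> carrier G \<Longrightarrow> \<zero>\<^bsub>RG\<^esub> x = \<zero>"
  and RG_one: "x \<in> carrier G \<Longrightarrow> \<one>\<^bsub>RG\<^esub> x = (if x = \<one>\<^bsub>G\<^esub> then \<one> else \<zero>)"
  by (simp_all add: group_ring_def)

lemma RG_add_closed [simp, intro]:
  assumes "f \<in> carrier RG" "h \<in> carrier RG" shows "f \<oplus>\<^bsub>RG\<^esub> h \<in> carrier RG"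
  using RG_memI[of "\<lambda>x. f x \<oplus> h x"] assms by (simp add: group_ring_def)

lemma RG_zero_closed [simp, intro]: "\<zero>\<^bsub>RG\<^esub> \<in> carrier RG"
  and RG_one_closed [simp, intro]: "\<one>\<^bsub>RG\<^esub> \<in> carrier RG"
  using RG_memI[of "\<lambda>_. \<zero>"] RG_memI[of "\<lambda>x. if x = \<one>\<^bsub>G\<^esub> then \<one> else \<zero>"]
  by (simp_all add: group_ring_def)

lemma bij_left_translation: "z \<in> carrier G \<Longrightarrow> bij_betw (\<lambda>w. z \<otimes>\<^bsub>G\<^esub> w) (carrier G) (carrier G)"
  by (rule bij_betw_byWitness[where f' = "\<lambda>w. inv\<^bsub>G\<^esub> z \<otimes>\<^bsub>G\<^esub> w"])
    (auto simp: G.m_assoc[symmetric])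

text \<open>Both sides are double sums; the substitution \<open>y = z w\<close> matches them.\<close>

lemma RG_assoc:
  assumes "f \<in> carrier RG" "g \<in> carrier RG" "h \<in> carrier RG"
  shows "f \<otimes>\<^bsub>RG\<^esub> g \<otimes>\<^bsub>RG\<^esub> h = f \<otimes>\<^bsub>RG\<^esub> (g \<otimes>\<^bsub>RG\<^esub> h)"
proof (rule RG_eqI)
  fix x assume x: "x \<in> carrier G"
  have "(f \<otimes>\<^bsub>RG\<^esub> g \<otimes>\<^bsub>RG\<^esub> h) x
      = (\<Oplus>y\<in>carrier G. \<Oplus>z\<in>carrier G. f z \<otimes> (g (inv\<^bsub>G\<^esub> z \<otimes>\<^bsub>G\<^esub> y) \<otimes> h (inv\<^bsub>G\<^esub> y \<otimes>\<^bsub>G\<^esub> x)))"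
    using assms x finite_G
    by (subst RG_mult) (auto simp: RG_mult finsum_ldistr m_assoc intro!: finsum_eqI)
  also have "\<dots> = (\<Oplus>z\<in>carrier G. \<Oplus>y\<in>carrier G. f z \<otimes> (g (inv\<^bsub>G\<^esub> z \<otimes>\<^bsub>G\<^esub> y) \<otimes> h (inv\<^bsub>G\<^esub> y \<otimes>\<^bsub>G\<^esub> x)))"
    using assms x by (intro finsum_swap finite_G) auto
  also have "\<dots> = (\<Oplus>z\<in>carrier G. \<Oplus>w\<in>carrier G.
      f z \<otimes> (g w \<otimes> h (inv\<^bsub>G\<^esub> w \<otimes>\<^bsub>G\<^esub> (inv\<^bsub>G\<^esub> z \<otimes>\<^bsub>G\<^esub> x))))"
  proof (rule finsum_eqI)
    fix z assume z: "z \<in> carrier G"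
    have "(\<Oplus>y\<in>carrier G. f z \<otimes> (g (inv\<^bsub>G\<^esub> z \<otimes>\<^bsub>G\<^esub> y) \<otimes> h (inv\<^bsub>G\<^esub> y \<otimes>\<^bsub>G\<^esub> x)))
        = (\<Oplus>w\<in>carrier G. f z \<otimes> (g (inv\<^bsub>G\<^esub> z \<otimes>\<^bsub>G\<^esub> (z \<otimes>\<^bsub>G\<^esub> w)) \<otimes> h (inv\<^bsub>G\<^esub> (z \<otimes>\<^bsub>G\<^esub> w) \<otimes>\<^bsub>G\<^esub> x)))"
      using assms x z
      by (intro finsum_bij[OF bij_left_translation[OF z], symmetric]) auto
    also have "\<dots> = (\<Oplus>w\<in>carrier G. f z \<otimes> (g w \<otimes> h (inv\<^bsub>G\<^esub> w \<otimes>\<^bsub>G\<^esub> (inv\<^bsub>G\<^esub> z \<otimes>\<^bsub>G\<^esub> x))))"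
      using assms x z
      by (intro finsum_eqI) (auto simp: G.m_assoc[symmetric] G.inv_mult_group)
    finally show "(\<Oplus>y\<in>carrier G. f z \<otimes> (g (inv\<^bsub>G\<^esub> z \<otimes>\<^bsub>G\<^esub> y) \<otimes> h (inv\<^bsub>G\<^esub> y \<otimes>\<^bsub>G\<^esub> x))) = \<dots>" .
  qed (use assms x in \<open>auto intro!: finsum_closed\<close>)
  also have "\<dots> = (f \<otimes>\<^bsub>RG\<^esub> (g \<otimes>\<^bsub>RG\<^esub> h)) x"
    using assms x finite_G
    by (subst RG_mult) (auto simp: RG_mult finsum_rdistr intro!: finsum_eqI finsum_closed)
  finally show "(f \<otimes>\<^bsub>RG\<^esub> g \<otimes>\<^bsub>RG\<^esub> h) x = (f \<otimes>\<^bsub>RG\<^esub> (g \<otimes>\<^bsub>RG\<^esub> h)) x" .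
qed (use assms in auto)

definition scalar :: "'a \<Rightarrow> 'c \<Rightarrow> 'a" where
  "scalar c = (\<lambda>x\<in>carrier G. if x = \<one>\<^bsub>G\<^esub> then c else \<zero>)"

lemma scalar_closed [simp, intro]: "c \<in> carrier R \<Longrightarrow> scalar c \<in> carrier RG"
  unfolding scalar_def by (intro RG_memI) auto

lemma scalar_mult:
  assumes "c \<in> carrier R" "f \<in> carrier RG" "x \<in> carrier G"
  shows "(scalar c \<otimes>\<^bsub>RG\<^esub> f) x = c \<otimes> f x" "(f \<otimes>\<^bsub>RG\<^esub> scalar c) x = f x \<otimes> c"
proof -
  have "(scalar c \<otimes>\<^bsub>RG\<^esub> f) x = (\<Oplus>y\<in>carrier G. if \<one>\<^bsub>G\<^esub> = y then c \<otimes> f (inv\<^bsub>G\<^esub> y \<otimes>\<^bsub>G\<^esub> x) else \<zero>)"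
    using assms by (simp only: RG_mult scalar_closed) (auto simp: scalar_def intro!: finsum_eqI)
  also have "\<dots> = c \<otimes> f x"
    using assms finite_G by (subst finsum_singleton) auto
  finally show "(scalar c \<otimes>\<^bsub>RG\<^esub> f) x = c \<otimes> f x" .
  have iff: "inv\<^bsub>G\<^esub> y \<otimes>\<^bsub>G\<^esub> x = \<one>\<^bsub>G\<^esub> \<longleftrightarrow> x = y" if "y \<in> carrier G" for y
    using that assms(3) by (metis G.inv_closed G.inv_equality G.inv_inv G.l_inv)
  have "(f \<otimes>\<^bsub>RG\<^esub> scalar c) x = (\<Oplus>y\<in>carrier G. if x = y then f y \<otimes> c else \<zero>)"
    using assms by (simp only: RG_mult scalar_closed) (auto simp: scalar_def iff intro!: finsum_eqI)
  also have "\<dots> = f x \<otimes> c"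
    using assms finite_G by (subst finsum_singleton) auto
  finally show "(f \<otimes>\<^bsub>RG\<^esub> scalar c) x = f x \<otimes> c" .
qed

lemma scalar_one: "scalar \<one> = \<one>\<^bsub>RG\<^esub>"
  by (simp add: scalar_def group_ring_def)

lemma ring_RG: "ring RG"
proof (rule ringI)
  show "abelian_group RG"
  proof (rule abelian_groupI)
    fix f assume f: "f \<in> carrier RG"
    have "(\<lambda>x\<in>carrier G. \<ominus> f x) \<in> carrier RG" using f by (intro RG_memI) auto
    moreover have "(\<lambda>x\<in>carrier G. \<ominus> f x) \<oplus>\<^bsub>RG\<^esub> f = \<zero>\<^bsub>RG\<^esub>"
      using f calculation by (intro RG_eqI) (auto simp: RG_add RG_zero l_neg)
    ultimately show "\<exists>g\<in>carrier RG. g \<oplus>\<^bsub>RG\<^esub> f = \<zero>\<^bsub>RG\<^esub>" by blast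
  qed (auto simp: RG_add RG_zero a_ac intro!: RG_eqI)
  show "monoid RG"
    by (rule monoidI)
      (auto simp: RG_assoc scalar_one[symmetric] scalar_mult intro!: RG_eqI)
next
  fix f g h assume fgh: "f \<in> carrier RG" "g \<in> carrier RG" "h \<in> carrier RG"
  show "(f \<oplus>\<^bsub>RG\<^esub> g) \<otimes>\<^bsub>RG\<^esub> h = f \<otimes>\<^bsub>RG\<^esub> h \<oplus>\<^bsub>RG\<^esub> g \<otimes>\<^bsub>RG\<^esub> h"
  proof (rule RG_eqI)
    fix x assume x: "x \<in> carrier G"
    have "((f \<oplus>\<^bsub>RG\<^esub> g) \<otimes>\<^bsub>RG\<^esub> h) x = (\<Oplus>y\<in>carrier G. f y \<otimes> h (inv\<^bsub>G\<^esub> y \<otimes>\<^bsub>G\<^esub> x) \<oplus> g y \<otimes> h (inv\<^bsub>G\<^esub> y \<otimes>\<^bsub>G\<^esub> x))"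
      using fgh x by (simp only: RG_mult RG_add_closed) (intro finsum_eqI; simp add: RG_add l_distr)
    also have "\<dots> = (f \<otimes>\<^bsub>RG\<^esub> h) x \<oplus> (g \<otimes>\<^bsub>RG\<^esub> h) x"
      using fgh x by (simp add: RG_mult)
    finally show "((f \<oplus>\<^bsub>RG\<^esub> g) \<otimes>\<^bsub>RG\<^esub> h) x = (f \<otimes>\<^bsub>RG\<^esub> h \<oplus>\<^bsub>RG\<^esub> g \<otimes>\<^bsub>RG\<^esub> h) x"
      using x by (simp add: RG_add)
  qed (use fgh in auto)
  show "h \<otimes>\<^bsub>RG\<^esub> (f \<oplus>\<^bsub>RG\<^esub> g) = h \<otimes>\<^bsub>RG\<^esub> f \<oplus>\<^bsub>RG\<^esub> h \<otimes>\<^bsub>RG\<^esub> g"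
  proof (rule RG_eqI)
    fix x assume x: "x \<in> carrier G"
    have "(h \<otimes>\<^bsub>RG\<^esub> (f \<oplus>\<^bsub>RG\<^esub> g)) x = (\<Oplus>y\<in>carrier G. h y \<otimes> f (inv\<^bsub>G\<^esub> y \<otimes>\<^bsub>G\<^esub> x) \<oplus> h y \<otimes> g (inv\<^bsub>G\<^esub> y \<otimes>\<^bsub>G\<^esub> x))"
      using fgh x by (simp only: RG_mult RG_add_closed) (intro finsum_eqI; simp add: RG_add r_distr)
    also have "\<dots> = (h \<otimes>\<^bsub>RG\<^esub> f) x \<oplus> (h \<otimes>\<^bsub>RG\<^esub> g) x"
      using fgh x by (simp add: RG_mult)
    finally show "(h \<otimes>\<^bsub>RG\<^esub> (f \<oplus>\<^bsub>RG\<^esub> g)) x = (h \<otimes>\<^bsub>RG\<^esub> f \<oplus>\<^bsub>RG\<^esub> h \<otimes>\<^bsub>RG\<^esub> g) x"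
      using x by (simp add: RG_add)
  qed (use fgh in auto)
qed

lemma RG_finsum:
  assumes "finite I" "\<And>i. i \<in> I \<Longrightarrow> F i \<in> carrier RG" "x \<in> carrier G"
  shows "(finsum RG F I) x = (\<Oplus>i\<in>I. F i x)"
proof -
  interpret RG: ring RG by (rule ring_RG)
  from assms(1,2) show ?thesis
    by (induction I rule: finite_induct)
      (use assms(3) in \<open>auto simp: RG_zero RG_add Pi_def\<close>)
qed

end

text \<open>
  The substitution that replaces \<open>y\<close> by \<open>\<tau> (y\<^sup>-\<^sup>1 x)\<close>
  exchanges the two arguments of a convolution at \<open>\<tau> x\<close>, up to the order of the
  factors, which commute.
\<close>

lemma (in finite_group_ring) involution_mult:
  assumes \<tau>: "\<And>x. x \<in> carrier G \<Longrightarrow> \<tau> x \<in> carrier G"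
      "\<And>x. x \<in> carrier G \<Longrightarrow> \<tau> (\<tau> x) = x"
      "\<And>x y. x \<in> carrier G \<Longrightarrow> y \<in> carrier G \<Longrightarrow> \<tau> (x \<otimes>\<^bsub>G\<^esub> y) = \<tau> y \<otimes>\<^bsub>G\<^esub> \<tau> x"
    and f: "f \<in> carrier RG" and h: "h \<in> carrier RG" and x: "x \<in> carrier G"
  shows "(f \<otimes>\<^bsub>RG\<^esub> h) (\<tau> x) = ((\<lambda>x\<in>carrier G. h (\<tau> x)) \<otimes>\<^bsub>RG\<^esub> (\<lambda>x\<in>carrier G. f (\<tau> x))) x"
proof -
  have mem: "(\<lambda>x\<in>carrier G. h (\<tau> x)) \<in> carrier RG" "(\<lambda>x\<in>carrier G. f (\<tau> x)) \<in> carrier RG"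
    using f h \<tau>(1) by (auto intro!: RG_memI)
  have \<tau>1: "\<tau> \<one>\<^bsub>G\<^esub> = \<one>\<^bsub>G\<^esub>"
    by (metis G.one_closed G.r_one \<tau>)
  have \<tau>inv: "\<tau> (inv\<^bsub>G\<^esub> y) = inv\<^bsub>G\<^esub> (\<tau> y)" if "y \<in> carrier G" for y
    by (metis G.inv_closed G.inv_equality G.r_inv \<tau>(1) \<tau>(3) \<tau>1 that)
  have "bij_betw (\<lambda>y. \<tau> (inv\<^bsub>G\<^esub> y \<otimes>\<^bsub>G\<^esub> x)) (carrier G) (carrier G)"
    by (rule bij_betw_byWitness[where f' = "\<lambda>z. x \<otimes>\<^bsub>G\<^esub> inv\<^bsub>G\<^esub> (\<tau> z)"])
      (use x \<tau> \<tau>inv in \<open>auto simp: G.inv_mult_group G.m_assoc[symmetric]\<close>)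
  then have "(\<Oplus>y\<in>carrier G. f (\<tau> (inv\<^bsub>G\<^esub> y \<otimes>\<^bsub>G\<^esub> x)) \<otimes> h (inv\<^bsub>G\<^esub> (\<tau> (inv\<^bsub>G\<^esub> y \<otimes>\<^bsub>G\<^esub> x)) \<otimes>\<^bsub>G\<^esub> \<tau> x))
      = (f \<otimes>\<^bsub>RG\<^esub> h) (\<tau> x)"
    using f h x \<tau>(1)
    by (subst finsum_bij[where h = "\<lambda>y. \<tau> (inv\<^bsub>G\<^esub> y \<otimes>\<^bsub>G\<^esub> x)" and J = "carrier G" and
        f = "\<lambda>z. f z \<otimes> h (inv\<^bsub>G\<^esub> z \<otimes>\<^bsub>G\<^esub> \<tau> x)"]) (auto simp: RG_mult)
  moreover have "inv\<^bsub>G\<^esub> (\<tau> (inv\<^bsub>G\<^esub> y \<otimes>\<^bsub>G\<^esub> x)) \<otimes>\<^bsub>G\<^esub> \<tau> x = \<tau> y" if "y \<in> carrier G" for y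
    using x that \<tau>(1) by (simp add: \<tau>(3) \<tau>inv G.inv_mult_group G.m_assoc)
  ultimately have "(\<Oplus>y\<in>carrier G. f (\<tau> (inv\<^bsub>G\<^esub> y \<otimes>\<^bsub>G\<^esub> x)) \<otimes> h (\<tau> y)) = (f \<otimes>\<^bsub>RG\<^esub> h) (\<tau> x)"
    using f h x \<tau>(1) by (simp cong: finsum_cong)
  then show ?thesis
    using f h x \<tau>(1) by (subst RG_mult[OF mem x]) (simp add: m_comm cong: finsum_cong)
qed

text \<open>
  Since \<open>\<tau>\<close> is its own inverse, the sum that defines the coefficient at
  \<open>x\<close> has at most the term at \<open>\<tau> x\<close>.
\<close>

lemma (in finite_group_ring) linear_extension_apply:
  assumes \<tau>: "\<And>x. x \<in> carrier G \<Longrightarrow> \<tau> x \<in> carrier G"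
      "\<And>x. x \<in> carrier G \<Longrightarrow> \<tau> (\<tau> x) = x" and f: "f \<in> carrier RG"
  shows "linear_extension R G \<tau> f = (\<lambda>x\<in>carrier G. f (\<tau> x))"
proof -
  have "(\<Oplus>g\<in>{g \<in> carrier G. f g \<noteq> \<zero> \<and> \<tau> g = x}. f g) = f (\<tau> x)" if x: "x \<in> carrier G" for x
  proof -
    have eq: "{g \<in> carrier G. f g \<noteq> \<zero> \<and> \<tau> g = x} = (if f (\<tau> x) = \<zero> then {} else {\<tau> x})"
      using x \<tau> by auto
    show ?thesis using f x \<tau>(1) by (auto simp: eq)
  qed
  then show ?thesis by (auto simp: linear_extension_def fun_eq_iff)
qed

lemma (in finite_group_ring) ring_involution_linear_extension:
  assumes \<tau>: "\<And>x. x \<in> carrier G \<Longrightarrow> \<tau> x \<in> carrier G"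
      "\<And>x. x \<in> carrier G \<Longrightarrow> \<tau> (\<tau> x) = x"
      "\<And>x y. x \<in> carrier G \<Longrightarrow> y \<in> carrier G \<Longrightarrow> \<tau> (x \<otimes>\<^bsub>G\<^esub> y) = \<tau> y \<otimes>\<^bsub>G\<^esub> \<tau> x"
  shows "ring_involution RG (linear_extension R G \<tau>)"
proof -
  note app = linear_extension_apply[OF \<tau>(1,2)]
  have closed: "linear_extension R G \<tau> f \<in> carrier RG" if "f \<in> carrier RG" for f
    using that \<tau>(1) by (simp add: app RG_memI)
  show ?thesis
    unfolding ring_involution_def
  proof (intro conjI ballI)
    fix f h assume fh: "f \<in> carrier RG" "h \<in> carrier RG"
    show "linear_extension R G \<tau> (f \<oplus>\<^bsub>RG\<^esub> h) = linear_extension R G \<tau> f \<oplus>\<^bsub>RG\<^esub> linear_extension R G \<tau> h"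
      using fh closed by (intro RG_eqI) (auto simp: app RG_add \<tau>)
    show "linear_extension R G \<tau> (f \<otimes>\<^bsub>RG\<^esub> h) = linear_extension R G \<tau> h \<otimes>\<^bsub>RG\<^esub> linear_extension R G \<tau> f"
      using fh closed by (intro RG_eqI) (auto simp: app involution_mult[OF \<tau>])
    have "linear_extension R G \<tau> (linear_extension R G \<tau> f) x = f x" if "x \<in> carrier G" for x
      using that fh \<tau>(1,2) by (subst app[OF _ _ closed]) (simp_all add: app)
    then show "linear_extension R G \<tau> (linear_extension R G \<tau> f) = f"
      using fh closed by (intro RG_eqI) auto
  qed (use closed in auto)
qed

section \<open>Star-clean rings\<close>

text \<open>
  The square of \<open>x\<^sup>n\<close> is a multiple of \<open>x\<^sup>n\<^sup>+\<^sup>1\<close>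
  for positive \<open>n\<close>, so the exponent of a vanishing power can be lowered to 1.
\<close>

lemma (in ring) reduced_nilpotent:
  assumes reduced: "\<And>x. x \<in> carrier R \<Longrightarrow> x \<otimes> x = \<zero> \<Longrightarrow> x = \<zero>"
    and x: "x \<in> carrier R" and "x [^] (Suc n) = \<zero>"
  shows "x = \<zero>"
  using assms(3)
proof (induction n)
  case 0
  then show ?case using x by simp
next
  case (Suc n)
  have "x [^] Suc n \<otimes> x [^] Suc n = x [^] (Suc (Suc n)) \<otimes> x [^] n"
    by (simp only: nat_pow_mult[OF x]) simp
  also have "\<dots> = \<zero>" using Suc.prems x by simp
  finally have "x [^] Suc n = \<zero>" by (rule reduced[rotated]) (use x in simp)
  then show ?case by (rule Suc.IH)
qed

text \<open>
  The element \<open>x (1 - x q)\<close> is nilpotent, since \<open>x\<^sup>m\<close> annihilates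
  \<open>1 - x q\<close> and the two factors commute.
\<close>

lemma (in ring) strongly_regular_of_reduced:
  assumes reduced: "\<And>x. x \<in> carrier R \<Longrightarrow> x \<otimes> x = \<zero> \<Longrightarrow> x = \<zero>"
    and x: "x \<in> carrier R" and q: "q \<in> carrier R" and comm: "q \<otimes> x = x \<otimes> q"
    and pow: "x [^] m = x [^] Suc m \<otimes> q"
  shows "x \<otimes> (x \<otimes> q) = x"
proof -
  define v where "v = \<one> \<ominus> x \<otimes> q"
  have v: "v \<in> carrier R" using x q by (simp add: v_def)
  have xq: "x \<otimes> q \<otimes> x = x \<otimes> (x \<otimes> q)" using x q comm by (simp add: m_assoc)
  have xv: "x \<otimes> v = x \<ominus> x \<otimes> (x \<otimes> q)" and vx: "v \<otimes> x = x \<ominus> x \<otimes> (x \<otimes> q)"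
    using x q by (simp_all add: v_def minus_eq r_distr l_distr r_minus l_minus xq)
  have "x [^] m \<otimes> v = \<zero>"
  proof -
    have "x [^] m \<otimes> (x \<otimes> q) = x [^] Suc m \<otimes> q" using x q by (simp add: m_assoc)
    then have "x [^] m \<otimes> (x \<otimes> q) = x [^] m" by (simp only: pow[symmetric])
    then show ?thesis using x q by (simp add: v_def minus_eq r_distr r_minus r_neg)
  qed
  then have "x [^] Suc m \<otimes> v = \<zero>"
    using x v by (simp only: nat_pow_Suc2[OF x] m_assoc nat_pow_closed r_null)
  moreover have "(x \<otimes> v) [^] Suc m = x [^] Suc m \<otimes> v [^] Suc m"
    using x v xv vx by (intro pow_mult_distrib) auto
  ultimately have "(x \<otimes> v) [^] Suc m = \<zero>"
    using x v by (simp only: nat_pow_Suc2[OF v] m_assoc[symmetric] nat_pow_closed m_closed l_null)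
  then have "x \<otimes> v = \<zero>"
    using x v by - (rule reduced_nilpotent, rule reduced, assumption+, simp, assumption)
  then show ?thesis using x q xv by simp
qed

text \<open>
  Write \<open>x = x\<^sup>2 q\<close> and \<open>e = x q\<close>. The idempotent \<open>e\<close>
  acts as the identity on \<open>x\<close>, which is invertible relative to \<open>e\<close> with
  inverse \<open>e q\<close>. With \<open>f = 1 - e\<close>, which annihilates \<open>x\<close>,
  the element \<open>x - f\<close> is a unit and \<open>f\<close> is a projection.
\<close>

lemma (in ring) star_clean_of_reduced:
  assumes inv: "ring_involution R \<tau>"
    and reduced: "\<And>x. x \<in> carrier R \<Longrightarrow> x \<otimes> x = \<zero> \<Longrightarrow> x = \<zero>"
    and sym: "\<And>e. e \<in> carrier R \<Longrightarrow> e \<otimes> e = e \<Longrightarrow> \<tau> e = e"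
    and reg: "\<And>x. x \<in> carrier R \<Longrightarrow> \<exists>m. \<exists>q\<in>carrier R. q \<otimes> x = x \<otimes> q \<and> x [^] m = x [^] Suc m \<otimes> q"
  shows "star_clean R \<tau>"
  unfolding star_clean_def
proof (intro conjI ballI)
  fix x assume x: "x \<in> carrier R"
  then obtain m q where q: "q \<in> carrier R" and comm: "q \<otimes> x = x \<otimes> q"
    and pow: "x [^] m = x [^] Suc m \<otimes> q" using reg by blast
  have xxq: "x \<otimes> (x \<otimes> q) = x"
    by (rule strongly_regular_of_reduced[OF _ x q comm pow]) (rule reduced)
  define e where "e = x \<otimes> q"
  have e: "e \<in> carrier R" and xe: "x \<otimes> e = x" and ex: "e \<otimes> x = x"
    using x q xxq by (simp_all add: e_def m_assoc comm)
  have ee: "e \<otimes> e = e"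
    using x q e ex by (metis e_def m_assoc)
  have qe: "q \<otimes> e = e \<otimes> q" using x q by (simp add: e_def comm flip: m_assoc)
  define f where "f = \<one> \<ominus> e"
  have f: "f \<in> carrier R" using e by (simp add: f_def)
  have xf: "x \<otimes> f = \<zero>" and fx: "f \<otimes> x = \<zero>" and ef: "e \<otimes> f = \<zero>" and fe: "f \<otimes> e = \<zero>"
    using x e xe ex ee by (simp_all add: f_def minus_eq r_distr l_distr r_minus l_minus r_neg)
  have ff: "f \<otimes> f = f"
  proof -
    have "f \<otimes> f = f \<otimes> \<one> \<ominus> f \<otimes> e"
      using e f by (subst (2) f_def) (simp add: minus_eq r_distr r_minus)
    then show ?thesis using f fe by (simp add: minus_eq)
  qed
  have one: "e \<oplus> f = \<one>" using e by (simp add: f_def minus_eq r_neg a_lcomm[of e \<one>])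
  have xeq: "x \<otimes> (e \<otimes> q) = e" and eqx: "e \<otimes> q \<otimes> x = e"
    using x q e by (simp_all add: m_assoc[symmetric] xe ee comm e_def[symmetric])
      (simp add: m_assoc comm e_def[symmetric] ee)
  have feq: "f \<otimes> (e \<otimes> q) = \<zero>" using e f q by (simp add: fe flip: m_assoc)
  have eqf: "e \<otimes> q \<otimes> f = \<zero>" using e f q by (simp add: m_assoc ef flip: qe)
  have "(x \<ominus> f) \<otimes> (e \<otimes> q \<ominus> f) = \<one>" "(e \<otimes> q \<ominus> f) \<otimes> (x \<ominus> f) = \<one>"
    using x e f q
    by (simp_all add: minus_eq l_distr r_distr l_minus r_minus xeq eqx feq eqf xf fx ff one)
  then have "x \<ominus> f \<in> Units R" using x e f q by (auto simp: Units_def)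
  moreover have "f \<in> projections R \<tau>" using f ff sym by (simp add: projections_def)
  moreover have "x = (x \<ominus> f) \<oplus> f" using x f by (simp add: minus_eq a_assoc l_neg)
  ultimately show "\<exists>u\<in>Units R. \<exists>p\<in>projections R \<tau>. x = u \<oplus> p" by blast
qed (use inv ring_axioms in auto)

lemma ring_hom_Units:
  assumes "h \<in> ring_hom S T" "u \<in> Units S"
  shows "h u \<in> Units T"
proof -
  obtain v where v: "v \<in> carrier S" "v \<otimes>\<^bsub>S\<^esub> u = \<one>\<^bsub>S\<^esub>" "u \<otimes>\<^bsub>S\<^esub> v = \<one>\<^bsub>S\<^esub>" "u \<in> carrier S"
    using assms(2) by (auto simp: Units_def)
  then have "h v \<otimes>\<^bsub>T\<^esub> h u = \<one>\<^bsub>T\<^esub>" "h u \<otimes>\<^bsub>T\<^esub> h v = \<one>\<^bsub>T\<^esub>" "h u \<in> carrier T" "h v \<in> carrier T"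
    using assms(1) by (metis ring_hom_mult ring_hom_one ring_hom_closed)+
  then show ?thesis by (auto simp: Units_def)
qed

text \<open>
  The maps \<open>h i\<close> identify \<open>S\<close> with the product of the rings \<open>Si
  i\<close>. Units and projections of a product are families of units and of projections.
\<close>

lemma star_clean_product:
  assumes S: "ring S" "ring_involution S \<tau>"
    and Si: "\<And>i. i \<in> I \<Longrightarrow> ring (Si i)" "\<And>i. i \<in> I \<Longrightarrow> ring_involution (Si i) (\<tau>i i)"
    and h: "\<And>i. i \<in> I \<Longrightarrow> h i \<in> ring_hom S (Si i)"
    and h\<tau>: "\<And>i x. i \<in> I \<Longrightarrow> x \<in> carrier S \<Longrightarrow> h i (\<tau> x) = \<tau>i i (h i x)"
    and inj: "\<And>x y. x \<in> carrier S \<Longrightarrow> y \<in> carrier S \<Longrightarrow> (\<And>i. i \<in> I \<Longrightarrow> h i x = h i y) \<Longrightarrow> x = y"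
    and surj: "\<And>y. (\<And>i. i \<in> I \<Longrightarrow> y i \<in> carrier (Si i)) \<Longrightarrow> \<exists>x\<in>carrier S. \<forall>i\<in>I. h i x = y i"
  shows "star_clean S \<tau> \<longleftrightarrow> (\<forall>i\<in>I. star_clean (Si i) (\<tau>i i))"
proof (intro iffI ballI)
  fix i assume clean: "star_clean S \<tau>" and i: "i \<in> I"
  interpret Si: ring "Si i" by (rule Si(1)[OF i])
  show "star_clean (Si i) (\<tau>i i)"
    unfolding star_clean_def
  proof (intro conjI ballI)
    fix y assume y: "y \<in> carrier (Si i)"
    have "(if j = i then y else \<zero>\<^bsub>Si j\<^esub>) \<in> carrier (Si j)" if "j \<in> I" for j
      using y ring.ring_simprules(2)[OF Si(1)[OF that]] by auto
    then have "\<exists>x\<in>carrier S. \<forall>j\<in>I. h j x = (if j = i then y else \<zero>\<^bsub>Si j\<^esub>)" by (rule surj)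
    then obtain x where x: "x \<in> carrier S" "h i x = y" using i by auto
    obtain u p where up: "u \<in> Units S" "p \<in> projections S \<tau>" "x = u \<oplus>\<^bsub>S\<^esub> p"
      using clean x(1) by (auto simp: star_clean_def)
    have "h i u \<in> Units (Si i)" using ring_hom_Units[OF h[OF i] up(1)] .
    moreover have "p \<in> carrier S" "u \<in> carrier S" using up by (auto simp: projections_def Units_def)
    then have "h i p \<in> projections (Si i) (\<tau>i i)" "y = h i u \<oplus>\<^bsub>Si i\<^esub> h i p"
      using up h[OF i] x(2)
      by (auto simp: projections_def ring_hom_closed ring_hom_add simp flip: ring_hom_mult[OF h[OF i]] h\<tau>[OF i])
    ultimately show "\<exists>u\<in>Units (Si i). \<exists>p\<in>projections (Si i) (\<tau>i i). y = u \<oplus>\<^bsub>Si i\<^esub> p" by blast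
  qed (use Si i in auto)
next
  assume clean: "\<forall>i\<in>I. star_clean (Si i) (\<tau>i i)"
  interpret S: ring S by (rule S)
  show "star_clean S \<tau>"
    unfolding star_clean_def
  proof (intro conjI ballI)
    fix x assume x: "x \<in> carrier S"
    have "\<forall>i\<in>I. \<exists>u v p. u \<in> carrier (Si i) \<and> v \<in> carrier (Si i) \<and> v \<otimes>\<^bsub>Si i\<^esub> u = \<one>\<^bsub>Si i\<^esub> \<and> u \<otimes>\<^bsub>Si i\<^esub> v = \<one>\<^bsub>Si i\<^esub> \<and>
        p \<in> carrier (Si i) \<and> p \<otimes>\<^bsub>Si i\<^esub> p = p \<and> \<tau>i i p = p \<and> h i x = u \<oplus>\<^bsub>Si i\<^esub> p"
    proof
      fix i assume i: "i \<in> I"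
      have "h i x \<in> carrier (Si i)" using i x h by (meson ring_hom_closed)
      then obtain u p where "u \<in> Units (Si i)" "p \<in> projections (Si i) (\<tau>i i)" "h i x = u \<oplus>\<^bsub>Si i\<^esub> p"
        using bspec[OF clean i] by (auto simp: star_clean_def)
      then show "\<exists>u v p. u \<in> carrier (Si i) \<and> v \<in> carrier (Si i) \<and> v \<otimes>\<^bsub>Si i\<^esub> u = \<one>\<^bsub>Si i\<^esub> \<and> u \<otimes>\<^bsub>Si i\<^esub> v = \<one>\<^bsub>Si i\<^esub> \<and>
          p \<in> carrier (Si i) \<and> p \<otimes>\<^bsub>Si i\<^esub> p = p \<and> \<tau>i i p = p \<and> h i x = u \<oplus>\<^bsub>Si i\<^esub> p"
        by (auto simp: Units_def projections_def)
    qed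
    from bchoice[OF this] obtain u where "\<forall>i\<in>I. \<exists>v p. u i \<in> carrier (Si i) \<and> v \<in> carrier (Si i) \<and>
        v \<otimes>\<^bsub>Si i\<^esub> u i = \<one>\<^bsub>Si i\<^esub> \<and> u i \<otimes>\<^bsub>Si i\<^esub> v = \<one>\<^bsub>Si i\<^esub> \<and>
        p \<in> carrier (Si i) \<and> p \<otimes>\<^bsub>Si i\<^esub> p = p \<and> \<tau>i i p = p \<and> h i x = u i \<oplus>\<^bsub>Si i\<^esub> p" by blast
    from bchoice[OF this] obtain v where "\<forall>i\<in>I. \<exists>p. u i \<in> carrier (Si i) \<and> v i \<in> carrier (Si i) \<and>
        v i \<otimes>\<^bsub>Si i\<^esub> u i = \<one>\<^bsub>Si i\<^esub> \<and> u i \<otimes>\<^bsub>Si i\<^esub> v i = \<one>\<^bsub>Si i\<^esub> \<and>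
        p \<in> carrier (Si i) \<and> p \<otimes>\<^bsub>Si i\<^esub> p = p \<and> \<tau>i i p = p \<and> h i x = u i \<oplus>\<^bsub>Si i\<^esub> p" by blast
    from bchoice[OF this] obtain p where uvp: "\<And>i. i \<in> I \<Longrightarrow> u i \<in> carrier (Si i)" "\<And>i. i \<in> I \<Longrightarrow> v i \<in> carrier (Si i)"
        "\<And>i. i \<in> I \<Longrightarrow> v i \<otimes>\<^bsub>Si i\<^esub> u i = \<one>\<^bsub>Si i\<^esub>" "\<And>i. i \<in> I \<Longrightarrow> u i \<otimes>\<^bsub>Si i\<^esub> v i = \<one>\<^bsub>Si i\<^esub>"
        "\<And>i. i \<in> I \<Longrightarrow> p i \<in> carrier (Si i)" "\<And>i. i \<in> I \<Longrightarrow> p i \<otimes>\<^bsub>Si i\<^esub> p i = p i"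
        "\<And>i. i \<in> I \<Longrightarrow> \<tau>i i (p i) = p i" "\<And>i. i \<in> I \<Longrightarrow> h i x = u i \<oplus>\<^bsub>Si i\<^esub> p i"
      by blast
    obtain u' where u': "u' \<in> carrier S" "\<And>i. i \<in> I \<Longrightarrow> h i u' = u i" using surj[of u] uvp(1) by blast
    obtain v' where v': "v' \<in> carrier S" "\<And>i. i \<in> I \<Longrightarrow> h i v' = v i" using surj[of v] uvp(2) by blast
    obtain p' where p': "p' \<in> carrier S" "\<And>i. i \<in> I \<Longrightarrow> h i p' = p i" using surj[of p] uvp(5) by blast
    have "v' \<otimes>\<^bsub>S\<^esub> u' = \<one>\<^bsub>S\<^esub>" "u' \<otimes>\<^bsub>S\<^esub> v' = \<one>\<^bsub>S\<^esub>" "p' \<otimes>\<^bsub>S\<^esub> p' = p'" "x = u' \<oplus>\<^bsub>S\<^esub> p'"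
      using u' v' p' x uvp by (auto intro!: inj simp: ring_hom_mult[OF h] ring_hom_one[OF h] ring_hom_add[OF h])
    moreover have "\<tau> p' = p'"
      using p' uvp(7) S(2) by (intro inj) (auto simp: h\<tau> ring_involution_def)
    ultimately show "\<exists>u\<in>Units S. \<exists>p\<in>projections S \<tau>. x = u \<oplus>\<^bsub>S\<^esub> p"
      using u' v' p' by (auto simp: Units_def projections_def)
  qed (use S in auto)
qed

section \<open>Finite dimension\<close>

text \<open>
  Gaussian elimination: a vector that does not vanish at the point \<open>x0\<close>, if there is
  one, is used to clear the coordinate at \<open>x0\<close> of all others, which reduces the claim
  to one vector and one coordinate less.
\<close>

lemma (in field) linear_dependence:
  assumes "finite I" "finite J" "card I < card J"
    and "\<And>j x. j \<in> J \<Longrightarrow> x \<in> I \<Longrightarrow> v j x \<in> carrier R"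
  shows "\<exists>c. (\<forall>j\<in>J. c j \<in> carrier R) \<and> (\<exists>j\<in>J. c j \<noteq> \<zero>) \<and> (\<forall>x\<in>I. (\<Oplus>j\<in>J. c j \<otimes> v j x) = \<zero>)"
  using assms
proof (induction I arbitrary: J v rule: finite_induct)
  case empty
  then have "J \<noteq> {}" by auto
  then show ?case by (intro exI[of _ "\<lambda>_. \<one>"]) auto
next
  case (insert x0 I)
  show ?case
  proof (cases "\<forall>j\<in>J. v j x0 = \<zero>")
    case True
    obtain c where c: "\<forall>j\<in>J. c j \<in> carrier R" "\<exists>j\<in>J. c j \<noteq> \<zero>" "\<forall>x\<in>I. (\<Oplus>j\<in>J. c j \<otimes> v j x) = \<zero>"
      using insert.IH[of J v] insert.prems insert.hyps by (simp add: card_insert_if) metis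
    have "(\<Oplus>j\<in>J. c j \<otimes> v j x0) = (\<Oplus>j\<in>J. \<zero>)"
      using True c(1) by (intro finsum_eqI) auto
    then show ?thesis using c by (intro exI[of _ c]) auto
  next
    case False
    then obtain k where k: "k \<in> J" "v k x0 \<noteq> \<zero>" by blast
    define J' where "J' = J - {k}"
    have J': "J = insert k J'" "k \<notin> J'" "finite J'" "card I < card J'"
      using k insert by (auto simp: J'_def)
    have v: "\<And>j x. j \<in> J \<Longrightarrow> x \<in> insert x0 I \<Longrightarrow> v j x \<in> carrier R" by fact
    define t where "t j = v j x0 \<otimes> inv (v k x0)" for j
    have inv: "inv (v k x0) \<in> carrier R" "v k x0 \<otimes> inv (v k x0) = \<one>" "inv (v k x0) \<otimes> v k x0 = \<one>"
      using k v[of k x0] by (auto simp: field_Units)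
    have t: "t j \<in> carrier R" if "j \<in> J" for j using that v inv by (simp add: t_def)
    obtain c where c: "\<forall>j\<in>J'. c j \<in> carrier R" "\<exists>j\<in>J'. c j \<noteq> \<zero>"
      "\<forall>x\<in>I. (\<Oplus>j\<in>J'. c j \<otimes> (v j x \<ominus> t j \<otimes> v k x)) = \<zero>"
      using insert.IH[of J' "\<lambda>j x. v j x \<ominus> t j \<otimes> v k x"] J' v t k by auto
    define s where "s = (\<Oplus>j\<in>J'. c j \<otimes> t j)"
    have s: "s \<in> carrier R" using c J' t by (auto simp: s_def intro!: finsum_closed)
    define c' where "c' j = (if j = k then \<ominus> s else c j)" for j
    have c': "\<forall>j\<in>J. c' j \<in> carrier R" using c J' s by (auto simp: c'_def)
    have expand: "(\<Oplus>j\<in>J. c' j \<otimes> v j x) = (\<Oplus>j\<in>J'. c j \<otimes> (v j x \<ominus> t j \<otimes> v k x))"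
      if x: "x \<in> insert x0 I" for x
    proof -
      have vx: "v j x \<in> carrier R" if "j \<in> J" for j using v that x by blast
      have "(\<Oplus>j\<in>J'. c j \<otimes> (v j x \<ominus> t j \<otimes> v k x))
          = (\<Oplus>j\<in>J'. c j \<otimes> v j x \<oplus> (c j \<otimes> t j) \<otimes> (\<ominus> v k x))"
        using c(1) J' t vx k by (intro finsum_eqI) (auto simp: minus_eq r_distr r_minus l_minus m_assoc)
      also have "\<dots> = (\<Oplus>j\<in>J'. c j \<otimes> v j x) \<oplus> (\<Oplus>j\<in>J'. (c j \<otimes> t j) \<otimes> (\<ominus> v k x))"
        using c(1) J' t vx k by (intro finsum_addf) auto
      also have "(\<Oplus>j\<in>J'. (c j \<otimes> t j) \<otimes> (\<ominus> v k x)) = s \<otimes> (\<ominus> v k x)"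
        unfolding s_def using c(1) J' t vx k by (intro finsum_ldistr[symmetric]) auto
      also have "s \<otimes> (\<ominus> v k x) = \<ominus> s \<otimes> v k x"
        using s vx k by (simp add: l_minus r_minus)
      finally have "(\<Oplus>j\<in>J'. c j \<otimes> (v j x \<ominus> t j \<otimes> v k x)) = \<ominus> s \<otimes> v k x \<oplus> (\<Oplus>j\<in>J'. c j \<otimes> v j x)"
        using s vx k c(1) J' by (simp add: a_comm finsum_closed Pi_def)
      moreover have "(\<Oplus>j\<in>J'. c' j \<otimes> v j x) = (\<Oplus>j\<in>J'. c j \<otimes> v j x)"
        using c(1) J' vx by (intro finsum_eqI) (auto simp: c'_def)
      moreover have "(\<Oplus>j\<in>J. c' j \<otimes> v j x) = \<ominus> s \<otimes> v k x \<oplus> (\<Oplus>j\<in>J'. c' j \<otimes> v j x)"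
        unfolding J'(1) using J' c' vx k s by (subst finsum_insert) (auto simp: c'_def)
      ultimately show ?thesis by simp
    qed
    have "(\<Oplus>j\<in>J'. c j \<otimes> (v j x0 \<ominus> t j \<otimes> v k x0)) = (\<Oplus>j\<in>J'. \<zero>)"
      using c(1) J' v t inv k by (intro finsum_eqI) (auto simp: t_def m_assoc minus_eq r_neg)
    then have "\<forall>x\<in>insert x0 I. (\<Oplus>j\<in>J. c' j \<otimes> v j x) = \<zero>"
      using expand c(3) by auto
    moreover have "\<exists>j\<in>J. c' j \<noteq> \<zero>" using c(2) J' by (auto simp: c'_def)
    ultimately show ?thesis using c' by blast
  qed
qed

context finite_group_ring
begin

lemma scalar_commutes: "c \<in> carrier R \<Longrightarrow> f \<in> carrier RG \<Longrightarrow> scalar c \<otimes>\<^bsub>RG\<^esub> f = f \<otimes>\<^bsub>RG\<^esub> scalar c"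
  by (intro RG_eqI) (auto simp: scalar_mult m_comm)

text \<open>
  The powers of \<open>x\<close> with exponents up to the dimension \<open>n\<close> satisfy a
  nontrivial linear relation. Solving it for the lowest power that occurs expresses
  \<open>x\<^sup>m\<close> as a multiple of \<open>x\<^sup>m\<^sup>+\<^sup>1\<close> by a
  polynomial in \<open>x\<close>.
\<close>

lemma strongly_pi_regular:
  assumes "field R" and x: "x \<in> carrier RG"
  shows "\<exists>m. \<exists>q\<in>carrier RG. q \<otimes>\<^bsub>RG\<^esub> x = x \<otimes>\<^bsub>RG\<^esub> q \<and> x [^]\<^bsub>RG\<^esub> m = x [^]\<^bsub>RG\<^esub> Suc m \<otimes>\<^bsub>RG\<^esub> q"
proof -
  interpret F: field R by fact
  interpret S: ring RG by (rule ring_RG)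
  define n where "n = card (carrier G)"
  obtain c where c: "\<forall>j\<in>{..n}. c j \<in> carrier R" "\<exists>j\<in>{..n}. c j \<noteq> \<zero>"
    "\<forall>g\<in>carrier G. (\<Oplus>j\<in>{..n}. c j \<otimes> (x [^]\<^bsub>RG\<^esub> j) g) = \<zero>"
    using F.linear_dependence[OF finite_G, of "{..n}" "\<lambda>j. x [^]\<^bsub>RG\<^esub> j"] x by (auto simp: n_def)
  define m where "m = (LEAST j. j \<le> n \<and> c j \<noteq> \<zero>)"
  have m: "m \<le> n" "c m \<noteq> \<zero>" and least: "\<And>j. j < m \<Longrightarrow> c j = \<zero>"
  proof -
    have "m \<le> n \<and> c m \<noteq> \<zero>" unfolding m_def by (rule LeastI_ex) (use c(2) in auto)
    then show "m \<le> n" "c m \<noteq> \<zero>" by auto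
    then show "c j = \<zero>" if "j < m" for j
      using not_less_Least[of j "\<lambda>j. j \<le> n \<and> c j \<noteq> \<zero>"] that by (auto simp: m_def[symmetric])
  qed
  have cj: "scalar (c j) \<in> carrier RG" if "j \<le> n" for j using c(1) that by auto
  define y where "y = (\<Oplus>\<^bsub>RG\<^esub>j\<in>{m<..n}. scalar (c j) \<otimes>\<^bsub>RG\<^esub> x [^]\<^bsub>RG\<^esub> (j - Suc m))"
  have y: "y \<in> carrier RG" unfolding y_def using x cj by (intro S.finsum_closed) auto
  have term_x: "scalar (c j) \<otimes>\<^bsub>RG\<^esub> x [^]\<^bsub>RG\<^esub> k \<otimes>\<^bsub>RG\<^esub> x = x \<otimes>\<^bsub>RG\<^esub> (scalar (c j) \<otimes>\<^bsub>RG\<^esub> x [^]\<^bsub>RG\<^esub> k)"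
    if "j \<le> n" for j and k :: nat
  proof -
    have "scalar (c j) \<otimes>\<^bsub>RG\<^esub> x [^]\<^bsub>RG\<^esub> k \<otimes>\<^bsub>RG\<^esub> x = scalar (c j) \<otimes>\<^bsub>RG\<^esub> (x \<otimes>\<^bsub>RG\<^esub> x [^]\<^bsub>RG\<^esub> k)"
      using x cj[OF that] S.nat_pow_Suc2[OF x, of k] by (simp add: S.m_assoc)
    also have "\<dots> = x \<otimes>\<^bsub>RG\<^esub> (scalar (c j) \<otimes>\<^bsub>RG\<^esub> x [^]\<^bsub>RG\<^esub> k)"
      using x cj[OF that] c(1) that
      by (simp only: S.m_assoc[symmetric] S.nat_pow_closed scalar_commutes[of "c j" x] atMost_iff)
    finally show ?thesis .
  qed
  have xy: "y \<otimes>\<^bsub>RG\<^esub> x = x \<otimes>\<^bsub>RG\<^esub> y"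
  proof -
    have "y \<otimes>\<^bsub>RG\<^esub> x = (\<Oplus>\<^bsub>RG\<^esub>j\<in>{m<..n}. scalar (c j) \<otimes>\<^bsub>RG\<^esub> x [^]\<^bsub>RG\<^esub> (j - Suc m) \<otimes>\<^bsub>RG\<^esub> x)"
      unfolding y_def using x cj by (intro S.finsum_ldistr) auto
    also have "\<dots> = (\<Oplus>\<^bsub>RG\<^esub>j\<in>{m<..n}. x \<otimes>\<^bsub>RG\<^esub> (scalar (c j) \<otimes>\<^bsub>RG\<^esub> x [^]\<^bsub>RG\<^esub> (j - Suc m)))"
      using x cj by (intro S.finsum_eqI) (auto simp: term_x)
    also have "\<dots> = x \<otimes>\<^bsub>RG\<^esub> y"
      unfolding y_def using x cj by (intro S.finsum_rdistr[symmetric]) auto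
    finally show ?thesis .
  qed
  have "\<zero>\<^bsub>RG\<^esub> = (\<Oplus>\<^bsub>RG\<^esub>j\<in>{..n}. scalar (c j) \<otimes>\<^bsub>RG\<^esub> x [^]\<^bsub>RG\<^esub> j)"
  proof (rule RG_eqI)
    fix g assume g: "g \<in> carrier G"
    have "(\<Oplus>\<^bsub>RG\<^esub>j\<in>{..n}. scalar (c j) \<otimes>\<^bsub>RG\<^esub> x [^]\<^bsub>RG\<^esub> j) g
        = (\<Oplus>j\<in>{..n}. (scalar (c j) \<otimes>\<^bsub>RG\<^esub> x [^]\<^bsub>RG\<^esub> j) g)"
      using x cj g by (intro RG_finsum) auto
    also have "\<dots> = (\<Oplus>j\<in>{..n}. c j \<otimes> (x [^]\<^bsub>RG\<^esub> j) g)"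
      using x cj c(1) g by (intro finsum_eqI) (auto simp: scalar_mult)
    finally show "\<zero>\<^bsub>RG\<^esub> g = (\<Oplus>\<^bsub>RG\<^esub>j\<in>{..n}. scalar (c j) \<otimes>\<^bsub>RG\<^esub> x [^]\<^bsub>RG\<^esub> j) g"
      using c(3) g by (simp add: RG_zero)
  qed (use x cj in \<open>auto intro!: S.finsum_closed\<close>)
  also have "\<dots> = (\<Oplus>\<^bsub>RG\<^esub>j\<in>{m..n}. scalar (c j) \<otimes>\<^bsub>RG\<^esub> x [^]\<^bsub>RG\<^esub> j)"
  proof (rule S.add.finprod_mono_neutral_cong_right)
    fix j assume "j \<in> {..n} - {m..n}"
    then have "scalar (c j) = \<zero>\<^bsub>RG\<^esub>" using least by (auto simp: scalar_def group_ring_def)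
    then show "scalar (c j) \<otimes>\<^bsub>RG\<^esub> x [^]\<^bsub>RG\<^esub> j = \<zero>\<^bsub>RG\<^esub>" using x by simp
  qed (use x cj in auto)
  also have "{m..n} = insert m {m<..n}" using m by auto
  also have "(\<Oplus>\<^bsub>RG\<^esub>j\<in>insert m {m<..n}. scalar (c j) \<otimes>\<^bsub>RG\<^esub> x [^]\<^bsub>RG\<^esub> j)
      = scalar (c m) \<otimes>\<^bsub>RG\<^esub> x [^]\<^bsub>RG\<^esub> m \<oplus>\<^bsub>RG\<^esub> (\<Oplus>\<^bsub>RG\<^esub>j\<in>{m<..n}. scalar (c j) \<otimes>\<^bsub>RG\<^esub> x [^]\<^bsub>RG\<^esub> j)"
    using x cj m by (intro S.finsum_insert) auto
  also have "(\<Oplus>\<^bsub>RG\<^esub>j\<in>{m<..n}. scalar (c j) \<otimes>\<^bsub>RG\<^esub> x [^]\<^bsub>RG\<^esub> j)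
      = (\<Oplus>\<^bsub>RG\<^esub>j\<in>{m<..n}. x [^]\<^bsub>RG\<^esub> Suc m \<otimes>\<^bsub>RG\<^esub> (scalar (c j) \<otimes>\<^bsub>RG\<^esub> x [^]\<^bsub>RG\<^esub> (j - Suc m)))"
  proof (rule S.finsum_eqI)
    fix j assume j: "j \<in> {m<..n}"
    have "x [^]\<^bsub>RG\<^esub> j = x [^]\<^bsub>RG\<^esub> Suc m \<otimes>\<^bsub>RG\<^esub> x [^]\<^bsub>RG\<^esub> (j - Suc m)"
      using x j by (simp only: S.nat_pow_mult) simp
    then show "scalar (c j) \<otimes>\<^bsub>RG\<^esub> x [^]\<^bsub>RG\<^esub> j
        = x [^]\<^bsub>RG\<^esub> Suc m \<otimes>\<^bsub>RG\<^esub> (scalar (c j) \<otimes>\<^bsub>RG\<^esub> x [^]\<^bsub>RG\<^esub> (j - Suc m))"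
      using x j cj c(1)
      by (simp only: S.m_assoc[symmetric] S.nat_pow_closed scalar_commutes[of "c j" "x [^]\<^bsub>RG\<^esub> Suc m", symmetric]
          atMost_iff greaterThanAtMost_iff)
  qed (use x cj in auto)
  also have "\<dots> = x [^]\<^bsub>RG\<^esub> Suc m \<otimes>\<^bsub>RG\<^esub> y"
    unfolding y_def using x cj by (intro S.finsum_rdistr[symmetric]) auto
  finally have zero: "scalar (c m) \<otimes>\<^bsub>RG\<^esub> x [^]\<^bsub>RG\<^esub> m \<oplus>\<^bsub>RG\<^esub> x [^]\<^bsub>RG\<^esub> Suc m \<otimes>\<^bsub>RG\<^esub> y = \<zero>\<^bsub>RG\<^esub>" by simp
  have cm: "c m \<in> carrier R" "inv (c m) \<in> carrier R" "inv (c m) \<otimes> c m = \<one>"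
    using c(1) m by (auto simp: F.field_Units)
  define d where "d = scalar (inv (c m))"
  have d: "d \<in> carrier RG" using cm by (auto simp: d_def)
  have dc: "d \<otimes>\<^bsub>RG\<^esub> scalar (c m) = \<one>\<^bsub>RG\<^esub>"
    unfolding d_def scalar_one[symmetric] using cm
    by (intro RG_eqI) (auto simp: scalar_mult, auto simp: scalar_def)
  have dx: "d \<otimes>\<^bsub>RG\<^esub> z = z \<otimes>\<^bsub>RG\<^esub> d" if "z \<in> carrier RG" for z
    unfolding d_def using cm that by (intro scalar_commutes)
  define q where "q = \<ominus>\<^bsub>RG\<^esub> (d \<otimes>\<^bsub>RG\<^esub> y)"
  have "x [^]\<^bsub>RG\<^esub> Suc m \<otimes>\<^bsub>RG\<^esub> y = \<ominus>\<^bsub>RG\<^esub> (scalar (c m) \<otimes>\<^bsub>RG\<^esub> x [^]\<^bsub>RG\<^esub> m)"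
    using zero x y cm by (intro S.minus_equality[symmetric]) (auto simp: S.a_comm)
  moreover have "x [^]\<^bsub>RG\<^esub> Suc m \<otimes>\<^bsub>RG\<^esub> q = \<ominus>\<^bsub>RG\<^esub> (d \<otimes>\<^bsub>RG\<^esub> (x [^]\<^bsub>RG\<^esub> Suc m \<otimes>\<^bsub>RG\<^esub> y))"
    unfolding q_def using x y d dx[of "x [^]\<^bsub>RG\<^esub> Suc m"]
    by (simp only: S.r_minus S.m_closed S.nat_pow_closed S.m_assoc[symmetric])
  moreover have "d \<otimes>\<^bsub>RG\<^esub> (scalar (c m) \<otimes>\<^bsub>RG\<^esub> x [^]\<^bsub>RG\<^esub> m) = x [^]\<^bsub>RG\<^esub> m"
    using x d cm by (simp add: dc flip: S.m_assoc)
  ultimately have "x [^]\<^bsub>RG\<^esub> m = x [^]\<^bsub>RG\<^esub> Suc m \<otimes>\<^bsub>RG\<^esub> q"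
    using x d cm by (simp add: S.r_minus)
  moreover have "q \<otimes>\<^bsub>RG\<^esub> x = x \<otimes>\<^bsub>RG\<^esub> q"
    unfolding q_def using x y d dx[OF x]
    by (simp only: S.r_minus S.l_minus S.m_closed S.m_assoc xy) (simp only: S.m_assoc[symmetric])
  ultimately show ?thesis using y d by (intro exI[of _ m] bexI[of _ q]) (auto simp: q_def)
qed

end

section \<open>Characters of finite abelian groups\<close>

text \<open>
  If \<open>(a b)\<^sup>k = 1\<close>, then raising to the power \<open>ord b\<close> eliminates
  \<open>b\<close>, so \<open>ord a\<close> divides \<open>k \<cdot> ord b\<close> and hence
  \<open>k\<close>.
\<close>

lemma (in comm_group) ord_mult_coprime:
  assumes "x \<in> carrier G" "y \<in> carrier G" "coprime (ord x) (ord y)"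
  shows "ord x * ord y dvd ord (x \<otimes> y)"
proof -
  have dvd: "ord a dvd ord (a \<otimes> b)" if ab: "a \<in> carrier G" "b \<in> carrier G" "coprime (ord a) (ord b)" for a b
  proof -
    have "a [^] (ord (a \<otimes> b) * ord b) = a [^] (ord (a \<otimes> b) * ord b) \<otimes> b [^] (ord (a \<otimes> b) * ord b)"
      using ab by (simp add: pow_eq_id)
    also have "\<dots> = (a \<otimes> b) [^] (ord (a \<otimes> b) * ord b)"
      using ab by (simp add: nat_pow_distrib)
    also have "\<dots> = \<one>" using ab by (simp add: pow_eq_id)
    finally have "ord a dvd ord (a \<otimes> b) * ord b" using ab by (simp add: pow_eq_id)
    then show ?thesis using ab(3) by (simp add: coprime_dvd_mult_left_iff)
  qed
  have "ord x dvd ord (x \<otimes> y)" "ord y dvd ord (x \<otimes> y)"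
    using dvd[of x y] dvd[of y x] assms by (simp_all add: m_comm coprime_commute)
  then show ?thesis using assms(3) by (rule divides_mult)
qed

text \<open>
  An element \<open>g\<close> of maximal order works. If a prime \<open>p\<close> divided
  \<open>ord a\<close> to a higher power than \<open>ord g\<close>, then the product of a power of
  \<open>g\<close> of order prime to \<open>p\<close> and a power of \<open>a\<close> of
  \<open>p\<close>-power order would have larger order than \<open>g\<close>.
\<close>

lemma (in comm_group) exists_ord_exponent:
  assumes "finite (carrier G)"
  shows "\<exists>g\<in>carrier G. \<forall>a\<in>carrier G. ord a dvd ord g"
proof -
  define N where "N = Max (ord ` carrier G)"
  have "N \<in> ord ` carrier G" unfolding N_def using assms by (intro Max_in) auto
  then obtain g where g: "g \<in> carrier G" "ord g = N" by auto
  have max: "ord a \<le> N" if "a \<in> carrier G" for a unfolding N_def using assms that by auto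
  have pos: "ord a > 0" if "a \<in> carrier G" for a using ord_ge_1[OF assms that] by simp
  have "ord a dvd ord g" if a: "a \<in> carrier G" for a
  proof (rule ccontr)
    assume "\<not> ord a dvd ord g"
    then have "\<not> (\<forall>p. Factorial_Ring.prime p \<longrightarrow> multiplicity p (ord a) \<le> multiplicity p (ord g))"
      using multiplicity_le_imp_dvd[of "ord a" "ord g"] pos[OF a] by blast
    then obtain p where p: "Factorial_Ring.prime p" "multiplicity p (ord g) < multiplicity p (ord a)"
      by (auto simp: not_le)
    have unit: "\<not> is_unit p" using p(1) by auto
    define i j where "i = multiplicity p (ord g)" and "j = multiplicity p (ord a)"
    obtain n' where n': "ord g = p ^ i * n'" "\<not> p dvd n'"
      using multiplicity_decompose'[of "ord g" p] pos[OF g(1)] unit unfolding i_def by auto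
    obtain m' where m': "ord a = p ^ j * m'" "\<not> p dvd m'"
      using multiplicity_decompose'[of "ord a" p] pos[OF a] unit unfolding j_def by auto
    have p0: "p > 0" using p(1) prime_gt_0_nat by blast
    have pos': "n' > 0" "m' > 0" using n' m' by (auto intro: gr0I)
    have o1: "ord (g [^] (p ^ i)) = n'"
      using g n' pos' p0 by (subst ord_pow) auto
    have o2: "ord (a [^] m') = p ^ j"
      using a m' pos' p0 by (subst ord_pow) auto
    have "coprime n' (p ^ j)"
      using prime_imp_coprime[OF p(1) n'(2)] by (simp add: coprime_commute)
    then have "n' * p ^ j dvd ord (g [^] (p ^ i) \<otimes> a [^] m')"
      using ord_mult_coprime[of "g [^] (p ^ i)" "a [^] m'"] g a by (simp add: o1 o2)
    then have "n' * p ^ j \<le> N"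
      using max[of "g [^] (p ^ i) \<otimes> a [^] m'"] pos[of "g [^] (p ^ i) \<otimes> a [^] m'"] g a
      by (auto dest!: dvd_imp_le)
    moreover have "N < n' * p ^ j"
    proof -
      have "p ^ i < p ^ j"
        using p(2) prime_gt_1_nat[OF p(1)] by (intro power_strict_increasing) (simp_all only: i_def j_def)
      then show ?thesis using pos'(1) n'(1) g(2) by (simp add: mult.commute)
    qed
    ultimately show False by simp
  qed
  then show ?thesis using g by blast
qed

text \<open>
  Characters are recorded by the exponents of their values: \<open>l\<close> stands for \<open>a
  \<mapsto> \<zeta>\<^sup>l\<^sup>a\<close>. The same exponents give characters with values in
  different fields, for every root \<open>\<zeta>\<close> of unity whose order divides
  \<open>m\<close>.
\<close>

definition additive_mod :: "('a, 'l) monoid_scheme \<Rightarrow> nat \<Rightarrow> 'a set \<Rightarrow> ('a \<Rightarrow> nat) \<Rightarrow> bool" where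
  "additive_mod A m H l \<longleftrightarrow> (\<forall>a\<in>H. \<forall>b\<in>H. [l (a \<otimes>\<^bsub>A\<^esub> b) = l a + l b] (mod m))"

lemma additive_mod_one:
  assumes "additive_mod A m H l" "\<one>\<^bsub>A\<^esub> \<in> H" "monoid A"
  shows "[l \<one>\<^bsub>A\<^esub> = 0] (mod m)"
proof -
  interpret monoid A by fact
  have "[l (\<one>\<^bsub>A\<^esub> \<otimes>\<^bsub>A\<^esub> \<one>\<^bsub>A\<^esub>) = l \<one>\<^bsub>A\<^esub> + l \<one>\<^bsub>A\<^esub>] (mod m)"
    using assms(1,2) unfolding additive_mod_def by blast
  then have "[l \<one>\<^bsub>A\<^esub> + 0 = l \<one>\<^bsub>A\<^esub> + l \<one>\<^bsub>A\<^esub>] (mod m)" by simp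
  then show ?thesis by (metis cong_add_lcancel_nat cong_sym)
qed

lemma additive_mod_pow:
  assumes l: "additive_mod A m H l" and "monoid A" and H: "\<one>\<^bsub>A\<^esub> \<in> H" "\<And>k::nat. a [^]\<^bsub>A\<^esub> k \<in> H" "a \<in> H"
  shows "[l (a [^]\<^bsub>A\<^esub> (k::nat)) = k * l a] (mod m)"
proof -
  interpret monoid A by fact
  show ?thesis
  proof (induction k)
    case 0
    then show ?case using additive_mod_one[OF l H(1) \<open>monoid A\<close>] by simp
  next
    case (Suc k)
    have "[l (a [^]\<^bsub>A\<^esub> k \<otimes>\<^bsub>A\<^esub> a) = l (a [^]\<^bsub>A\<^esub> k) + l a] (mod m)"
      using l H by (auto simp: additive_mod_def)
    also have "[l (a [^]\<^bsub>A\<^esub> k) + l a = k * l a + l a] (mod m)"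
      by (intro cong_add Suc cong_refl)
    finally show ?case by (simp add: add.commute)
  qed
qed

context field
begin

lemma geometric_sum_zero:
  assumes x: "x \<in> carrier R" "x [^] (r::nat) = \<one>" "x \<noteq> \<one>"
  shows "(\<Oplus>t\<in>{..<r}. x [^] t) = \<zero>"
proof -
  have "(\<Oplus>t\<in>{..<k}. x [^] t) \<otimes> (x \<ominus> \<one>) = x [^] k \<ominus> \<one>" for k :: nat
  proof (induction k)
    case 0
    then show ?case using x by (simp add: minus_eq r_neg)
  next
    case (Suc k)
    have s: "(\<Oplus>t\<in>{..<k}. x [^] t) \<in> carrier R" using x by (intro finsum_closed) auto
    have "(\<Oplus>t\<in>{..<Suc k}. x [^] t) = x [^] k \<oplus> (\<Oplus>t\<in>{..<k}. x [^] t)"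
      unfolding lessThan_Suc using x by (intro finsum_insert) auto
    then have "(\<Oplus>t\<in>{..<Suc k}. x [^] t) \<otimes> (x \<ominus> \<one>) = x [^] k \<otimes> (x \<ominus> \<one>) \<oplus> (x [^] k \<ominus> \<one>)"
      using x s by (simp add: l_distr Suc.IH)
    also have "\<dots> = x [^] Suc k \<ominus> \<one>"
      using x by (simp add: minus_eq r_distr r_minus a_assoc r_neg1)
    finally show ?case .
  qed
  from this[of r] have "(\<Oplus>t\<in>{..<r}. x [^] t) \<otimes> (x \<ominus> \<one>) = \<zero>" using x by (simp add: minus_eq r_neg)
  moreover have "(\<Oplus>t\<in>{..<r}. x [^] t) \<in> carrier R" "x \<ominus> \<one> \<in> carrier R" "x \<ominus> \<one> \<noteq> \<zero>"
    using x by (auto intro!: finsum_closed)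
  ultimately show ?thesis using integral by blast
qed

lemma primitive_root_power_mod:
  assumes "primitive_root_of_one R d \<zeta>"
  shows "\<zeta> [^] (k::nat) = \<zeta> [^] (k mod d)"
proof -
  have z: "\<zeta> \<in> carrier R" "\<zeta> [^] d = \<one>"
    using assms by (auto simp: primitive_root_of_one_def)
  have "\<zeta> [^] k = \<zeta> [^] (d * (k div d) + k mod d)" by simp
  also have "\<dots> = (\<zeta> [^] d) [^] (k div d) \<otimes> \<zeta> [^] (k mod d)"
    using z(1) by (simp only: nat_pow_pow nat_pow_mult)
  finally show ?thesis using z by simp
qed

lemma primitive_root_power_eq_one_iff:
  assumes "primitive_root_of_one R d \<zeta>"
  shows "\<zeta> [^] (k::nat) = \<one> \<longleftrightarrow> d dvd k"
proof -
  have "d > 0" and min: "\<And>k. 0 < k \<Longrightarrow> k < d \<Longrightarrow> \<zeta> [^] k \<noteq> \<one>"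
    using assms by (auto simp: primitive_root_of_one_def)
  then show ?thesis
    using min[of "k mod d"] primitive_root_power_mod[OF assms, of k]
    by (cases "k mod d = 0") (auto simp: dvd_eq_mod_eq_0)
qed

lemma primitive_root_power_eq_iff:
  assumes "primitive_root_of_one R d \<zeta>"
  shows "\<zeta> [^] (i::nat) = \<zeta> [^] (j::nat) \<longleftrightarrow> [i = j] (mod d)"
proof
  have z: "\<zeta> \<in> carrier R" and d: "d > 0"
    using assms by (auto simp: primitive_root_of_one_def)
  assume eq: "\<zeta> [^] i = \<zeta> [^] j"
  have dj: "(d - 1) * j + j = d * j" using d by (cases d) auto
  have "\<zeta> [^] ((d - 1) * j + i) = \<zeta> [^] ((d - 1) * j + j)"
    using z eq by (simp flip: nat_pow_mult)
  also have "\<dots> = \<one>" unfolding dj by (simp add: primitive_root_power_eq_one_iff[OF assms])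
  finally have "d dvd (d - 1) * j + i" by (simp add: primitive_root_power_eq_one_iff[OF assms])
  then have "[(d - 1) * j + i = (d - 1) * j + j] (mod d)"
    unfolding dj by (simp add: cong_def dvd_eq_mod_eq_0)
  then show "[i = j] (mod d)" by (simp add: cong_add_lcancel_nat)
next
  assume "[i = j] (mod d)"
  then show "\<zeta> [^] i = \<zeta> [^] j"
    using primitive_root_power_mod[OF assms] by (metis cong_def)
qed

text \<open>
  A polynomial of degree less than \<open>r\<close> that vanishes at the \<open>r\<close> distinct
  points \<open>\<omega> \<eta>\<^sup>t\<close> is zero. Fourier inversion proves it: multiplying
  the equation for \<open>t\<close> by \<open>\<eta>\<^sup>-\<^sup>j\<^sup>t\<close> and adding
  over \<open>t\<close> cancels all terms but \<open>r \<omega>\<^sup>j c j\<close>.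
\<close>

lemma coeffs_zero_of_roots:
  assumes \<omega>: "\<omega> \<in> carrier R" "\<omega> \<noteq> \<zero>" and \<eta>: "primitive_root_of_one R r \<eta>"
    and char: "[r] \<cdot> \<one> \<noteq> \<zero>"
    and c: "\<And>k. k < r \<Longrightarrow> c k \<in> carrier R"
    and root: "\<And>t. t < r \<Longrightarrow> (\<Oplus>k\<in>{..<r}. c k \<otimes> (\<omega> \<otimes> \<eta> [^] t) [^] k) = \<zero>"
    and j: "j < r"
  shows "c j = \<zero>"
proof -
  have e: "\<eta> \<in> carrier R" using \<eta> by (auto simp: primitive_root_of_one_def)
  \<comment> \<open>The exponent \<open>r - j\<close> stands for \<open>- j\<close>.\<close>
  have inner: "(\<Oplus>t\<in>{..<r}. (\<eta> [^] (k + (r - j))) [^] t) = (if k = j then [r] \<cdot> \<one> else \<zero>)"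
    if k: "k < r" for k
  proof (cases "k = j")
    case True
    then have "\<eta> [^] (k + (r - j)) = \<one>"
      using j by (simp add: primitive_root_power_eq_one_iff[OF \<eta>])
    then show ?thesis using True e by (simp add: add.finprod_const)
  next
    case False
    have "\<not> r dvd k + (r - j)"
    proof
      assume "r dvd k + (r - j)"
      then obtain q where q: "k + (r - j) = r * q" by auto
      have "0 < r * q" "r * q < r * 2" using k j q by linarith+
      then have "q = 1" by simp
      then show False using q False j by simp
    qed
    then have "\<eta> [^] (k + (r - j)) \<noteq> \<one>" by (simp add: primitive_root_power_eq_one_iff[OF \<eta>])
    moreover have "(\<eta> [^] (k + (r - j))) [^] r = \<one>"
      using e by (simp add: nat_pow_pow primitive_root_power_eq_one_iff[OF \<eta>])
    ultimately show ?thesis using False e by (simp add: geometric_sum_zero)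
  qed
  have "\<zero> = (\<Oplus>t\<in>{..<r}. \<eta> [^] (t * (r - j)) \<otimes> (\<Oplus>k\<in>{..<r}. c k \<otimes> (\<omega> \<otimes> \<eta> [^] t) [^] k))"
  proof -
    have "(\<Oplus>t\<in>{..<r}. \<eta> [^] (t * (r - j)) \<otimes> (\<Oplus>k\<in>{..<r}. c k \<otimes> (\<omega> \<otimes> \<eta> [^] t) [^] k)) = (\<Oplus>t\<in>{..<r}. \<zero>)"
      using e by (intro finsum_cong') (auto simp: root)
    then show ?thesis by simp
  qed
  also have "\<dots> = (\<Oplus>t\<in>{..<r}. \<Oplus>k\<in>{..<r}. c k \<otimes> \<omega> [^] k \<otimes> (\<eta> [^] (k + (r - j))) [^] t)"
  proof (rule finsum_cong')
    fix t assume t: "t \<in> {..<r}"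
    have eta: "(\<eta> [^] (k + (r - j))) [^] t = \<eta> [^] (t * (r - j)) \<otimes> (\<eta> [^] t) [^] k" for k :: nat
      using e by (simp add: nat_pow_pow nat_pow_mult algebra_simps)
    have "\<eta> [^] (t * (r - j)) \<otimes> (\<Oplus>k\<in>{..<r}. c k \<otimes> (\<omega> \<otimes> \<eta> [^] t) [^] k)
        = (\<Oplus>k\<in>{..<r}. \<eta> [^] (t * (r - j)) \<otimes> (c k \<otimes> (\<omega> \<otimes> \<eta> [^] t) [^] k))"
      using c e \<omega> by (intro finsum_rdistr) auto
    also have "\<dots> = (\<Oplus>k\<in>{..<r}. c k \<otimes> \<omega> [^] k \<otimes> (\<eta> [^] (k + (r - j))) [^] t)"
      using c e \<omega> by (intro finsum_eqI) (auto simp: eta nat_pow_distrib m_ac)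
    finally show "\<eta> [^] (t * (r - j)) \<otimes> (\<Oplus>k\<in>{..<r}. c k \<otimes> (\<omega> \<otimes> \<eta> [^] t) [^] k) = \<dots>" .
  qed (use c e \<omega> in \<open>auto intro!: finsum_closed\<close>)
  also have "\<dots> = (\<Oplus>k\<in>{..<r}. \<Oplus>t\<in>{..<r}. c k \<otimes> \<omega> [^] k \<otimes> (\<eta> [^] (k + (r - j))) [^] t)"
    using c e \<omega> by (intro finsum_swap) auto
  also have "\<dots> = (\<Oplus>k\<in>{..<r}. if j = k then c k \<otimes> \<omega> [^] k \<otimes> [r] \<cdot> \<one> else \<zero>)"
  proof (rule finsum_cong')
    fix k assume k: "k \<in> {..<r}"
    have "(\<Oplus>t\<in>{..<r}. c k \<otimes> \<omega> [^] k \<otimes> (\<eta> [^] (k + (r - j))) [^] t)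
        = c k \<otimes> \<omega> [^] k \<otimes> (\<Oplus>t\<in>{..<r}. (\<eta> [^] (k + (r - j))) [^] t)"
      using c k e \<omega> by (intro finsum_rdistr[symmetric]) auto
    then show "(\<Oplus>t\<in>{..<r}. c k \<otimes> \<omega> [^] k \<otimes> (\<eta> [^] (k + (r - j))) [^] t)
        = (if j = k then c k \<otimes> \<omega> [^] k \<otimes> [r] \<cdot> \<one> else \<zero>)"
      using inner[of k] k c \<omega> by auto
  qed (use c \<omega> in auto)
  also have "\<dots> = c j \<otimes> \<omega> [^] j \<otimes> [r] \<cdot> \<one>"
    using c \<omega> j by (intro finsum_singleton) auto
  finally have "c j \<otimes> \<omega> [^] j \<otimes> [r] \<cdot> \<one> = \<zero>" by simp
  moreover have "\<omega> [^] j \<noteq> \<zero>"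
    using \<omega> by (induction j) (auto dest: integral)
  ultimately show ?thesis using c[OF j] \<omega> char by (metis integral m_closed nat_pow_closed add.nat_pow_closed one_closed)
qed

end

locale abelian_characters = field K + A: comm_group A for K (structure) and A (structure) +
  fixes m :: nat and \<zeta>
  assumes finite_A: "finite (carrier A)"
    and root: "primitive_root_of_one K m \<zeta>"
    and exponent: "\<And>a. a \<in> carrier A \<Longrightarrow> a [^]\<^bsub>A\<^esub> m = \<one>\<^bsub>A\<^esub>"
    and invertible: "[m] \<cdot>\<^bsub>K\<^esub> \<one>\<^bsub>K\<^esub> \<noteq> \<zero>\<^bsub>K\<^esub>"
begin

lemma zeta: "\<zeta> \<in> carrier K" and m_pos: "m > 0" and zeta_nonzero: "\<zeta> \<noteq> \<zero>\<^bsub>K\<^esub>"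
proof -
  show "\<zeta> \<in> carrier K" "m > 0" using root by (auto simp: primitive_root_of_one_def)
  then show "\<zeta> \<noteq> \<zero>\<^bsub>K\<^esub>"
    using root by (auto simp: primitive_root_of_one_def nat_pow_zero)
qed

lemma zeta_pow_nonzero: "\<zeta> [^]\<^bsub>K\<^esub> (k::nat) \<noteq> \<zero>\<^bsub>K\<^esub>"
  using zeta zeta_nonzero by (induction k) (auto dest: integral)

text \<open>The Fourier transform of functions on \<open>H\<close> is injective.\<close>

definition separated :: "'c set \<Rightarrow> bool" where
  "separated H \<longleftrightarrow> (\<forall>f. (\<forall>h\<in>H. f h \<in> carrier K) \<longrightarrow>
     (\<forall>l. additive_mod A m H l \<longrightarrow> (\<Oplus>\<^bsub>K\<^esub>h\<in>H. f h \<otimes>\<^bsub>K\<^esub> \<zeta> [^]\<^bsub>K\<^esub> l h) = \<zero>\<^bsub>K\<^esub>) \<longrightarrow> (\<forall>h\<in>H. f h = \<zero>\<^bsub>K\<^esub>))"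

lemma separated_trivial: "separated {\<one>\<^bsub>A\<^esub>}"
  unfolding separated_def
proof (intro allI impI)
  fix f :: "'c \<Rightarrow> 'a"
  assume f: "\<forall>h\<in>{\<one>\<^bsub>A\<^esub>}. f h \<in> carrier K"
    and "\<forall>l. additive_mod A m {\<one>\<^bsub>A\<^esub>} l \<longrightarrow> (\<Oplus>\<^bsub>K\<^esub>h\<in>{\<one>\<^bsub>A\<^esub>}. f h \<otimes>\<^bsub>K\<^esub> \<zeta> [^]\<^bsub>K\<^esub> l h) = \<zero>\<^bsub>K\<^esub>"
  then have "(\<Oplus>\<^bsub>K\<^esub>h\<in>{\<one>\<^bsub>A\<^esub>}. f h \<otimes>\<^bsub>K\<^esub> \<zeta> [^]\<^bsub>K\<^esub> (0::nat)) = \<zero>\<^bsub>K\<^esub>"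
    by (elim allE[of _ "\<lambda>_. 0"]) (auto simp: additive_mod_def)
  then show "\<forall>h\<in>{\<one>\<^bsub>A\<^esub>}. f h = \<zero>\<^bsub>K\<^esub>" using f by simp
qed

lemma submonoid_imp_subgroup:
  assumes "H \<subseteq> carrier A" "\<one>\<^bsub>A\<^esub> \<in> H" "\<And>x y. x \<in> H \<Longrightarrow> y \<in> H \<Longrightarrow> x \<otimes>\<^bsub>A\<^esub> y \<in> H"
  shows "subgroup H A"
proof (rule A.subgroupI)
  fix x assume x: "x \<in> H"
  have pow: "x [^]\<^bsub>A\<^esub> (k::nat) \<in> H" for k using x assms by (induction k) auto
  have "x [^]\<^bsub>A\<^esub> (m - 1) \<otimes>\<^bsub>A\<^esub> x = x [^]\<^bsub>A\<^esub> m"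
    using m_pos by (cases m) auto
  then have "x [^]\<^bsub>A\<^esub> (m - 1) \<otimes>\<^bsub>A\<^esub> x = \<one>\<^bsub>A\<^esub>"
    using x assms(1) exponent by auto
  then have "inv\<^bsub>A\<^esub> x = x [^]\<^bsub>A\<^esub> (m - 1)"
    using x assms(1) by (intro A.inv_equality) auto
  then show "inv\<^bsub>A\<^esub> x \<in> H" using pow by simp
qed (use assms in auto)

text \<open>
  Let \<open>r\<close> be the least positive exponent with \<open>a\<^sup>r \<in> H\<close>. The
  elements of the enlarged group \<open>H'\<close> are uniquely \<open>h a\<^sup>k\<close> with
  \<open>h \<in> H\<close> and \<open>k < r\<close>. A character \<open>l\<close> of
  \<open>H\<close> extends to \<open>H'\<close> in \<open>r\<close> ways: the exponent
  \<open>s\<close> of the value at \<open>a\<close> has to satisfy \<open>r s = l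
  (a\<^sup>r)\<close> modulo \<open>m\<close>. If a function on \<open>H'\<close> is annihilated
  by all these extensions, then the polynomial whose coefficients are the Fourier coefficients at
  \<open>l\<close> of its restrictions to the cosets \<open>H a\<^sup>k\<close> has
  \<open>r\<close> zeros. So these coefficients vanish, and the hypothesis on \<open>H\<close>
  applies to each coset.
\<close>

lemma separated_step:
  assumes H: "subgroup H A" and sep: "separated H" and a: "a \<in> carrier A"
  shows "\<exists>H'. subgroup H' A \<and> separated H' \<and> insert a H \<subseteq> H'"
proof -
  interpret H: subgroup H A by fact
  define r where "r = (LEAST r::nat. r > 0 \<and> a [^]\<^bsub>A\<^esub> r \<in> H)"
  have witness: "m > 0 \<and> a [^]\<^bsub>A\<^esub> m \<in> H" using m_pos exponent[OF a] by simp
  have r: "r > 0" "a [^]\<^bsub>A\<^esub> r \<in> H" and min: "\<And>k. 0 < k \<Longrightarrow> k < r \<Longrightarrow> a [^]\<^bsub>A\<^esub> k \<notin> H"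
  proof -
    have "r > 0 \<and> a [^]\<^bsub>A\<^esub> r \<in> H" unfolding r_def by (rule LeastI, rule witness)
    then show "r > 0" "a [^]\<^bsub>A\<^esub> r \<in> H" by auto
    show "a [^]\<^bsub>A\<^esub> k \<notin> H" if "0 < k" "k < r" for k
      using not_less_Least[OF that(2)[unfolded r_def]] that(1) by blast
  qed
  define b where "b = a [^]\<^bsub>A\<^esub> r"
  have b: "b \<in> H" using r by (simp add: b_def)
  have apow: "a [^]\<^bsub>A\<^esub> (k::nat) \<in> carrier A" for k using a by simp
  have r_dvd: "r dvd k" if "a [^]\<^bsub>A\<^esub> k \<in> H" for k :: nat
  proof -
    have bq: "b [^]\<^bsub>A\<^esub> q \<in> H" for q :: nat using b by (induction q) auto
    have "a [^]\<^bsub>A\<^esub> k = b [^]\<^bsub>A\<^esub> (k div r) \<otimes>\<^bsub>A\<^esub> a [^]\<^bsub>A\<^esub> (k mod r)"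
      using a by (simp only: b_def A.nat_pow_pow A.nat_pow_mult) simp
    then have "a [^]\<^bsub>A\<^esub> (k mod r) = inv\<^bsub>A\<^esub> (b [^]\<^bsub>A\<^esub> (k div r)) \<otimes>\<^bsub>A\<^esub> a [^]\<^bsub>A\<^esub> k"
      using apow bq H.subset by (metis A.inv_solve_left subsetD)
    also have "\<dots> \<in> H" using that bq by blast
    finally show ?thesis using min[of "k mod r"] r(1) by (cases "k mod r = 0") (auto simp: dvd_eq_mod_eq_0)
  qed
  define e where "e = m div r"
  have me: "m = r * e" using r_dvd[of m] exponent[OF a] by (simp add: e_def)
  have e_pos: "e > 0" using me m_pos by (cases e) auto

  define g where "g = (\<lambda>(h, k). h \<otimes>\<^bsub>A\<^esub> a [^]\<^bsub>A\<^esub> (k::nat))"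
  define D where "D = H \<times> {..<r}"
  have fin: "finite H" "finite D" using finite_A H.subset by (auto simp: D_def intro: finite_subset)
  \<comment> \<open>The coset of \<open>H\<close> determines the exponent \<open>k < r\<close>.\<close>
  have key: "k = k'" if "h \<in> H" "h' \<in> H" "k \<le> k'" "k' < r" "h \<otimes>\<^bsub>A\<^esub> a [^]\<^bsub>A\<^esub> k = h' \<otimes>\<^bsub>A\<^esub> a [^]\<^bsub>A\<^esub> k'"
    for h h' and k k' :: nat
  proof -
    have "a [^]\<^bsub>A\<^esub> k' = a [^]\<^bsub>A\<^esub> (k' - k) \<otimes>\<^bsub>A\<^esub> a [^]\<^bsub>A\<^esub> k"
      using that a by (simp only: A.nat_pow_mult) simp
    then have "h \<otimes>\<^bsub>A\<^esub> a [^]\<^bsub>A\<^esub> k = (h' \<otimes>\<^bsub>A\<^esub> a [^]\<^bsub>A\<^esub> (k' - k)) \<otimes>\<^bsub>A\<^esub> a [^]\<^bsub>A\<^esub> k"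
      using that apow H.subset by (simp add: A.m_assoc subset_iff)
    then have "h = h' \<otimes>\<^bsub>A\<^esub> a [^]\<^bsub>A\<^esub> (k' - k)"
      using that apow H.subset by (simp add: subset_iff)
    then have "a [^]\<^bsub>A\<^esub> (k' - k) = inv\<^bsub>A\<^esub> h' \<otimes>\<^bsub>A\<^esub> h"
      using that apow H.subset by (metis A.inv_solve_left subsetD)
    also have "\<dots> \<in> H" using that by blast
    finally show ?thesis using min[of "k' - k"] that by (cases "k = k'") auto
  qed
  have inj: "inj_on g D"
  proof (rule inj_onI)
    fix x y assume xy: "x \<in> D" "y \<in> D" "g x = g y"
    obtain h k h' k' where eq: "x = (h, k)" "y = (h', k')" by (metis surj_pair)
    have mem: "h \<in> H" "h' \<in> H" "k < r" "k' < r" using xy by (auto simp: eq D_def)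
    have gg: "h \<otimes>\<^bsub>A\<^esub> a [^]\<^bsub>A\<^esub> k = h' \<otimes>\<^bsub>A\<^esub> a [^]\<^bsub>A\<^esub> k'" using xy(3) by (simp add: eq g_def)
    have "k = k'"
      using key[OF mem(1,2) _ mem(4) gg] key[OF mem(2,1) _ mem(3) gg[symmetric]] by (cases "k \<le> k'") auto
    then show "x = y" using gg mem apow H.subset by (auto simp: eq subset_iff)
  qed
  define H' where "H' = g ` D"
  have bij: "bij_betw g D H'" using inj by (simp add: bij_betw_def H'_def)
  have HsubH': "h \<in> H'" if "h \<in> H" for h
  proof -
    have "g (h, 0) = h" using that H.subset by (auto simp: g_def)
    moreover have "(h, 0) \<in> D" using that r by (simp add: D_def)
    ultimately show ?thesis unfolding H'_def by (metis imageI)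
  qed
  have mem_H': "h \<otimes>\<^bsub>A\<^esub> a [^]\<^bsub>A\<^esub> k \<in> H'" if "h \<in> H" for h and k :: nat
  proof -
    have bq: "b [^]\<^bsub>A\<^esub> q \<in> H" for q :: nat using b by (induction q) auto
    have "a [^]\<^bsub>A\<^esub> k = b [^]\<^bsub>A\<^esub> (k div r) \<otimes>\<^bsub>A\<^esub> a [^]\<^bsub>A\<^esub> (k mod r)"
      using a by (simp only: b_def A.nat_pow_pow A.nat_pow_mult) simp
    then have "h \<otimes>\<^bsub>A\<^esub> a [^]\<^bsub>A\<^esub> k = g (h \<otimes>\<^bsub>A\<^esub> b [^]\<^bsub>A\<^esub> (k div r), k mod r)"
      using that bq apow H.subset by (simp add: g_def A.m_assoc subset_iff)
    moreover have "(h \<otimes>\<^bsub>A\<^esub> b [^]\<^bsub>A\<^esub> (k div r), k mod r) \<in> D"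
      using that bq r by (simp add: D_def)
    ultimately show ?thesis unfolding H'_def by blast
  qed
  have sub': "subgroup H' A"
  proof (rule submonoid_imp_subgroup)
    show "H' \<subseteq> carrier A" using H.subset a by (auto simp: H'_def g_def D_def)
    show "\<one>\<^bsub>A\<^esub> \<in> H'" by (simp add: HsubH')
    fix x y assume "x \<in> H'" "y \<in> H'"
    then obtain h k h' k' where x: "h \<in> H" "x = h \<otimes>\<^bsub>A\<^esub> a [^]\<^bsub>A\<^esub> (k::nat)" and y: "h' \<in> H" "y = h' \<otimes>\<^bsub>A\<^esub> a [^]\<^bsub>A\<^esub> (k'::nat)"
      by (auto simp: H'_def g_def D_def)
    have "x \<otimes>\<^bsub>A\<^esub> y = h \<otimes>\<^bsub>A\<^esub> h' \<otimes>\<^bsub>A\<^esub> (a [^]\<^bsub>A\<^esub> k \<otimes>\<^bsub>A\<^esub> a [^]\<^bsub>A\<^esub> k')"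
      using x y apow H.subset by (simp add: A.m_ac subset_iff)
    also have "\<dots> = h \<otimes>\<^bsub>A\<^esub> h' \<otimes>\<^bsub>A\<^esub> a [^]\<^bsub>A\<^esub> (k + k')" using a by (simp add: A.nat_pow_mult)
    also have "\<dots> \<in> H'" using x y by (intro mem_H') simp
    finally show "x \<otimes>\<^bsub>A\<^esub> y \<in> H'" .
  qed
  have "separated H'"
    unfolding separated_def
  proof (intro allI impI)
    fix f assume f: "\<forall>h\<in>H'. f h \<in> carrier K"
      and zero: "\<forall>l. additive_mod A m H' l \<longrightarrow> (\<Oplus>\<^bsub>K\<^esub>h\<in>H'. f h \<otimes>\<^bsub>K\<^esub> \<zeta> [^]\<^bsub>K\<^esub> l h) = \<zero>\<^bsub>K\<^esub>"
    have fK: "f (h \<otimes>\<^bsub>A\<^esub> a [^]\<^bsub>A\<^esub> k) \<in> carrier K" if "h \<in> H" for h and k :: nat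
      using f mem_H'[OF that] by blast
    have coeff: "(\<Oplus>\<^bsub>K\<^esub>h\<in>H. f (h \<otimes>\<^bsub>A\<^esub> a [^]\<^bsub>A\<^esub> j) \<otimes>\<^bsub>K\<^esub> \<zeta> [^]\<^bsub>K\<^esub> l h) = \<zero>\<^bsub>K\<^esub>"
      if l: "additive_mod A m H l" and j: "j < r" for l j
    proof -
      have lmult: "[l (x \<otimes>\<^bsub>A\<^esub> y) = l x + l y] (mod m)" if "x \<in> H" "y \<in> H" for x y
        using l that by (auto simp: additive_mod_def)
      have "[l (b [^]\<^bsub>A\<^esub> e) = e * l b] (mod m)"
      proof (rule additive_mod_pow[OF l])
        show "b [^]\<^bsub>A\<^esub> k \<in> H" for k :: nat using b by (induction k) auto
      qed (use b A.monoid_axioms in auto)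
      moreover have "b [^]\<^bsub>A\<^esub> e = \<one>\<^bsub>A\<^esub>"
        using a exponent[OF a] by (simp add: b_def A.nat_pow_pow flip: me)
      moreover have "[l \<one>\<^bsub>A\<^esub> = 0] (mod m)"
        by (rule additive_mod_one[OF l]) (use A.monoid_axioms in auto)
      ultimately have "[e * l b = 0] (mod m)" by (metis cong_sym cong_trans)
      then have "r * e dvd e * l b" by (simp add: cong_0_iff me)
      then have "r dvd l b" using e_pos by (simp add: mult.commute)
      then obtain c where c: "l b = r * c" by auto
      show ?thesis
      proof (rule coeffs_zero_of_roots[where \<omega> = "\<zeta> [^]\<^bsub>K\<^esub> c" and \<eta> = "\<zeta> [^]\<^bsub>K\<^esub> e" and r = r])
        show "primitive_root_of_one K r (\<zeta> [^]\<^bsub>K\<^esub> e)"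
          unfolding primitive_root_of_one_def
          using r zeta e_pos by (auto simp: nat_pow_pow primitive_root_power_eq_one_iff[OF root] me mult.commute dest: nat_dvd_not_less)
        have "[m] \<cdot>\<^bsub>K\<^esub> \<one>\<^bsub>K\<^esub> = [e] \<cdot>\<^bsub>K\<^esub> ([r] \<cdot>\<^bsub>K\<^esub> \<one>\<^bsub>K\<^esub>)"
          by (simp add: me add.nat_pow_pow)
        then show "[r] \<cdot>\<^bsub>K\<^esub> \<one>\<^bsub>K\<^esub> \<noteq> \<zero>\<^bsub>K\<^esub>" using invertible by auto
      next
        fix t assume t: "t < r"
        \<comment> \<open>All solutions \<open>s\<close> of the congruence, one for each \<open>t < r\<close>.\<close>
        define s where "s = c + t * e"
        define L where "L x = (case the_inv_into D g x of (h, k) \<Rightarrow> l h + k * s)" for x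
        have Lg: "L (h \<otimes>\<^bsub>A\<^esub> a [^]\<^bsub>A\<^esub> k) = l h + k * s" if "h \<in> H" "k < r" for h k
        proof -
          have "the_inv_into D g (g (h, k)) = (h, k)"
            using that by (intro the_inv_into_f_f[OF inj]) (auto simp: D_def)
          then show ?thesis by (simp add: L_def g_def)
        qed
        have rs: "[l b = r * s] (mod m)"
        proof -
          have "r * s = r * c + t * m" by (simp add: s_def me algebra_simps)
          then show ?thesis by (simp add: c cong_def)
        qed
        have "additive_mod A m H' L"
          unfolding additive_mod_def
        proof (intro ballI)
          fix x y assume "x \<in> H'" "y \<in> H'"
          then obtain h k h' k' where x: "h \<in> H" "k < r" "x = h \<otimes>\<^bsub>A\<^esub> a [^]\<^bsub>A\<^esub> k"
            and y: "h' \<in> H" "k' < r" "y = h' \<otimes>\<^bsub>A\<^esub> a [^]\<^bsub>A\<^esub> k'"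
            by (auto simp: H'_def g_def D_def)
          have hh: "h \<otimes>\<^bsub>A\<^esub> h' \<in> H" using x y by blast
          have "x \<otimes>\<^bsub>A\<^esub> y = h \<otimes>\<^bsub>A\<^esub> h' \<otimes>\<^bsub>A\<^esub> (a [^]\<^bsub>A\<^esub> k \<otimes>\<^bsub>A\<^esub> a [^]\<^bsub>A\<^esub> k')"
            using x y apow H.subset by (simp add: A.m_ac subset_iff)
          then have xy: "x \<otimes>\<^bsub>A\<^esub> y = h \<otimes>\<^bsub>A\<^esub> h' \<otimes>\<^bsub>A\<^esub> a [^]\<^bsub>A\<^esub> (k + k')" using a by (simp add: A.nat_pow_mult)
          have "[L (x \<otimes>\<^bsub>A\<^esub> y) = l h + l h' + (k + k') * s] (mod m)"
          proof (cases "k + k' < r")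
            case True
            then have "L (x \<otimes>\<^bsub>A\<^esub> y) = l (h \<otimes>\<^bsub>A\<^esub> h') + (k + k') * s" using xy hh by (simp add: Lg)
            then show ?thesis using lmult[of h h'] x y by (simp add: cong_add_rcancel_nat)
          next
            case False
            \<comment> \<open>The carry from \<open>a\<^sup>r\<close> goes to \<open>b \<in> H\<close>.\<close>
            define k0 where "k0 = k + k' - r"
            have k0: "k + k' = r + k0" "k0 < r" using False x y by (auto simp: k0_def)
            have "x \<otimes>\<^bsub>A\<^esub> y = h \<otimes>\<^bsub>A\<^esub> h' \<otimes>\<^bsub>A\<^esub> (b \<otimes>\<^bsub>A\<^esub> a [^]\<^bsub>A\<^esub> k0)"
              unfolding xy k0(1) using a by (simp add: b_def A.nat_pow_mult)
            then have "x \<otimes>\<^bsub>A\<^esub> y = (h \<otimes>\<^bsub>A\<^esub> h' \<otimes>\<^bsub>A\<^esub> b) \<otimes>\<^bsub>A\<^esub> a [^]\<^bsub>A\<^esub> k0"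
              using hh b apow H.subset x y by (simp add: A.m_assoc subset_iff)
            then have "L (x \<otimes>\<^bsub>A\<^esub> y) = l (h \<otimes>\<^bsub>A\<^esub> h' \<otimes>\<^bsub>A\<^esub> b) + k0 * s"
              using hh b k0 by (simp add: Lg)
            also have "[\<dots> = (l h + l h' + r * s) + k0 * s] (mod m)"
            proof (rule cong_add[OF _ cong_refl])
              have "[l (h \<otimes>\<^bsub>A\<^esub> h' \<otimes>\<^bsub>A\<^esub> b) = l (h \<otimes>\<^bsub>A\<^esub> h') + l b] (mod m)" using hh b by (rule lmult)
              also have "[l (h \<otimes>\<^bsub>A\<^esub> h') + l b = l h + l h' + r * s] (mod m)"
                using lmult[OF x(1) y(1)] rs by (rule cong_add)
              finally show "[l (h \<otimes>\<^bsub>A\<^esub> h' \<otimes>\<^bsub>A\<^esub> b) = l h + l h' + r * s] (mod m)" .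
            qed
            finally show ?thesis by (simp only: k0(1) add_mult_distrib add.assoc)
          qed
          then show "[L (x \<otimes>\<^bsub>A\<^esub> y) = L x + L y] (mod m)"
            using x y by (simp add: Lg algebra_simps)
        qed
        then have "\<zero>\<^bsub>K\<^esub> = (\<Oplus>\<^bsub>K\<^esub>x\<in>H'. f x \<otimes>\<^bsub>K\<^esub> \<zeta> [^]\<^bsub>K\<^esub> L x)" using zero by simp
        also have "\<dots> = (\<Oplus>\<^bsub>K\<^esub>p\<in>D. f (g p) \<otimes>\<^bsub>K\<^esub> \<zeta> [^]\<^bsub>K\<^esub> L (g p))"
          using f zeta by (intro finsum_bij[OF bij, symmetric]) auto
        also have "\<dots> = (\<Oplus>\<^bsub>K\<^esub>h\<in>H. \<Oplus>\<^bsub>K\<^esub>k\<in>{..<r}. f (g (h, k)) \<otimes>\<^bsub>K\<^esub> \<zeta> [^]\<^bsub>K\<^esub> L (g (h, k)))"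
          unfolding D_def using fin fK zeta by (intro finsum_Times) (auto simp: g_def)
        also have "\<dots> = (\<Oplus>\<^bsub>K\<^esub>k\<in>{..<r}. \<Oplus>\<^bsub>K\<^esub>h\<in>H. f (g (h, k)) \<otimes>\<^bsub>K\<^esub> \<zeta> [^]\<^bsub>K\<^esub> L (g (h, k)))"
          using fin fK zeta by (intro finsum_swap) (auto simp: g_def)
        also have "\<dots> = (\<Oplus>\<^bsub>K\<^esub>k\<in>{..<r}. (\<Oplus>\<^bsub>K\<^esub>h\<in>H. f (h \<otimes>\<^bsub>A\<^esub> a [^]\<^bsub>A\<^esub> k) \<otimes>\<^bsub>K\<^esub> \<zeta> [^]\<^bsub>K\<^esub> l h)
            \<otimes>\<^bsub>K\<^esub> (\<zeta> [^]\<^bsub>K\<^esub> c \<otimes>\<^bsub>K\<^esub> (\<zeta> [^]\<^bsub>K\<^esub> e) [^]\<^bsub>K\<^esub> t) [^]\<^bsub>K\<^esub> k)"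
        proof (rule finsum_eqI)
          fix k assume k: "k \<in> {..<r}"
          have zs: "(\<zeta> [^]\<^bsub>K\<^esub> c \<otimes>\<^bsub>K\<^esub> (\<zeta> [^]\<^bsub>K\<^esub> e) [^]\<^bsub>K\<^esub> t) [^]\<^bsub>K\<^esub> k = \<zeta> [^]\<^bsub>K\<^esub> (k * s)"
            using zeta by (simp add: nat_pow_pow nat_pow_mult s_def algebra_simps)
          have "(\<Oplus>\<^bsub>K\<^esub>h\<in>H. f (g (h, k)) \<otimes>\<^bsub>K\<^esub> \<zeta> [^]\<^bsub>K\<^esub> L (g (h, k)))
              = (\<Oplus>\<^bsub>K\<^esub>h\<in>H. f (h \<otimes>\<^bsub>A\<^esub> a [^]\<^bsub>A\<^esub> k) \<otimes>\<^bsub>K\<^esub> \<zeta> [^]\<^bsub>K\<^esub> l h \<otimes>\<^bsub>K\<^esub> \<zeta> [^]\<^bsub>K\<^esub> (k * s))"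
            using k fK zeta by (intro finsum_eqI) (auto simp: g_def Lg m_assoc nat_pow_mult)
          also have "\<dots> = (\<Oplus>\<^bsub>K\<^esub>h\<in>H. f (h \<otimes>\<^bsub>A\<^esub> a [^]\<^bsub>A\<^esub> k) \<otimes>\<^bsub>K\<^esub> \<zeta> [^]\<^bsub>K\<^esub> l h) \<otimes>\<^bsub>K\<^esub> \<zeta> [^]\<^bsub>K\<^esub> (k * s)"
            using fin fK zeta by (intro finsum_ldistr[symmetric]) auto
          finally show "(\<Oplus>\<^bsub>K\<^esub>h\<in>H. f (g (h, k)) \<otimes>\<^bsub>K\<^esub> \<zeta> [^]\<^bsub>K\<^esub> L (g (h, k))) =
              (\<Oplus>\<^bsub>K\<^esub>h\<in>H. f (h \<otimes>\<^bsub>A\<^esub> a [^]\<^bsub>A\<^esub> k) \<otimes>\<^bsub>K\<^esub> \<zeta> [^]\<^bsub>K\<^esub> l h)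
              \<otimes>\<^bsub>K\<^esub> (\<zeta> [^]\<^bsub>K\<^esub> c \<otimes>\<^bsub>K\<^esub> (\<zeta> [^]\<^bsub>K\<^esub> e) [^]\<^bsub>K\<^esub> t) [^]\<^bsub>K\<^esub> k"
            unfolding zs .
        qed (use fK zeta in \<open>auto simp: g_def intro!: finsum_closed\<close>)
        finally show "(\<Oplus>\<^bsub>K\<^esub>k\<in>{..<r}. (\<Oplus>\<^bsub>K\<^esub>h\<in>H. f (h \<otimes>\<^bsub>A\<^esub> a [^]\<^bsub>A\<^esub> k) \<otimes>\<^bsub>K\<^esub> \<zeta> [^]\<^bsub>K\<^esub> l h)
            \<otimes>\<^bsub>K\<^esub> (\<zeta> [^]\<^bsub>K\<^esub> c \<otimes>\<^bsub>K\<^esub> (\<zeta> [^]\<^bsub>K\<^esub> e) [^]\<^bsub>K\<^esub> t) [^]\<^bsub>K\<^esub> k) = \<zero>\<^bsub>K\<^esub>" by simp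
      qed (use zeta zeta_pow_nonzero fK j in \<open>auto intro!: finsum_closed\<close>)
    qed
    have "f (h \<otimes>\<^bsub>A\<^esub> a [^]\<^bsub>A\<^esub> k) = \<zero>\<^bsub>K\<^esub>" if "h \<in> H" "k < r" for h k
      using sep[unfolded separated_def, rule_format, of "\<lambda>h. f (h \<otimes>\<^bsub>A\<^esub> a [^]\<^bsub>A\<^esub> k)"] fK coeff that by blast
    then show "\<forall>h\<in>H'. f h = \<zero>\<^bsub>K\<^esub>" by (auto simp: H'_def g_def D_def)
  qed
  moreover have "a \<in> H'" using mem_H'[of "\<one>\<^bsub>A\<^esub>" 1] a by simp
  ultimately show ?thesis using sub' HsubH' by blast
qed

text \<open>A maximal subgroup among the separated ones absorbs every element.\<close>

lemma characters_separate:
  assumes f: "\<And>a. a \<in> carrier A \<Longrightarrow> f a \<in> carrier K"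
    and zero: "\<And>l. additive_mod A m (carrier A) l \<Longrightarrow> (\<Oplus>\<^bsub>K\<^esub>a\<in>carrier A. f a \<otimes>\<^bsub>K\<^esub> \<zeta> [^]\<^bsub>K\<^esub> l a) = \<zero>\<^bsub>K\<^esub>"
    and a: "a \<in> carrier A"
  shows "f a = \<zero>\<^bsub>K\<^esub>"
proof -
  define \<H> where "\<H> = {H. subgroup H A \<and> separated H}"
  have "\<H> \<subseteq> Pow (carrier A)" by (auto simp: \<H>_def dest: subgroup.subset)
  then have "finite \<H>" using finite_A finite_subset by blast
  moreover have "\<H> \<noteq> {}" using separated_trivial A.triv_subgroup by (auto simp: \<H>_def)
  ultimately obtain H where H: "H \<in> \<H>" and max: "\<And>H'. H' \<in> \<H> \<Longrightarrow> H \<subseteq> H' \<Longrightarrow> H = H'"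
    using finite_has_maximal[of \<H>] by blast
  have "b \<in> H" if "b \<in> carrier A" for b
    using separated_step[of H b] H that max unfolding \<H>_def by blast
  then have "H = carrier A" using H by (auto simp: \<H>_def dest: subgroup.subset)
  then show ?thesis using H f zero a by (auto simp: \<H>_def separated_def)
qed

text \<open>
  By separation, some character does not annihilate the sum of \<open>\<zeta>\<^sup>-\<^sup>k
  g\<^sup>k\<close> over \<open>k < m\<close>. A character \<open>l\<close> maps it to a geometric
  sum with ratio \<open>\<zeta>\<^sup>l\<^sup>g\<^sup>-\<^sup>1\<close>, which is zero unless the
  ratio is 1.
\<close>

lemma exists_character_of_generator:
  assumes g: "g \<in> carrier A" "A.ord g = m"
  shows "\<exists>l. additive_mod A m (carrier A) l \<and> [l g = 1] (mod m)"
proof (rule ccontr)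
  assume none: "\<not> ?thesis"
  \<comment> \<open>The exponent \<open>(m - 1) k\<close> stands for \<open>- k\<close>.\<close>
  define f where "f x = (if x \<in> (\<lambda>k. g [^]\<^bsub>A\<^esub> k) ` {..<m}
     then \<zeta> [^]\<^bsub>K\<^esub> ((m - 1) * the_inv_into {..<m} (\<lambda>k::nat. g [^]\<^bsub>A\<^esub> k) x) else \<zero>\<^bsub>K\<^esub>)" for x
  have inj: "inj_on (\<lambda>k::nat. g [^]\<^bsub>A\<^esub> k) {..<m}"
  proof -
    have "{..<m} = {0..A.ord g - 1}" using g m_pos by auto
    then show ?thesis using A.ord_inj[OF g(1)] by simp
  qed
  have fg: "f (g [^]\<^bsub>A\<^esub> k) = \<zeta> [^]\<^bsub>K\<^esub> ((m - 1) * k)" if "k < m" for k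
    using that the_inv_into_f_f[OF inj, of k] by (auto simp: f_def)
  have fK: "f a \<in> carrier K" for a using zeta by (auto simp: f_def)
  have "f \<one>\<^bsub>A\<^esub> = \<zero>\<^bsub>K\<^esub>"
  proof (rule characters_separate)
    fix l assume l: "additive_mod A m (carrier A) l"
    define w where "w = \<zeta> [^]\<^bsub>K\<^esub> (m - 1 + l g)"
    have "w \<noteq> \<one>\<^bsub>K\<^esub>"
    proof
      assume "w = \<one>\<^bsub>K\<^esub>"
      then have "[m - 1 + l g = 0] (mod m)"
        by (simp add: w_def primitive_root_power_eq_one_iff[OF root] cong_0_iff)
      then have "[1 + (m - 1 + l g) = 1 + 0] (mod m)" by (rule cong_add[OF cong_refl])
      then have "[l g = 1] (mod m)" using m_pos by (simp add: cong_def)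
      then show False using none l by blast
    qed
    moreover have "w [^]\<^bsub>K\<^esub> m = \<one>\<^bsub>K\<^esub>"
      using zeta by (simp add: w_def nat_pow_pow primitive_root_power_eq_one_iff[OF root])
    ultimately have geo: "(\<Oplus>\<^bsub>K\<^esub>k\<in>{..<m}. w [^]\<^bsub>K\<^esub> k) = \<zero>\<^bsub>K\<^esub>"
      using zeta by (intro geometric_sum_zero) (auto simp: w_def)
    have "(\<Oplus>\<^bsub>K\<^esub>a\<in>carrier A. f a \<otimes>\<^bsub>K\<^esub> \<zeta> [^]\<^bsub>K\<^esub> l a)
        = (\<Oplus>\<^bsub>K\<^esub>a\<in>(\<lambda>k. g [^]\<^bsub>A\<^esub> k) ` {..<m}. f a \<otimes>\<^bsub>K\<^esub> \<zeta> [^]\<^bsub>K\<^esub> l a)"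
      using finite_A fK zeta g by (intro add.finprod_mono_neutral_cong_right) (auto simp: f_def)
    also have "\<dots> = (\<Oplus>\<^bsub>K\<^esub>k\<in>{..<m}. f (g [^]\<^bsub>A\<^esub> k) \<otimes>\<^bsub>K\<^esub> \<zeta> [^]\<^bsub>K\<^esub> l (g [^]\<^bsub>A\<^esub> k))"
      using fK zeta inj by (intro finsum_reindex) auto
    also have "\<dots> = (\<Oplus>\<^bsub>K\<^esub>k\<in>{..<m}. w [^]\<^bsub>K\<^esub> k)"
    proof (rule finsum_eqI)
      fix k assume k: "k \<in> {..<m}"
      have "[l (g [^]\<^bsub>A\<^esub> k) = k * l g] (mod m)"
        using additive_mod_pow[OF l A.monoid_axioms] g by auto
      then have "\<zeta> [^]\<^bsub>K\<^esub> l (g [^]\<^bsub>A\<^esub> k) = \<zeta> [^]\<^bsub>K\<^esub> (k * l g)"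
        by (simp add: primitive_root_power_eq_iff[OF root])
      then show "f (g [^]\<^bsub>A\<^esub> k) \<otimes>\<^bsub>K\<^esub> \<zeta> [^]\<^bsub>K\<^esub> l (g [^]\<^bsub>A\<^esub> k) = w [^]\<^bsub>K\<^esub> k"
        using k zeta by (simp add: fg w_def nat_pow_pow nat_pow_mult algebra_simps)
    qed (use fK zeta in auto)
    finally show "(\<Oplus>\<^bsub>K\<^esub>a\<in>carrier A. f a \<otimes>\<^bsub>K\<^esub> \<zeta> [^]\<^bsub>K\<^esub> l a) = \<zero>\<^bsub>K\<^esub>" using geo by simp
  qed (use fK in auto)
  moreover have "f \<one>\<^bsub>A\<^esub> = \<one>\<^bsub>K\<^esub>" using fg[of 0] m_pos by simp
  ultimately show False by simp
qed

end

section \<open>Evaluating the group ring at characters\<close>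

text \<open>The substitution \<open>x = y w\<close> splits the double sum into a product.\<close>

lemma (in finite_group_ring) evaluation_mult:
  assumes "cring K" and \<iota>: "\<iota> \<in> ring_hom R K"
    and \<chi>: "\<And>x. x \<in> carrier G \<Longrightarrow> \<chi> x \<in> carrier K"
      "\<And>x y. x \<in> carrier G \<Longrightarrow> y \<in> carrier G \<Longrightarrow> \<chi> (x \<otimes>\<^bsub>G\<^esub> y) = \<chi> x \<otimes>\<^bsub>K\<^esub> \<chi> y"
    and f: "f \<in> carrier RG" and h: "h \<in> carrier RG"
  shows "(\<Oplus>\<^bsub>K\<^esub>x\<in>carrier G. \<iota> ((f \<otimes>\<^bsub>RG\<^esub> h) x) \<otimes>\<^bsub>K\<^esub> \<chi> x)
    = (\<Oplus>\<^bsub>K\<^esub>x\<in>carrier G. \<iota> (f x) \<otimes>\<^bsub>K\<^esub> \<chi> x) \<otimes>\<^bsub>K\<^esub> (\<Oplus>\<^bsub>K\<^esub>x\<in>carrier G. \<iota> (h x) \<otimes>\<^bsub>K\<^esub> \<chi> x)"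
proof -
  interpret K: cring K by fact
  interpret \<iota>: ring_hom_cring R K \<iota>
    by unfold_locales (rule \<iota>)
  let ?G = "carrier G" and ?S = "\<Oplus>\<^bsub>K\<^esub>x\<in>carrier G. \<iota> (h x) \<otimes>\<^bsub>K\<^esub> \<chi> x"
  have "(\<Oplus>\<^bsub>K\<^esub>x\<in>?G. \<iota> ((f \<otimes>\<^bsub>RG\<^esub> h) x) \<otimes>\<^bsub>K\<^esub> \<chi> x)
      = (\<Oplus>\<^bsub>K\<^esub>x\<in>?G. \<Oplus>\<^bsub>K\<^esub>y\<in>?G. \<iota> (f y) \<otimes>\<^bsub>K\<^esub> \<iota> (h (inv\<^bsub>G\<^esub> y \<otimes>\<^bsub>G\<^esub> x)) \<otimes>\<^bsub>K\<^esub> \<chi> x)"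
  proof (rule K.finsum_eqI)
    fix x assume x: "x \<in> ?G"
    have "\<iota> ((f \<otimes>\<^bsub>RG\<^esub> h) x) = (\<Oplus>\<^bsub>K\<^esub>y\<in>?G. \<iota> (f y \<otimes> h (inv\<^bsub>G\<^esub> y \<otimes>\<^bsub>G\<^esub> x)))"
      using f h x by (simp add: RG_mult \<iota>.hom_finsum comp_def)
    also have "\<dots> = (\<Oplus>\<^bsub>K\<^esub>y\<in>?G. \<iota> (f y) \<otimes>\<^bsub>K\<^esub> \<iota> (h (inv\<^bsub>G\<^esub> y \<otimes>\<^bsub>G\<^esub> x)))"
      using f h x by (intro K.finsum_eqI) auto
    finally show "\<iota> ((f \<otimes>\<^bsub>RG\<^esub> h) x) \<otimes>\<^bsub>K\<^esub> \<chi> x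
        = (\<Oplus>\<^bsub>K\<^esub>y\<in>?G. \<iota> (f y) \<otimes>\<^bsub>K\<^esub> \<iota> (h (inv\<^bsub>G\<^esub> y \<otimes>\<^bsub>G\<^esub> x)) \<otimes>\<^bsub>K\<^esub> \<chi> x)"
      using f h x \<chi> finite_G by (simp add: K.finsum_ldistr)
  qed (use f h \<chi> in auto)
  also have "\<dots> = (\<Oplus>\<^bsub>K\<^esub>y\<in>?G. \<Oplus>\<^bsub>K\<^esub>x\<in>?G. \<iota> (f y) \<otimes>\<^bsub>K\<^esub> \<iota> (h (inv\<^bsub>G\<^esub> y \<otimes>\<^bsub>G\<^esub> x)) \<otimes>\<^bsub>K\<^esub> \<chi> x)"
    using f h \<chi> by (intro K.finsum_swap finite_G) auto
  also have "\<dots> = (\<Oplus>\<^bsub>K\<^esub>y\<in>?G. \<iota> (f y) \<otimes>\<^bsub>K\<^esub> \<chi> y \<otimes>\<^bsub>K\<^esub> ?S)"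
  proof (rule K.finsum_eqI)
    fix y assume y: "y \<in> ?G"
    have "(\<Oplus>\<^bsub>K\<^esub>x\<in>?G. \<iota> (f y) \<otimes>\<^bsub>K\<^esub> \<iota> (h (inv\<^bsub>G\<^esub> y \<otimes>\<^bsub>G\<^esub> x)) \<otimes>\<^bsub>K\<^esub> \<chi> x)
        = (\<Oplus>\<^bsub>K\<^esub>w\<in>?G. \<iota> (f y) \<otimes>\<^bsub>K\<^esub> \<iota> (h (inv\<^bsub>G\<^esub> y \<otimes>\<^bsub>G\<^esub> (y \<otimes>\<^bsub>G\<^esub> w))) \<otimes>\<^bsub>K\<^esub> \<chi> (y \<otimes>\<^bsub>G\<^esub> w))"
      using f h y \<chi> by (intro K.finsum_bij[OF bij_left_translation[OF y], symmetric]) auto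
    also have "\<dots> = (\<Oplus>\<^bsub>K\<^esub>w\<in>?G. \<iota> (f y) \<otimes>\<^bsub>K\<^esub> \<chi> y \<otimes>\<^bsub>K\<^esub> (\<iota> (h w) \<otimes>\<^bsub>K\<^esub> \<chi> w))"
      using f h y \<chi> by (intro K.finsum_eqI) (auto simp: K.m_ac simp flip: G.m_assoc)
    also have "\<dots> = \<iota> (f y) \<otimes>\<^bsub>K\<^esub> \<chi> y \<otimes>\<^bsub>K\<^esub> ?S"
      using f h y \<chi> finite_G by (intro K.finsum_rdistr[symmetric]) auto
    finally show "(\<Oplus>\<^bsub>K\<^esub>x\<in>?G. \<iota> (f y) \<otimes>\<^bsub>K\<^esub> \<iota> (h (inv\<^bsub>G\<^esub> y \<otimes>\<^bsub>G\<^esub> x)) \<otimes>\<^bsub>K\<^esub> \<chi> x) = \<dots>" .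
  qed (use f h \<chi> in \<open>auto intro!: K.finsum_closed\<close>)
  also have "\<dots> = (\<Oplus>\<^bsub>K\<^esub>x\<in>?G. \<iota> (f x) \<otimes>\<^bsub>K\<^esub> \<chi> x) \<otimes>\<^bsub>K\<^esub> ?S"
    using f h \<chi> finite_G by (intro K.finsum_ldistr[symmetric]) (auto intro!: K.finsum_closed)
  finally show ?thesis .
qed

lemma (in finite_group_ring) evaluation_ring_hom:
  assumes "cring K" and \<iota>: "\<iota> \<in> ring_hom R K"
    and \<chi>: "\<And>x. x \<in> carrier G \<Longrightarrow> \<chi> x \<in> carrier K"
      "\<And>x y. x \<in> carrier G \<Longrightarrow> y \<in> carrier G \<Longrightarrow> \<chi> (x \<otimes>\<^bsub>G\<^esub> y) = \<chi> x \<otimes>\<^bsub>K\<^esub> \<chi> y"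
      "\<chi> \<one>\<^bsub>G\<^esub> = \<one>\<^bsub>K\<^esub>"
  shows "(\<lambda>f. \<Oplus>\<^bsub>K\<^esub>x\<in>carrier G. \<iota> (f x) \<otimes>\<^bsub>K\<^esub> \<chi> x) \<in> ring_hom RG K"
proof (rule ring_hom_memI)
  interpret K: cring K by fact
  interpret \<iota>: ring_hom_cring R K \<iota>
    by unfold_locales (rule \<iota>)
  show "(\<Oplus>\<^bsub>K\<^esub>x\<in>carrier G. \<iota> (\<one>\<^bsub>RG\<^esub> x) \<otimes>\<^bsub>K\<^esub> \<chi> x) = \<one>\<^bsub>K\<^esub>"
  proof -
    have "(\<Oplus>\<^bsub>K\<^esub>x\<in>carrier G. \<iota> (\<one>\<^bsub>RG\<^esub> x) \<otimes>\<^bsub>K\<^esub> \<chi> x)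
        = (\<Oplus>\<^bsub>K\<^esub>x\<in>carrier G. if \<one>\<^bsub>G\<^esub> = x then \<chi> x else \<zero>\<^bsub>K\<^esub>)"
      using \<chi> by (intro K.finsum_eqI) (auto simp: RG_one)
    then show ?thesis using \<chi> finite_G by (subst (asm) K.finsum_singleton) auto
  qed
  fix f h assume fh: "f \<in> carrier RG" "h \<in> carrier RG"
  show "(\<Oplus>\<^bsub>K\<^esub>x\<in>carrier G. \<iota> (f x) \<otimes>\<^bsub>K\<^esub> \<chi> x) \<in> carrier K"
    using fh \<chi> by (intro K.finsum_closed) auto
  show "(\<Oplus>\<^bsub>K\<^esub>x\<in>carrier G. \<iota> ((f \<otimes>\<^bsub>RG\<^esub> h) x) \<otimes>\<^bsub>K\<^esub> \<chi> x)
    = (\<Oplus>\<^bsub>K\<^esub>x\<in>carrier G. \<iota> (f x) \<otimes>\<^bsub>K\<^esub> \<chi> x) \<otimes>\<^bsub>K\<^esub> (\<Oplus>\<^bsub>K\<^esub>x\<in>carrier G. \<iota> (h x) \<otimes>\<^bsub>K\<^esub> \<chi> x)"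
    by (rule evaluation_mult[OF \<open>cring K\<close> \<iota>]) (use \<chi> fh in auto)
  have "(\<Oplus>\<^bsub>K\<^esub>x\<in>carrier G. \<iota> ((f \<oplus>\<^bsub>RG\<^esub> h) x) \<otimes>\<^bsub>K\<^esub> \<chi> x)
      = (\<Oplus>\<^bsub>K\<^esub>x\<in>carrier G. \<iota> (f x) \<otimes>\<^bsub>K\<^esub> \<chi> x \<oplus>\<^bsub>K\<^esub> \<iota> (h x) \<otimes>\<^bsub>K\<^esub> \<chi> x)"
    using fh \<chi> by (intro K.finsum_cong') (auto simp: RG_add K.l_distr)
  also have "\<dots> = (\<Oplus>\<^bsub>K\<^esub>x\<in>carrier G. \<iota> (f x) \<otimes>\<^bsub>K\<^esub> \<chi> x) \<oplus>\<^bsub>K\<^esub> (\<Oplus>\<^bsub>K\<^esub>x\<in>carrier G. \<iota> (h x) \<otimes>\<^bsub>K\<^esub> \<chi> x)"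
    using fh \<chi> by (intro K.finsum_addf) auto
  finally show "(\<Oplus>\<^bsub>K\<^esub>x\<in>carrier G. \<iota> ((f \<oplus>\<^bsub>RG\<^esub> h) x) \<otimes>\<^bsub>K\<^esub> \<chi> x) = \<dots>" .
qed

text \<open>
  A character \<open>\<chi>\<close> of the second factor of \<open>Q \<times>\<times> A\<close>
  moves that factor into the coefficients, as \<open>twist\<close> below does.
\<close>

locale character_twist = F: cring F + K: cring K + Q: group Q + A: comm_group A
  for F (structure) and K (structure) and Q (structure) and A (structure) +
  fixes \<iota> \<chi>
  assumes finite_Q: "finite (carrier Q)" and finite_A: "finite (carrier A)"
    and \<iota>: "\<iota> \<in> ring_hom F K"
    and \<chi>_closed [simp]: "\<And>a. a \<in> carrier A \<Longrightarrow> \<chi> a \<in> carrier K"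
    and \<chi>_mult: "\<And>a b. a \<in> carrier A \<Longrightarrow> b \<in> carrier A \<Longrightarrow> \<chi> (a \<otimes>\<^bsub>A\<^esub> b) = \<chi> a \<otimes>\<^bsub>K\<^esub> \<chi> b"
    and \<chi>_one: "\<chi> \<one>\<^bsub>A\<^esub> = \<one>\<^bsub>K\<^esub>"
begin

sublocale FG: finite_group_ring F "Q \<times>\<times> A"
  by (intro finite_group_ring.intro finite_group_ring_axioms.intro F.cring_axioms
      DirProd_group Q.group_axioms A.group_axioms) (simp add: finite_Q finite_A)

sublocale KQ: finite_group_ring K Q
  by (intro finite_group_ring.intro finite_group_ring_axioms.intro K.cring_axioms
      Q.group_axioms finite_Q)

sublocale \<iota>: ring_hom_cring F K \<iota>
  by unfold_locales (rule \<iota>)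

definition twist where
  "twist f = (\<lambda>q\<in>carrier Q. \<Oplus>\<^bsub>K\<^esub>a\<in>carrier A. \<iota> (f (q, a)) \<otimes>\<^bsub>K\<^esub> \<chi> a)"

lemma twist_closed: "f \<in> carrier FG.RG \<Longrightarrow> twist f \<in> carrier KQ.RG"
  unfolding twist_def by (intro KQ.RG_memI K.finsum_closed) auto

lemma FG_apply [simp]: "f \<in> carrier FG.RG \<Longrightarrow> q \<in> carrier Q \<Longrightarrow> a \<in> carrier A \<Longrightarrow> f (q, a) \<in> carrier F"
  by auto

lemma twist_mult:
  assumes f: "f \<in> carrier FG.RG" and h: "h \<in> carrier FG.RG"
  shows "twist (f \<otimes>\<^bsub>FG.RG\<^esub> h) = twist f \<otimes>\<^bsub>KQ.RG\<^esub> twist h"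
proof (rule KQ.RG_eqI)
  fix q assume q: "q \<in> carrier Q"
  let ?Q = "carrier Q" and ?A = "carrier A"
  let ?t = "\<lambda>p b a. \<iota> (f (p, b)) \<otimes>\<^bsub>K\<^esub> \<iota> (h (inv\<^bsub>Q\<^esub> p \<otimes>\<^bsub>Q\<^esub> q, inv\<^bsub>A\<^esub> b \<otimes>\<^bsub>A\<^esub> a)) \<otimes>\<^bsub>K\<^esub> \<chi> a"
  have t: "?t p b a \<in> carrier K" if "p \<in> ?Q" "b \<in> ?A" "a \<in> ?A" for p b a
    using that f h q by simp
  have "twist (f \<otimes>\<^bsub>FG.RG\<^esub> h) q = (\<Oplus>\<^bsub>K\<^esub>a\<in>?A. \<Oplus>\<^bsub>K\<^esub>p\<in>?Q. \<Oplus>\<^bsub>K\<^esub>b\<in>?A. ?t p b a)"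
  proof -
    have "\<iota> ((f \<otimes>\<^bsub>FG.RG\<^esub> h) (q, a)) \<otimes>\<^bsub>K\<^esub> \<chi> a = (\<Oplus>\<^bsub>K\<^esub>p\<in>?Q. \<Oplus>\<^bsub>K\<^esub>b\<in>?A. ?t p b a)" if a: "a \<in> ?A" for a
    proof -
      let ?u = "\<lambda>x. f x \<otimes>\<^bsub>F\<^esub> h (inv\<^bsub>Q \<times>\<times> A\<^esub> x \<otimes>\<^bsub>Q \<times>\<times> A\<^esub> (q, a))"
      have u: "?u x \<in> carrier F" if "x \<in> carrier (Q \<times>\<times> A)" for x
      proof -
        have "(q, a) \<in> carrier (Q \<times>\<times> A)" using q a by simp
        then show ?thesis using that f h by (intro F.m_closed FG.RG_closed FG.G.m_closed FG.G.inv_closed)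
      qed
      have "\<iota> ((f \<otimes>\<^bsub>FG.RG\<^esub> h) (q, a)) \<otimes>\<^bsub>K\<^esub> \<chi> a = (\<Oplus>\<^bsub>K\<^esub>x\<in>carrier (Q \<times>\<times> A). \<iota> (?u x)) \<otimes>\<^bsub>K\<^esub> \<chi> a"
        using f h q a u by (subst FG.RG_mult) (auto simp: \<iota>.hom_finsum comp_def)
      also have "\<dots> = (\<Oplus>\<^bsub>K\<^esub>x\<in>carrier (Q \<times>\<times> A). \<iota> (?u x) \<otimes>\<^bsub>K\<^esub> \<chi> a)"
        using a u FG.finite_G by (intro K.finsum_ldistr) auto
      also have "\<dots> = (\<Oplus>\<^bsub>K\<^esub>p\<in>?Q. \<Oplus>\<^bsub>K\<^esub>b\<in>?A. \<iota> (?u (p, b)) \<otimes>\<^bsub>K\<^esub> \<chi> a)"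
        unfolding carrier_DirProd using a u finite_Q finite_A by (intro K.finsum_Times) auto
      also have "\<dots> = (\<Oplus>\<^bsub>K\<^esub>p\<in>?Q. \<Oplus>\<^bsub>K\<^esub>b\<in>?A. ?t p b a)"
      proof (intro K.finsum_eqI)
        fix p b assume pb: "p \<in> ?Q" "b \<in> ?A"
        show "\<iota> (?u (p, b)) \<otimes>\<^bsub>K\<^esub> \<chi> a = ?t p b a"
          using pb f h q a by (simp add: inv_DirProd[OF Q.group_axioms A.group_axioms])
        show "\<iota> (?u (p, b)) \<otimes>\<^bsub>K\<^esub> \<chi> a \<in> carrier K" using u[of "(p, b)"] pb a by simp
      next
        fix p assume "p \<in> ?Q"
        then show "(\<Oplus>\<^bsub>K\<^esub>b\<in>?A. \<iota> (?u (p, b)) \<otimes>\<^bsub>K\<^esub> \<chi> a) \<in> carrier K"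
          using u a by (intro K.finsum_closed) auto
      qed
      finally show ?thesis .
    qed
    then show ?thesis
      using q t unfolding twist_def by (auto intro!: K.finsum_cong' K.finsum_closed)
  qed
  also have "\<dots> = (\<Oplus>\<^bsub>K\<^esub>p\<in>?Q. \<Oplus>\<^bsub>K\<^esub>a\<in>?A. \<Oplus>\<^bsub>K\<^esub>b\<in>?A. ?t p b a)"
    using t by (intro K.finsum_swap finite_Q finite_A K.finsum_closed) auto
  also have "\<dots> = (\<Oplus>\<^bsub>K\<^esub>p\<in>?Q. twist f p \<otimes>\<^bsub>K\<^esub> twist h (inv\<^bsub>Q\<^esub> p \<otimes>\<^bsub>Q\<^esub> q))"
  proof (rule K.finsum_cong')
    fix p assume p: "p \<in> ?Q"
    let ?S = "twist h (inv\<^bsub>Q\<^esub> p \<otimes>\<^bsub>Q\<^esub> q)"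
    have S: "?S = (\<Oplus>\<^bsub>K\<^esub>a\<in>?A. \<iota> (h (inv\<^bsub>Q\<^esub> p \<otimes>\<^bsub>Q\<^esub> q, a)) \<otimes>\<^bsub>K\<^esub> \<chi> a)" "?S \<in> carrier K"
      using p q KQ.RG_closed[OF twist_closed[OF h]] by (auto simp: twist_def)
    have "(\<Oplus>\<^bsub>K\<^esub>a\<in>?A. \<Oplus>\<^bsub>K\<^esub>b\<in>?A. ?t p b a) = (\<Oplus>\<^bsub>K\<^esub>b\<in>?A. \<Oplus>\<^bsub>K\<^esub>a\<in>?A. ?t p b a)"
      using t p by (intro K.finsum_swap finite_A) auto
    also have "\<dots> = (\<Oplus>\<^bsub>K\<^esub>b\<in>?A. \<iota> (f (p, b)) \<otimes>\<^bsub>K\<^esub> \<chi> b \<otimes>\<^bsub>K\<^esub> ?S)"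
    proof (rule K.finsum_eqI)
      fix b assume b: "b \<in> ?A"
      have bij: "bij_betw (\<lambda>a. b \<otimes>\<^bsub>A\<^esub> a) ?A ?A"
        by (rule bij_betw_byWitness[where f' = "\<lambda>w. inv\<^bsub>A\<^esub> b \<otimes>\<^bsub>A\<^esub> w"])
          (use b in \<open>auto simp: A.m_assoc[symmetric]\<close>)
      have "(\<Oplus>\<^bsub>K\<^esub>a\<in>?A. ?t p b a) = (\<Oplus>\<^bsub>K\<^esub>a\<in>?A. ?t p b (b \<otimes>\<^bsub>A\<^esub> a))"
        using t p b by (intro K.finsum_bij[OF bij, symmetric]) auto
      also have "\<dots> = (\<Oplus>\<^bsub>K\<^esub>a\<in>?A. \<iota> (f (p, b)) \<otimes>\<^bsub>K\<^esub> \<chi> b \<otimes>\<^bsub>K\<^esub> (\<iota> (h (inv\<^bsub>Q\<^esub> p \<otimes>\<^bsub>Q\<^esub> q, a)) \<otimes>\<^bsub>K\<^esub> \<chi> a))"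
      proof (rule K.finsum_eqI)
        fix a assume a: "a \<in> ?A"
        show "?t p b (b \<otimes>\<^bsub>A\<^esub> a) \<in> carrier K" using t p a b by auto
        have "inv\<^bsub>A\<^esub> b \<otimes>\<^bsub>A\<^esub> (b \<otimes>\<^bsub>A\<^esub> a) = a" using a b by (simp flip: A.m_assoc)
        then show "?t p b (b \<otimes>\<^bsub>A\<^esub> a) = \<iota> (f (p, b)) \<otimes>\<^bsub>K\<^esub> \<chi> b \<otimes>\<^bsub>K\<^esub> (\<iota> (h (inv\<^bsub>Q\<^esub> p \<otimes>\<^bsub>Q\<^esub> q, a)) \<otimes>\<^bsub>K\<^esub> \<chi> a)"
          using a b p q f h by (simp add: \<chi>_mult K.m_ac)
      qed
      also have "\<dots> = \<iota> (f (p, b)) \<otimes>\<^bsub>K\<^esub> \<chi> b \<otimes>\<^bsub>K\<^esub> ?S"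
        unfolding S(1) using f h p q b finite_A by (intro K.finsum_rdistr[symmetric]) auto
      finally show "(\<Oplus>\<^bsub>K\<^esub>a\<in>?A. ?t p b a) = \<dots>" .
    qed (use t p in \<open>auto intro!: K.finsum_closed\<close>)
    also have "\<dots> = twist f p \<otimes>\<^bsub>K\<^esub> ?S"
      using p f S(2) finite_A by (simp add: twist_def K.finsum_ldistr)
    finally show "(\<Oplus>\<^bsub>K\<^esub>a\<in>?A. \<Oplus>\<^bsub>K\<^esub>b\<in>?A. ?t p b a) = twist f p \<otimes>\<^bsub>K\<^esub> ?S" .
  qed (use q KQ.RG_closed[OF twist_closed[OF h]] KQ.RG_closed[OF twist_closed[OF f]] in auto)
  also have "\<dots> = (twist f \<otimes>\<^bsub>KQ.RG\<^esub> twist h) q"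
    using q by (simp add: KQ.RG_mult twist_closed f h)
  finally show "twist (f \<otimes>\<^bsub>FG.RG\<^esub> h) q = (twist f \<otimes>\<^bsub>KQ.RG\<^esub> twist h) q" .
qed (use f h in \<open>auto intro!: twist_closed\<close>)

lemma twist_ring_hom: "twist \<in> ring_hom FG.RG KQ.RG"
proof (rule ring_hom_memI)
  show "twist \<one>\<^bsub>FG.RG\<^esub> = \<one>\<^bsub>KQ.RG\<^esub>"
  proof (rule KQ.RG_eqI)
    fix q assume q: "q \<in> carrier Q"
    have "twist \<one>\<^bsub>FG.RG\<^esub> q = (\<Oplus>\<^bsub>K\<^esub>a\<in>carrier A. if \<one>\<^bsub>A\<^esub> = a then \<one>\<^bsub>KQ.RG\<^esub> q else \<zero>\<^bsub>K\<^esub>)"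
      using q by (auto simp: twist_def FG.RG_one KQ.RG_one \<chi>_one intro!: K.finsum_cong')
    also have "\<dots> = \<one>\<^bsub>KQ.RG\<^esub> q"
      using q finite_A by (subst K.finsum_singleton) auto
    finally show "twist \<one>\<^bsub>FG.RG\<^esub> q = \<one>\<^bsub>KQ.RG\<^esub> q" .
  qed (auto intro!: twist_closed)
  fix f h assume fh: "f \<in> carrier FG.RG" "h \<in> carrier FG.RG"
  show "twist f \<in> carrier KQ.RG" using fh(1) by (rule twist_closed)
  show "twist (f \<otimes>\<^bsub>FG.RG\<^esub> h) = twist f \<otimes>\<^bsub>KQ.RG\<^esub> twist h" using fh by (rule twist_mult)
  show "twist (f \<oplus>\<^bsub>FG.RG\<^esub> h) = twist f \<oplus>\<^bsub>KQ.RG\<^esub> twist h"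
  proof (rule KQ.RG_eqI)
    fix q assume q: "q \<in> carrier Q"
    have "twist (f \<oplus>\<^bsub>FG.RG\<^esub> h) q
        = (\<Oplus>\<^bsub>K\<^esub>a\<in>carrier A. \<iota> (f (q, a)) \<otimes>\<^bsub>K\<^esub> \<chi> a \<oplus>\<^bsub>K\<^esub> \<iota> (h (q, a)) \<otimes>\<^bsub>K\<^esub> \<chi> a)"
      unfolding twist_def restrict_apply'[OF q]
      using q fh by (intro K.finsum_cong') (auto simp: FG.RG_add K.l_distr)
    also have "\<dots> = (twist f \<oplus>\<^bsub>KQ.RG\<^esub> twist h) q"
      using q fh by (subst K.finsum_addf) (auto simp: twist_def KQ.RG_add)
    finally show "twist (f \<oplus>\<^bsub>FG.RG\<^esub> h) q = (twist f \<oplus>\<^bsub>KQ.RG\<^esub> twist h) q" .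
  qed (use fh in \<open>auto intro!: twist_closed\<close>)
qed

end

section \<open>The group ring of the quaternion group over a field\<close>

lemma (in ring) finsum_minus:
  assumes "finite I" "\<And>i. i \<in> I \<Longrightarrow> f i \<in> carrier R" "\<And>i. i \<in> I \<Longrightarrow> g i \<in> carrier R"
  shows "(\<Oplus>i\<in>I. f i \<ominus> g i) = (\<Oplus>i\<in>I. f i) \<ominus> (\<Oplus>i\<in>I. g i)"
proof -
  have "(\<Oplus>i\<in>I. f i) = (\<Oplus>i\<in>I. (f i \<ominus> g i) \<oplus> g i)"
    using assms by (intro finsum_cong') (auto simp: minus_eq a_assoc l_neg)
  also have "\<dots> = (\<Oplus>i\<in>I. f i \<ominus> g i) \<oplus> (\<Oplus>i\<in>I. g i)"
    using assms by (intro finsum_addf) auto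
  finally have eq: "(\<Oplus>i\<in>I. f i) = (\<Oplus>i\<in>I. f i \<ominus> g i) \<oplus> (\<Oplus>i\<in>I. g i)" .
  have "s = (s \<oplus> t) \<ominus> t" if "s \<in> carrier R" "t \<in> carrier R" for s t
    using that by (simp add: minus_eq a_assoc r_neg)
  then show ?thesis
    unfolding eq using assms by (auto intro!: finsum_closed)
qed

lemma UNIV_quat_unit: "(UNIV :: quat_unit set) = {U1, UI, UJ, UK}"
  using quat_unit.exhaust by auto

lemma finite_quat_unit: "finite (UNIV :: quat_unit set)"
  by (simp add: UNIV_quat_unit)

locale quaternion_group_ring = field K for K (structure)
begin

sublocale finite_group_ring K Q8
  by (intro finite_group_ring.intro finite_group_ring_axioms.intro cring_axioms group_Q8)
    (simp add: finite_quat_unit finite_Prod_UNIV)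

lemma KQ_closed [simp]: "f \<in> carrier RG \<Longrightarrow> f x \<in> carrier K"
  by (rule RG_closed) auto

lemma finsum_quat_unit:
  assumes "\<And>u. g u \<in> carrier K"
  shows "(\<Oplus>u\<in>UNIV. g u) = g U1 \<oplus> (g UI \<oplus> (g UJ \<oplus> g UK))"
  using assms unfolding UNIV_quat_unit by (simp add: finsum_insert Pi_def)

lemma finsum_Q8:
  fixes g :: "bool \<times> quat_unit \<Rightarrow> 'a"
  assumes "\<And>x. g x \<in> carrier K"
  shows "(\<Oplus>x\<in>UNIV. g x) = (\<Oplus>u\<in>UNIV. g (False, u) \<oplus> g (True, u))"
proof -
  have "(\<Oplus>x\<in>UNIV \<times> UNIV. g x) = (\<Oplus>b\<in>UNIV. \<Oplus>u\<in>UNIV. g (b, u))"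
    by (rule finsum_Times[OF _ finite_quat_unit]) (use assms in auto)
  then have "(\<Oplus>x\<in>UNIV. g x) = (\<Oplus>b\<in>UNIV. \<Oplus>u\<in>UNIV. g (b, u))" by simp
  also have "\<dots> = (\<Oplus>u\<in>UNIV. g (False, u)) \<oplus> (\<Oplus>u\<in>UNIV. g (True, u))"
    using assms by (simp add: UNIV_bool finsum_closed Pi_def finsum_insert)
  also have "\<dots> = (\<Oplus>u\<in>UNIV. g (False, u) \<oplus> g (True, u))"
    using assms by (intro finsum_addf[symmetric]) auto
  finally show ?thesis .
qed

text \<open>
  The coordinates with respect to \<open>1, i, j, k\<close> of the image of \<open>f\<close> in
  the quaternion algebra over \<open>K\<close>, where the central element of order 2 becomes
  \<open>- 1\<close>.
\<close>

definition odd_part :: "(bool \<times> quat_unit \<Rightarrow> 'a) \<Rightarrow> quat_unit \<Rightarrow> 'a" where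
  "odd_part f u = f (False, u) \<ominus> f (True, u)"

lemma odd_part_closed [simp]: "f \<in> carrier RG \<Longrightarrow> odd_part f u \<in> carrier K"
  by (simp add: odd_part_def)

lemma odd_part_swap: "f \<in> carrier RG \<Longrightarrow> f (True, u) \<ominus> f (False, u) = \<ominus> odd_part f u"
  by (simp add: odd_part_def minus_eq minus_add a_comm)

lemma odd_part_mult_sum:
  assumes f: "f \<in> carrier RG" and h: "h \<in> carrier RG"
  shows "odd_part (f \<otimes>\<^bsub>RG\<^esub> h) w = (\<Oplus>u\<in>UNIV. odd_part f u \<otimes>
    (h (inv\<^bsub>Q8\<^esub> (False, u) \<otimes>\<^bsub>Q8\<^esub> (False, w)) \<ominus> h (inv\<^bsub>Q8\<^esub> (True, u) \<otimes>\<^bsub>Q8\<^esub> (False, w))))"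
proof -
  define M where "M u = h (inv\<^bsub>Q8\<^esub> (False, u) \<otimes>\<^bsub>Q8\<^esub> (False, w))" for u
  define N where "N u = h (inv\<^bsub>Q8\<^esub> (True, u) \<otimes>\<^bsub>Q8\<^esub> (False, w))" for u
  have MN: "M u \<in> carrier K" "N u \<in> carrier K" for u using h by (auto simp: M_def N_def)
  have N': "h (inv\<^bsub>Q8\<^esub> (False, u) \<otimes>\<^bsub>Q8\<^esub> (True, w)) = N u" and M': "h (inv\<^bsub>Q8\<^esub> (True, u) \<otimes>\<^bsub>Q8\<^esub> (True, w)) = M u" for u
    by (cases u; cases w; simp add: M_def N_def inv_Q8)+
  have F: "(f \<otimes>\<^bsub>RG\<^esub> h) (False, w) = (\<Oplus>u\<in>UNIV. f (False, u) \<otimes> M u \<oplus> f (True, u) \<otimes> N u)"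
    using f h by (subst RG_mult) (auto simp: finsum_Q8 M_def N_def simp del: Q8_simps(3))
  have T: "(f \<otimes>\<^bsub>RG\<^esub> h) (True, w) = (\<Oplus>u\<in>UNIV. f (False, u) \<otimes> N u \<oplus> f (True, u) \<otimes> M u)"
    using f h by (subst RG_mult) (auto simp: finsum_Q8 M' N' simp del: Q8_simps(3))
  have "odd_part (f \<otimes>\<^bsub>RG\<^esub> h) w = (\<Oplus>u\<in>UNIV. (f (False, u) \<otimes> M u \<oplus> f (True, u) \<otimes> N u)
      \<ominus> (f (False, u) \<otimes> N u \<oplus> f (True, u) \<otimes> M u))"
    unfolding odd_part_def F T using f MN finite_quat_unit by (intro finsum_minus[symmetric]) auto
  also have "\<dots> = (\<Oplus>u\<in>UNIV. odd_part f u \<otimes> (M u \<ominus> N u))"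
    using f MN by (intro finsum_cong')
      (auto simp: odd_part_def minus_eq l_distr r_distr l_minus r_minus minus_add a_ac)
  finally show ?thesis by (simp add: M_def N_def)
qed

text \<open>These are the multiplication rules of quaternions.\<close>

lemma odd_part_mult:
  assumes f: "f \<in> carrier RG" and h: "h \<in> carrier RG"
  shows "odd_part (f \<otimes>\<^bsub>RG\<^esub> h) U1 = odd_part f U1 \<otimes> odd_part h U1 \<oplus> (\<ominus> (odd_part f UI \<otimes> odd_part h UI)
      \<oplus> (\<ominus> (odd_part f UJ \<otimes> odd_part h UJ) \<oplus> \<ominus> (odd_part f UK \<otimes> odd_part h UK)))"
    and "odd_part (f \<otimes>\<^bsub>RG\<^esub> h) UI = odd_part f U1 \<otimes> odd_part h UI \<oplus> (odd_part f UI \<otimes> odd_part h U1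
      \<oplus> (odd_part f UJ \<otimes> odd_part h UK \<oplus> \<ominus> (odd_part f UK \<otimes> odd_part h UJ)))"
    and "odd_part (f \<otimes>\<^bsub>RG\<^esub> h) UJ = odd_part f U1 \<otimes> odd_part h UJ \<oplus> (\<ominus> (odd_part f UI \<otimes> odd_part h UK)
      \<oplus> (odd_part f UJ \<otimes> odd_part h U1 \<oplus> odd_part f UK \<otimes> odd_part h UI))"
    and "odd_part (f \<otimes>\<^bsub>RG\<^esub> h) UK = odd_part f U1 \<otimes> odd_part h UK \<oplus> (odd_part f UI \<otimes> odd_part h UJ
      \<oplus> (\<ominus> (odd_part f UJ \<otimes> odd_part h UI) \<oplus> odd_part f UK \<otimes> odd_part h U1))"
  using f h
  by (simp_all add: odd_part_mult_sum finsum_quat_unit inv_Q8 odd_part_swap r_minus flip: odd_part_def)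

text \<open>
  For signs \<open>s\<close> and \<open>t\<close>, the map with \<open>i \<mapsto> s\<close>,
  \<open>j \<mapsto> t\<close> and \<open>k \<mapsto> s t\<close> is a character of
  \<open>Q8\<close>. It maps \<open>f\<close> to an element of \<open>K\<close> with square zero.
\<close>

lemma sign_character_sum_zero:
  assumes f: "f \<in> carrier RG" "f \<otimes>\<^bsub>RG\<^esub> f = \<zero>\<^bsub>RG\<^esub>"
    and s: "s \<in> carrier K" "s \<otimes> s = \<one>" and t: "t \<in> carrier K" "t \<otimes> t = \<one>"
  defines "e \<equiv> \<lambda>u. f (False, u) \<oplus> f (True, u)"
  shows "e U1 \<oplus> (e UI \<otimes> s \<oplus> (e UJ \<otimes> t \<oplus> e UK \<otimes> (s \<otimes> t))) = \<zero>"
proof -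
  define \<psi> where "\<psi> x = (case snd x of U1 \<Rightarrow> \<one> | UI \<Rightarrow> s | UJ \<Rightarrow> t | UK \<Rightarrow> s \<otimes> t)" for x :: "bool \<times> quat_unit"
  have \<psi>: "\<psi> x \<in> carrier K" for x using s t by (auto simp: \<psi>_def split: quat_unit.split)
  have ts: "t \<otimes> s = s \<otimes> t" using s t by (simp add: m_comm)
  have sst: "s \<otimes> (s \<otimes> t) = t"
    using t(1) by (simp only: m_assoc[OF s(1) s(1) t(1), symmetric] s(2) l_one)
  have stt: "s \<otimes> t \<otimes> t = s"
    using s(1) by (simp only: m_assoc[OF s(1) t(1) t(1)] t(2) r_one)
  have tst: "t \<otimes> (s \<otimes> t) = s"
    by (simp only: m_assoc[OF t(1) s(1) t(1), symmetric] ts stt)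
  have "s \<otimes> t \<otimes> s = t" "s \<otimes> t \<otimes> (s \<otimes> t) = \<one>"
    by (simp_all only: m_assoc[OF s(1) t(1) s(1)] m_assoc[OF s(1) t(1) m_closed[OF s(1) t(1)]] ts sst tst s(2))
  note st = this ts sst stt tst
  have \<psi>_mult: "\<psi> (x \<otimes>\<^bsub>Q8\<^esub> y) = \<psi> x \<otimes> \<psi> y" for x y
  proof -
    obtain a u b v where "x = (a, u)" "y = (b, v)" by (metis surj_pair)
    then show ?thesis using s t by (cases u; cases v) (auto simp: \<psi>_def st)
  qed
  let ?S = "\<lambda>h. \<Oplus>x\<in>carrier Q8. id (h x) \<otimes> \<psi> x"
  have "?S f \<otimes> ?S f = ?S (f \<otimes>\<^bsub>RG\<^esub> f)"
    by (rule evaluation_mult[OF cring_axioms id_ring_hom, symmetric]) (use f \<psi> \<psi>_mult in auto)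
  also have "\<dots> = (\<Oplus>x\<in>carrier Q8. \<zero>)"
    using \<psi> by (intro finsum_cong') (auto simp: f RG_zero)
  finally have "?S f \<otimes> ?S f = \<zero>" by simp
  moreover have "?S f \<in> carrier K" using f \<psi> by (intro finsum_closed) auto
  ultimately have "?S f = \<zero>" using integral by blast
  moreover have "?S f = (\<Oplus>u\<in>UNIV. f (False, u) \<otimes> \<psi> (False, u) \<oplus> f (True, u) \<otimes> \<psi> (True, u))"
    using f \<psi> by (simp add: finsum_Q8)
  also have "\<dots> = (\<Oplus>u\<in>UNIV. e u \<otimes> \<psi> (False, u))"
    using f \<psi> by (intro finsum_cong') (auto simp: e_def l_distr \<psi>_def)
  also have "\<dots> = e U1 \<oplus> (e UI \<otimes> s \<oplus> (e UJ \<otimes> t \<oplus> e UK \<otimes> (s \<otimes> t)))"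
    using f \<psi> by (subst finsum_quat_unit) (auto simp: e_def \<psi>_def)
  finally show ?thesis by simp
qed

end

locale odd_quaternion_group_ring = quaternion_group_ring +
  assumes two: "\<one> \<oplus> \<one> \<noteq> \<zero>"
begin

lemma double_eq_zero:
  assumes "x \<in> carrier K" "x \<oplus> x = \<zero>" shows "x = \<zero>"
proof -
  have "(\<one> \<oplus> \<one>) \<otimes> x = \<zero>" using assms by (simp add: l_distr)
  then show ?thesis using two assms integral by blast
qed

lemma sum_and_difference_zero:
  assumes "x \<in> carrier K" "y \<in> carrier K" "x \<oplus> y = \<zero>" "x \<oplus> \<ominus> y = \<zero>"
  shows "x = \<zero>" "y = \<zero>"
proof -
  have eq: "y = x" using assms(1,2,4) by (metis minus_eq r_right_minus_eq)
  show "x = \<zero>" using assms(3) unfolding eq by (rule double_eq_zero[OF assms(1)])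
  then show "y = \<zero>" by (simp add: eq)
qed

text \<open>The four sign characters determine the sums \<open>e u\<close>, since 2 is invertible.\<close>

lemma even_part_zero:
  assumes f: "f \<in> carrier RG" "f \<otimes>\<^bsub>RG\<^esub> f = \<zero>\<^bsub>RG\<^esub>"
  shows "f (False, u) \<oplus> f (True, u) = \<zero>"
proof -
  define e where "e u = f (False, u) \<oplus> f (True, u)" for u
  have e: "e u \<in> carrier K" for u using f by (simp add: e_def)
  have eq: "e U1 \<oplus> (e UI \<otimes> s \<oplus> (e UJ \<otimes> t \<oplus> e UK \<otimes> (s \<otimes> t))) = \<zero>"
    if "s \<in> {\<one>, \<ominus> \<one>}" "t \<in> {\<one>, \<ominus> \<one>}" for s t
    using sign_character_sum_zero[OF f, of s t] that unfolding e_def by (auto simp: l_minus r_minus)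
  have 1: "(e U1 \<oplus> e UI) \<oplus> (e UJ \<oplus> e UK) = \<zero>"
    using eq[of \<one> \<one>] e by (simp add: a_assoc)
  have 2: "(e U1 \<oplus> e UI) \<oplus> \<ominus> (e UJ \<oplus> e UK) = \<zero>"
    using eq[of \<one> "\<ominus> \<one>"] e by (simp add: a_assoc r_minus minus_add)
  have 3: "(e U1 \<oplus> \<ominus> e UI) \<oplus> (e UJ \<oplus> \<ominus> e UK) = \<zero>"
    using eq[of "\<ominus> \<one>" \<one>] e by (simp add: a_assoc r_minus)
  have 4: "(e U1 \<oplus> \<ominus> e UI) \<oplus> \<ominus> (e UJ \<oplus> \<ominus> e UK) = \<zero>"
    using eq[of "\<ominus> \<one>" "\<ominus> \<one>"] e by (simp add: a_assoc r_minus l_minus minus_add)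
  have 5: "e U1 \<oplus> e UI = \<zero>" "e UJ \<oplus> e UK = \<zero>"
    using sum_and_difference_zero[OF _ _ 1 2] e by auto
  have 6: "e U1 \<oplus> \<ominus> e UI = \<zero>" "e UJ \<oplus> \<ominus> e UK = \<zero>"
    using sum_and_difference_zero[OF _ _ 3 4] e by auto
  have "e U1 = \<zero>" "e UI = \<zero>" "e UJ = \<zero>" "e UK = \<zero>"
    using sum_and_difference_zero[OF _ _ 5(1) 6(1)] sum_and_difference_zero[OF _ _ 5(2) 6(2)] e by blast+
  then show ?thesis by (cases u) (auto simp: e_def)
qed

lemma eq_zero_of_parts:
  assumes f: "f \<in> carrier RG" and "\<And>u. f (False, u) \<oplus> f (True, u) = \<zero>" "\<And>u. odd_part f u = \<zero>"
  shows "f = \<zero>\<^bsub>RG\<^esub>"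
proof (rule RG_eqI)
  fix x assume "x \<in> carrier Q8"
  obtain b u where x: "x = (b, u)" by (cases x)
  have difference: "f (False, u) \<oplus> \<ominus> f (True, u) = \<zero>"
    using assms(3)[of u] by (simp add: odd_part_def minus_eq)
  have "f (False, u) = \<zero>" "f (True, u) = \<zero>"
    by (rule sum_and_difference_zero[OF _ _ assms(2) difference]; use f in simp)+
  then show "f x = \<zero>\<^bsub>RG\<^esub> x" by (cases b) (auto simp: x RG_zero)
qed (use f in auto)

context
  assumes no_solution: "\<And>x y z. x \<in> carrier K \<Longrightarrow> y \<in> carrier K \<Longrightarrow> z \<in> carrier K \<Longrightarrow>
    x \<otimes> x \<oplus> y \<otimes> y \<oplus> z \<otimes> z \<oplus> \<one> \<noteq> \<zero>"
begin

text \<open>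
  If \<open>a\<close> is not zero, division by \<open>a\<^sup>2\<close> gives the forbidden
  solution \<open>(b / a, c / a, 0)\<close>.
\<close>

lemma sum_three_squares_zero:
  assumes abc: "a \<in> carrier K" "b \<in> carrier K" "c \<in> carrier K" and zero: "a \<otimes> a \<oplus> b \<otimes> b \<oplus> c \<otimes> c = \<zero>"
  shows "a = \<zero>"
proof (rule ccontr)
  assume "a \<noteq> \<zero>"
  then have i: "inv a \<in> carrier K" "a \<otimes> inv a = \<one>" using abc by (auto simp: field_Units)
  have sq: "(b \<otimes> inv a) \<otimes> (b \<otimes> inv a) = b \<otimes> b \<otimes> (inv a \<otimes> inv a)" if "b \<in> carrier K" for b
    using that i by (simp add: m_ac)
  have "(a \<otimes> a \<oplus> b \<otimes> b \<oplus> c \<otimes> c) \<otimes> (inv a \<otimes> inv a) = (a \<otimes> inv a) \<otimes> (a \<otimes> inv a)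
      \<oplus> (b \<otimes> inv a) \<otimes> (b \<otimes> inv a) \<oplus> (c \<otimes> inv a) \<otimes> (c \<otimes> inv a)"
    using abc i(1) by (simp add: sq l_distr)
  then have "\<one> \<oplus> (b \<otimes> inv a) \<otimes> (b \<otimes> inv a) \<oplus> (c \<otimes> inv a) \<otimes> (c \<otimes> inv a) = \<zero>"
    using zero i by simp
  then have "(b \<otimes> inv a) \<otimes> (b \<otimes> inv a) \<oplus> (c \<otimes> inv a) \<otimes> (c \<otimes> inv a) \<oplus> \<zero> \<otimes> \<zero> \<oplus> \<one> = \<zero>"
    using abc i(1) by (simp add: a_ac)
  moreover have "b \<otimes> inv a \<in> carrier K" "c \<otimes> inv a \<in> carrier K" using abc i by auto
  ultimately show False using no_solution[OF _ _ zero_closed] by metis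
qed

text \<open>
  Let \<open>a + b i + c j + d k\<close> have square zero. The coordinates of the square at
  \<open>i, j, k\<close> are \<open>2 a b\<close>, \<open>2 a c\<close> and \<open>2 a d\<close>,
  so \<open>a\<close> or the rest vanishes; either way the first coordinate \<open>a\<^sup>2 -
  b\<^sup>2 - c\<^sup>2 - d\<^sup>2\<close> forces the quaternion to be zero.
\<close>

lemma odd_part_zero_of_square_zero:
  assumes f: "f \<in> carrier RG" "f \<otimes>\<^bsub>RG\<^esub> f = \<zero>\<^bsub>RG\<^esub>"
  shows "odd_part f u = \<zero>"
proof -
  define a b c d where "a = odd_part f U1" "b = odd_part f UI" "c = odd_part f UJ" "d = odd_part f UK"
  note abcd_def = this
  have abcd: "a \<in> carrier K" "b \<in> carrier K" "c \<in> carrier K" "d \<in> carrier K"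
    using f by (auto simp: abcd_def)
  have zero: "odd_part (f \<otimes>\<^bsub>RG\<^esub> f) u = \<zero>" for u by (simp add: f odd_part_def RG_zero minus_eq r_neg)
  have 1: "a \<otimes> a \<oplus> (\<ominus> (b \<otimes> b) \<oplus> (\<ominus> (c \<otimes> c) \<oplus> \<ominus> (d \<otimes> d))) = \<zero>"
    using odd_part_mult(1)[OF f(1) f(1)] by (simp add: zero abcd_def)
  have "a \<otimes> b \<oplus> (b \<otimes> a \<oplus> (c \<otimes> d \<oplus> \<ominus> (d \<otimes> c))) = \<zero>"
    using odd_part_mult(2)[OF f(1) f(1)] by (simp add: zero abcd_def)
  then have ab: "a \<otimes> b = \<zero>"
    using abcd double_eq_zero[of "a \<otimes> b"] by (simp add: m_comm r_neg)
  have "a \<otimes> c \<oplus> (\<ominus> (b \<otimes> d) \<oplus> (c \<otimes> a \<oplus> d \<otimes> b)) = \<zero>"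
    using odd_part_mult(3)[OF f(1) f(1)] by (simp add: zero abcd_def)
  then have ac: "a \<otimes> c = \<zero>"
    using abcd double_eq_zero[of "a \<otimes> c"] by (simp add: m_comm a_lcomm r_neg1 l_neg r_neg a_ac)
  have "a \<otimes> d \<oplus> (b \<otimes> c \<oplus> (\<ominus> (c \<otimes> b) \<oplus> d \<otimes> a)) = \<zero>"
    using odd_part_mult(4)[OF f(1) f(1)] by (simp add: zero abcd_def)
  then have ad: "a \<otimes> d = \<zero>"
    using abcd double_eq_zero[of "a \<otimes> d"] by (simp add: m_comm r_neg2)
  have "a = \<zero>"
  proof (rule ccontr)
    assume "a \<noteq> \<zero>"
    then have "b = \<zero>" "c = \<zero>" "d = \<zero>" using ab ac ad abcd integral by blast+
    then have "a \<otimes> a = \<zero>" using 1 abcd by simp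
    then show False using \<open>a \<noteq> \<zero>\<close> abcd integral by blast
  qed
  then have "\<ominus> (b \<otimes> b \<oplus> c \<otimes> c \<oplus> d \<otimes> d) = \<zero>" using 1 abcd by (simp add: minus_add a_assoc)
  then have 2: "b \<otimes> b \<oplus> c \<otimes> c \<oplus> d \<otimes> d = \<zero>" using abcd by (metis a_closed m_closed minus_minus minus_zero)
  have "b = \<zero>" "c = \<zero>" "d = \<zero>"
    using sum_three_squares_zero[of b c d] sum_three_squares_zero[of c b d] sum_three_squares_zero[of d b c] 2 abcd
    by (simp_all add: a_ac)
  then show ?thesis using \<open>a = \<zero>\<close> by (cases u) (auto simp: abcd_def)
qed

lemma reduced:
  assumes "f \<in> carrier RG" "f \<otimes>\<^bsub>RG\<^esub> f = \<zero>\<^bsub>RG\<^esub>"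
  shows "f = \<zero>\<^bsub>RG\<^esub>"
  using assms even_part_zero odd_part_zero_of_square_zero by (intro eq_zero_of_parts) auto

text \<open>
  Let the quaternion \<open>a + b i + c j + d k\<close> be idempotent. Comparing coordinates at
  \<open>i, j, k\<close> shows that it is a scalar or \<open>2 a = 1\<close>. In the second case
  four times the first coordinate reads \<open>1 = 2 + (2 b)\<^sup>2 + (2 c)\<^sup>2 + (2
  d)\<^sup>2\<close>, which is a forbidden solution.
\<close>

lemma idempotent_symmetric:
  assumes f: "f \<in> carrier RG" "f \<otimes>\<^bsub>RG\<^esub> f = f" and u: "u \<noteq> U1"
  shows "f (False, u) = f (True, u)"
proof -
  define a b c d where "a = odd_part f U1" "b = odd_part f UI" "c = odd_part f UJ" "d = odd_part f UK"
  note abcd_def = this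
  have abcd: "a \<in> carrier K" "b \<in> carrier K" "c \<in> carrier K" "d \<in> carrier K"
    using f by (auto simp: abcd_def)
  have 1: "a \<otimes> a \<oplus> (\<ominus> (b \<otimes> b) \<oplus> (\<ominus> (c \<otimes> c) \<oplus> \<ominus> (d \<otimes> d))) = a"
    using odd_part_mult(1)[OF f(1) f(1)] by (simp add: f(2) abcd_def)
  have "a \<otimes> b \<oplus> (b \<otimes> a \<oplus> (c \<otimes> d \<oplus> \<ominus> (d \<otimes> c))) = b"
    using odd_part_mult(2)[OF f(1) f(1)] by (simp add: f(2) abcd_def)
  then have ab: "(a \<oplus> a) \<otimes> b = b"
    using abcd by (simp add: m_comm r_neg r_distr)
  have "a \<otimes> c \<oplus> (\<ominus> (b \<otimes> d) \<oplus> (c \<otimes> a \<oplus> d \<otimes> b)) = c"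
    using odd_part_mult(3)[OF f(1) f(1)] by (simp add: f(2) abcd_def)
  then have ac: "(a \<oplus> a) \<otimes> c = c"
    using abcd by (simp add: m_comm a_lcomm r_neg1 l_neg r_neg a_ac r_distr)
  have "a \<otimes> d \<oplus> (b \<otimes> c \<oplus> (\<ominus> (c \<otimes> b) \<oplus> d \<otimes> a)) = d"
    using odd_part_mult(4)[OF f(1) f(1)] by (simp add: f(2) abcd_def)
  then have ad: "(a \<oplus> a) \<otimes> d = d"
    using abcd by (simp add: m_comm r_neg2 r_distr)
  have "a \<oplus> a \<noteq> \<one>"
  proof
    assume half: "a \<oplus> a = \<one>"
    have sq: "(x \<oplus> x) \<otimes> (x \<oplus> x) = (\<one> \<oplus> \<one>) \<otimes> (\<one> \<oplus> \<one>) \<otimes> (x \<otimes> x)" if "x \<in> carrier K" for x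
    proof -
      have "x \<oplus> x = (\<one> \<oplus> \<one>) \<otimes> x" using that by (simp add: l_distr)
      then show ?thesis using that by (simp add: m_ac)
    qed
    define s where "s = b \<otimes> b \<oplus> c \<otimes> c \<oplus> d \<otimes> d"
    have s: "s \<in> carrier K" using abcd by (simp add: s_def)
    have "a \<otimes> a \<oplus> \<ominus> s = a" using 1 abcd by (simp add: s_def minus_add a_assoc)
    then have "a \<otimes> a = a \<oplus> s" using abcd s by (metis a_assoc a_inv_closed l_neg m_closed r_zero)
    then have "\<one> \<otimes> \<one> = (\<one> \<oplus> \<one>) \<otimes> (\<one> \<oplus> \<one>) \<otimes> (a \<oplus> s)"
      using sq[of a] abcd half by simp
    also have "\<dots> = (\<one> \<oplus> \<one>) \<otimes> (a \<oplus> a) \<oplus> (\<one> \<oplus> \<one>) \<otimes> (\<one> \<oplus> \<one>) \<otimes> s"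
      using abcd s by (simp add: l_distr r_distr a_ac)
    also have "\<dots> = \<one> \<oplus> (\<one> \<oplus> (\<one> \<oplus> \<one>) \<otimes> (\<one> \<oplus> \<one>) \<otimes> s)"
      using s half by (simp add: a_assoc)
    finally have "\<one> \<oplus> (\<one> \<oplus> \<one>) \<otimes> (\<one> \<oplus> \<one>) \<otimes> s = \<zero>"
      using s by simp
    moreover have "(\<one> \<oplus> \<one>) \<otimes> (\<one> \<oplus> \<one>) \<otimes> s = (b \<oplus> b) \<otimes> (b \<oplus> b) \<oplus> (c \<oplus> c) \<otimes> (c \<oplus> c) \<oplus> (d \<oplus> d) \<otimes> (d \<oplus> d)"
    proof -
      have "k \<otimes> s = k \<otimes> (b \<otimes> b) \<oplus> k \<otimes> (c \<otimes> c) \<oplus> k \<otimes> (d \<otimes> d)" if "k \<in> carrier K" for k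
        using abcd that by (simp add: s_def r_distr)
      then show ?thesis using abcd by (simp only: sq) simp
    qed
    ultimately show False
      using no_solution[of "b \<oplus> b" "c \<oplus> c" "d \<oplus> d"] abcd by (simp add: a_comm)
  qed
  moreover have "x = \<zero>" if "x \<in> carrier K" "(a \<oplus> a) \<otimes> x = x" "a \<oplus> a \<noteq> \<one>" for x
    using that abcd by (metis a_closed l_one m_rcancel one_closed)
  ultimately have "b = \<zero>" "c = \<zero>" "d = \<zero>" using ab ac ad abcd by blast+
  then have "odd_part f u = \<zero>" using u by (cases u) (auto simp: abcd_def)
  then show ?thesis using f by (simp add: odd_part_def)
qed

end

text \<open>
  Here \<open>h\<close> is one half. The quaternion part of \<open>P\<close> is an idempotent
  scalar \<open>p\<close>, so that of \<open>U\<close> has scalar coordinate \<open>h - p\<close>,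
  which is \<open>h\<close> or \<open>- h\<close>, and norm \<open>h\<^sup>2 (1 + x\<^sup>2 +
  y\<^sup>2 + z\<^sup>2) = 0\<close>. So its conjugate, the quaternion part of \<open>C\<close>,
  annihilates it, although it is invertible.
\<close>

lemma not_unit_plus_projection:
  assumes xyz: "x \<in> carrier K" "y \<in> carrier K" "z \<in> carrier K"
    and zero: "x \<otimes> x \<oplus> y \<otimes> y \<oplus> z \<otimes> z \<oplus> \<one> = \<zero>"
    and h: "h \<in> carrier K" "h \<oplus> h = \<one>"
    and U: "U \<in> Units RG" and P: "P \<in> carrier RG" "P \<otimes>\<^bsub>RG\<^esub> P = P" "\<And>u. u \<noteq> U1 \<Longrightarrow> P (False, u) = P (True, u)"
    and sum: "odd_part (U \<oplus>\<^bsub>RG\<^esub> P) U1 = h" "odd_part (U \<oplus>\<^bsub>RG\<^esub> P) UI = h \<otimes> x"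
      "odd_part (U \<oplus>\<^bsub>RG\<^esub> P) UJ = h \<otimes> y" "odd_part (U \<oplus>\<^bsub>RG\<^esub> P) UK = h \<otimes> z"
  shows False
proof -
  interpret S: ring RG by (rule ring_RG)
  obtain V where V: "V \<in> carrier RG" "U \<otimes>\<^bsub>RG\<^esub> V = \<one>\<^bsub>RG\<^esub>" and Uc: "U \<in> carrier RG"
    using U by (auto simp: Units_def)
  have P0: "odd_part P u = \<zero>" if "u \<noteq> U1" for u
    using P(1,3) that by (simp add: odd_part_def minus_eq r_neg)
  have add: "odd_part (U \<oplus>\<^bsub>RG\<^esub> P) u = odd_part U u \<oplus> odd_part P u" for u
    using Uc P(1) by (simp add: odd_part_def RG_add minus_eq minus_add a_ac)
  define a p where "a = odd_part U U1" and "p = odd_part P U1"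
  have ap: "a \<in> carrier K" "p \<in> carrier K" using Uc P by (auto simp: a_def p_def)
  have U_part: "odd_part U UI = h \<otimes> x" "odd_part U UJ = h \<otimes> y" "odd_part U UK = h \<otimes> z" and a: "a \<oplus> p = h"
    using sum Uc by (auto simp: add P0 a_def p_def)
  have "p \<otimes> p = p"
    using odd_part_mult(1)[OF P(1,1)] ap by (simp add: P(2) P0 flip: p_def)
  then have "p \<otimes> (p \<oplus> \<ominus> \<one>) = \<zero>" using ap by (simp add: r_distr r_minus r_neg)
  then have "p = \<zero> \<or> p = \<one>" using ap by (metis a_inv_closed a_closed integral minus_eq one_closed r_right_minus_eq)
  then have "a = h \<or> a = \<ominus> h"
  proof
    assume "p = \<one>"
    then have "a \<oplus> (h \<oplus> h) = h" using a h by simp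
    then have "a \<oplus> h \<oplus> h = \<zero> \<oplus> h" using ap h by (simp add: a_assoc)
    then have "a \<oplus> h = \<zero>" using ap h by (simp only: a_closed add.r_cancel zero_closed)
    then show ?thesis using ap h minus_equality by (metis a_comm)
  qed (use a ap in auto)
  then have aa: "a \<otimes> a = h \<otimes> h" and a0: "a \<noteq> \<zero>"
  proof -
    have "h \<noteq> \<zero>" using h by auto
    moreover have "\<ominus> h \<noteq> \<zero>" using h \<open>h \<noteq> \<zero>\<close> by (metis minus_minus minus_zero)
    ultimately show "a \<noteq> \<zero>" using \<open>a = h \<or> a = \<ominus> h\<close> by metis
    show "a \<otimes> a = h \<otimes> h" using \<open>a = h \<or> a = \<ominus> h\<close> h by (auto simp: l_minus r_minus)
  qed
  define C where "C = (\<lambda>q\<in>carrier Q8. if fst q then \<zero> else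
    (case snd q of U1 \<Rightarrow> a | UI \<Rightarrow> \<ominus> (h \<otimes> x) | UJ \<Rightarrow> \<ominus> (h \<otimes> y) | UK \<Rightarrow> \<ominus> (h \<otimes> z)))"
  have C: "C \<in> carrier RG"
    unfolding C_def using ap h xyz by (intro RG_memI) (auto split: quat_unit.split)
  have C_part: "odd_part C U1 = a" "odd_part C UI = \<ominus> (h \<otimes> x)" "odd_part C UJ = \<ominus> (h \<otimes> y)" "odd_part C UK = \<ominus> (h \<otimes> z)"
    using ap h xyz by (simp_all add: odd_part_def C_def minus_eq)
  note part = C_part U_part a_def[symmetric]
  have "odd_part (C \<otimes>\<^bsub>RG\<^esub> U) U1 = h \<otimes> h \<otimes> (x \<otimes> x \<oplus> y \<otimes> y \<oplus> z \<otimes> z \<oplus> \<one>)"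
    using h xyz ap by (simp add: odd_part_mult[OF C Uc] part aa l_minus r_minus r_distr m_ac a_ac)
  then have "odd_part (C \<otimes>\<^bsub>RG\<^esub> U) U1 = \<zero>" using zero h by simp
  moreover have "odd_part (C \<otimes>\<^bsub>RG\<^esub> U) UI = \<zero>" "odd_part (C \<otimes>\<^bsub>RG\<^esub> U) UJ = \<zero>" "odd_part (C \<otimes>\<^bsub>RG\<^esub> U) UK = \<zero>"
    using h xyz ap
    by (simp_all add: odd_part_mult[OF C Uc] part l_minus r_minus m_ac a_ac r_neg r_neg1 r_neg2 l_neg)
  ultimately have "odd_part (C \<otimes>\<^bsub>RG\<^esub> U \<otimes>\<^bsub>RG\<^esub> V) U1 = \<zero>"
    using V C Uc by (simp add: odd_part_mult)
  moreover have "C \<otimes>\<^bsub>RG\<^esub> U \<otimes>\<^bsub>RG\<^esub> V = C" using C Uc V by (simp add: S.m_assoc)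
  ultimately show False using a0 C_part by simp
qed

end

section \<open>The group ring of the product of the quaternion group with an abelian group\<close>

lemma canonical_involution_Q8_times:
  assumes "comm_group A" "a \<in> carrier A"
  shows "canonical_involution (Q8 \<times>\<times> A) (q, a) = (inv\<^bsub>Q8\<^esub> q, a)"
proof -
  interpret A: comm_group A by fact
  obtain b u where "q = (b, u)" by (cases q)
  then show ?thesis
    using assms(2)
    by (cases u) (auto simp: canonical_involution_def group_center_Q8_times[OF assms(1)]
        SLC_commutator_Q8_times[OF assms(1)] inv_Q8)
qed

lemma canonical_involution_Q8_times_anti:
  assumes A: "comm_group A"
  defines "\<tau> \<equiv> canonical_involution (Q8 \<times>\<times> A)"
  assumes x: "x \<in> carrier (Q8 \<times>\<times> A)"
  shows "\<tau> x \<in> carrier (Q8 \<times>\<times> A)" "\<tau> (\<tau> x) = x"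
    and "y \<in> carrier (Q8 \<times>\<times> A) \<Longrightarrow> \<tau> (x \<otimes>\<^bsub>Q8 \<times>\<times> A\<^esub> y) = \<tau> y \<otimes>\<^bsub>Q8 \<times>\<times> A\<^esub> \<tau> x"
proof -
  interpret A: comm_group A by fact
  interpret Q: group Q8 by (rule group_Q8)
  obtain q a where qa: "x = (q, a)" "a \<in> carrier A" using x by auto
  note app = canonical_involution_Q8_times[OF A, folded \<tau>_def]
  show "\<tau> x \<in> carrier (Q8 \<times>\<times> A)" "\<tau> (\<tau> x) = x" using qa by (auto simp: app)
  assume "y \<in> carrier (Q8 \<times>\<times> A)"
  then obtain p b where "y = (p, b)" "b \<in> carrier A" by auto
  then show "\<tau> (x \<otimes>\<^bsub>Q8 \<times>\<times> A\<^esub> y) = \<tau> y \<otimes>\<^bsub>Q8 \<times>\<times> A\<^esub> \<tau> x"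
    using qa by (simp add: app Q.inv_mult_group A.m_comm del: Q8_simps(3))
qed

lemma finite_group_ring_Q8_times:
  assumes "cring F" "comm_group A" "finite (carrier A)"
  shows "finite_group_ring F (Q8 \<times>\<times> A)"
proof -
  interpret A: comm_group A by fact
  show ?thesis
    using assms by (intro finite_group_ring.intro finite_group_ring_axioms.intro DirProd_group group_Q8 A.group_axioms)
      (simp_all add: finite_quat_unit finite_Prod_UNIV)
qed

lemma ring_involution_Q8_times:
  assumes "cring F" "comm_group A" "finite (carrier A)"
  shows "ring_involution (group_ring F (Q8 \<times>\<times> A))
    (linear_extension F (Q8 \<times>\<times> A) (canonical_involution (Q8 \<times>\<times> A)))"
  by (rule finite_group_ring.ring_involution_linear_extension[OF finite_group_ring_Q8_times[OF assms]])
    (use canonical_involution_Q8_times_anti[OF assms(2)] in blast)+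

lemma linear_extension_Q8_times:
  assumes "cring F" "comm_group A" "finite (carrier A)" "f \<in> carrier (group_ring F (Q8 \<times>\<times> A))"
  shows "linear_extension F (Q8 \<times>\<times> A) (canonical_involution (Q8 \<times>\<times> A)) f
    = (\<lambda>x\<in>carrier (Q8 \<times>\<times> A). f (canonical_involution (Q8 \<times>\<times> A) x))"
  by (rule finite_group_ring.linear_extension_apply[OF finite_group_ring_Q8_times[OF assms(1-3)]])
    (use canonical_involution_Q8_times_anti[OF assms(2)] assms(4) in blast)+

lemma field_hom_eq_zero:
  assumes "field F" "field K" "\<iota> \<in> ring_hom F K" "x \<in> carrier F" "\<iota> x = \<zero>\<^bsub>K\<^esub>"
  shows "x = \<zero>\<^bsub>F\<^esub>"
proof (rule ccontr)
  interpret F: field F by fact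
  interpret K: field K by fact
  interpret \<iota>: ring_hom_cring F K \<iota> by unfold_locales (rule assms)
  assume "x \<noteq> \<zero>\<^bsub>F\<^esub>"
  then have inv: "inv\<^bsub>F\<^esub> x \<in> carrier F" "x \<otimes>\<^bsub>F\<^esub> inv\<^bsub>F\<^esub> x = \<one>\<^bsub>F\<^esub>"
    using assms(4) by (auto simp: F.field_Units)
  have "\<iota> x \<otimes>\<^bsub>K\<^esub> \<iota> (inv\<^bsub>F\<^esub> x) = \<iota> (x \<otimes>\<^bsub>F\<^esub> inv\<^bsub>F\<^esub> x)"
    using inv(1) assms(4) by simp
  then have "\<one>\<^bsub>K\<^esub> = \<zero>\<^bsub>K\<^esub>" using inv assms(5) by simp
  then show False by simp
qed

lemma multiple_of_one_nonzero:
  assumes "field F" "field K" "\<iota> \<in> ring_hom F K" "\<not> ring_characteristic F dvd N" "k dvd N"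
  shows "[k] \<cdot>\<^bsub>K\<^esub> \<one>\<^bsub>K\<^esub> \<noteq> \<zero>\<^bsub>K\<^esub>"
proof
  interpret F: field F by fact
  interpret K: field K by fact
  interpret \<iota>: ring_hom_cring F K \<iota> by unfold_locales (rule assms)
  have hom: "\<iota> ([j] \<cdot>\<^bsub>F\<^esub> \<one>\<^bsub>F\<^esub>) = [j] \<cdot>\<^bsub>K\<^esub> \<one>\<^bsub>K\<^esub>" for j :: nat
    by (induction j) auto
  assume "[k] \<cdot>\<^bsub>K\<^esub> \<one>\<^bsub>K\<^esub> = \<zero>\<^bsub>K\<^esub>"
  then have "\<iota> ([k] \<cdot>\<^bsub>F\<^esub> \<one>\<^bsub>F\<^esub>) = \<zero>\<^bsub>K\<^esub>" by (simp add: hom)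
  then have "[k] \<cdot>\<^bsub>F\<^esub> \<one>\<^bsub>F\<^esub> = \<zero>\<^bsub>F\<^esub>"
    by (rule field_hom_eq_zero[OF assms(1-3), rotated]) simp
  then have "ring_characteristic F dvd k"
    unfolding ring_characteristic_def using F.add.pow_eq_id[of "\<one>\<^bsub>F\<^esub>" k] by (simp add: add_pow_def)
  then show False using assms(4,5) dvd_trans by blast
qed


lemma character_twist_of_additive:
  assumes "field F" "field K" "comm_group A" "finite (carrier A)" "\<iota> \<in> ring_hom F K"
    and root: "primitive_root_of_one K d \<zeta>" and l: "additive_mod A m (carrier A) l" and "d dvd m"
  shows "character_twist F K Q8 A \<iota> (\<lambda>a. \<zeta> [^]\<^bsub>K\<^esub> l a)"
proof -
  interpret F: field F by fact
  interpret K: field K by fact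
  interpret A: comm_group A by fact
  have \<zeta>: "\<zeta> \<in> carrier K" using root by (simp add: primitive_root_of_one_def)
  note cong = cong_dvd_modulus_nat[OF _ \<open>d dvd m\<close>]
  show ?thesis
  proof (intro character_twist.intro character_twist_axioms.intro F.cring_axioms K.cring_axioms
      group_Q8 A.comm_group_axioms assms)
    show "finite (carrier Q8)" by (simp add: finite_quat_unit finite_Prod_UNIV)
    fix a b assume ab: "a \<in> carrier A" "b \<in> carrier A"
    have "[l (a \<otimes>\<^bsub>A\<^esub> b) = l a + l b] (mod d)"
      using l ab by (intro cong) (auto simp: additive_mod_def)
    then have "\<zeta> [^]\<^bsub>K\<^esub> l (a \<otimes>\<^bsub>A\<^esub> b) = \<zeta> [^]\<^bsub>K\<^esub> (l a + l b)"
      by (simp add: K.primitive_root_power_eq_iff[OF root])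
    then show "\<zeta> [^]\<^bsub>K\<^esub> l (a \<otimes>\<^bsub>A\<^esub> b) = \<zeta> [^]\<^bsub>K\<^esub> l a \<otimes>\<^bsub>K\<^esub> \<zeta> [^]\<^bsub>K\<^esub> l b"
      using \<zeta> by (simp add: K.nat_pow_mult)
  next
    have "[l \<one>\<^bsub>A\<^esub> = 0] (mod d)"
      using additive_mod_one[OF l _ A.monoid_axioms] by (intro cong) auto
    then show "\<zeta> [^]\<^bsub>K\<^esub> l \<one>\<^bsub>A\<^esub> = \<one>\<^bsub>K\<^esub>"
      using K.primitive_root_power_eq_iff[OF root, of "l \<one>\<^bsub>A\<^esub>" 0] by simp
  qed (use \<zeta> in auto)
qed

text \<open>
  Nilpotency and idempotency are inspected after twisting by all characters \<open>l\<close>,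
  which separate the coefficient functions on \<open>A\<close>.
\<close>

lemma star_clean_Q8_times:
  assumes F: "field F" and A: "comm_group A" "finite (carrier A)"
    and K: "field K" and \<iota>: "\<iota> \<in> ring_hom F K" and root: "primitive_root_of_one K m \<zeta>"
    and exponent: "\<And>a. a \<in> carrier A \<Longrightarrow> a [^]\<^bsub>A\<^esub> m = \<one>\<^bsub>A\<^esub>"
    and two: "\<one>\<^bsub>K\<^esub> \<oplus>\<^bsub>K\<^esub> \<one>\<^bsub>K\<^esub> \<noteq> \<zero>\<^bsub>K\<^esub>" and m: "[m] \<cdot>\<^bsub>K\<^esub> \<one>\<^bsub>K\<^esub> \<noteq> \<zero>\<^bsub>K\<^esub>"
    and no_solution: "\<And>x y z. x \<in> carrier K \<Longrightarrow> y \<in> carrier K \<Longrightarrow> z \<in> carrier K \<Longrightarrow>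
      x \<otimes>\<^bsub>K\<^esub> x \<oplus>\<^bsub>K\<^esub> y \<otimes>\<^bsub>K\<^esub> y \<oplus>\<^bsub>K\<^esub> z \<otimes>\<^bsub>K\<^esub> z \<oplus>\<^bsub>K\<^esub> \<one>\<^bsub>K\<^esub> \<noteq> \<zero>\<^bsub>K\<^esub>"
  shows "star_clean (group_ring F (Q8 \<times>\<times> A))
    (linear_extension F (Q8 \<times>\<times> A) (canonical_involution (Q8 \<times>\<times> A)))"
proof -
  interpret F: field F by fact
  interpret A: comm_group A by fact
  interpret FG: finite_group_ring F "Q8 \<times>\<times> A"
    by (rule finite_group_ring_Q8_times[OF F.cring_axioms A])
  interpret S: ring FG.RG by (rule FG.ring_RG)
  interpret K: odd_quaternion_group_ring K
    by (intro odd_quaternion_group_ring.intro quaternion_group_ring.intro odd_quaternion_group_ring_axioms.intro K two)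
  interpret AC: abelian_characters K A m \<zeta>
    by (intro abelian_characters.intro abelian_characters_axioms.intro K A root exponent m)
  note twist = character_twist_of_additive[OF F K A \<iota> root _ dvd_refl]
  have \<zeta>: "\<zeta> \<in> carrier K" by (rule AC.zeta)
  have \<iota>_closed: "\<iota> x \<in> carrier K" if "x \<in> carrier F" for x using that \<iota> ring_hom_closed by metis
  have zero_if: "x = \<zero>\<^bsub>F\<^esub>" if "x \<in> carrier F" "\<iota> x = \<zero>\<^bsub>K\<^esub>" for x
    using field_hom_eq_zero[OF F K \<iota> that] .
  show ?thesis
  proof (rule S.star_clean_of_reduced)
    show "ring_involution FG.RG (linear_extension F (Q8 \<times>\<times> A) (canonical_involution (Q8 \<times>\<times> A)))"
      by (rule ring_involution_Q8_times[OF F.cring_axioms A])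
    show "\<exists>m. \<exists>q\<in>carrier FG.RG. q \<otimes>\<^bsub>FG.RG\<^esub> x = x \<otimes>\<^bsub>FG.RG\<^esub> q \<and> x [^]\<^bsub>FG.RG\<^esub> m = x [^]\<^bsub>FG.RG\<^esub> Suc m \<otimes>\<^bsub>FG.RG\<^esub> q"
      if "x \<in> carrier FG.RG" for x
      by (rule FG.strongly_pi_regular[OF F that])
  next
    fix f assume f: "f \<in> carrier FG.RG" and ff: "f \<otimes>\<^bsub>FG.RG\<^esub> f = \<zero>\<^bsub>FG.RG\<^esub>"
    have "\<iota> (f (q, a)) = \<zero>\<^bsub>K\<^esub>" if a: "a \<in> carrier A" for q a
    proof (rule AC.characters_separate[OF _ _ a, where f = "\<lambda>a. \<iota> (f (q, a))"])
      fix l assume l: "additive_mod A m (carrier A) l"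
      interpret T: character_twist F K Q8 A \<iota> "\<lambda>a. \<zeta> [^]\<^bsub>K\<^esub> l a" by (rule twist[OF l])
      have "T.twist \<zero>\<^bsub>FG.RG\<^esub> = \<zero>\<^bsub>K.RG\<^esub>"
        using ring_hom_zero[OF T.twist_ring_hom FG.ring_RG K.ring_RG] .
      then have "T.twist f \<otimes>\<^bsub>K.RG\<^esub> T.twist f = \<zero>\<^bsub>K.RG\<^esub>"
        using T.twist_mult[OF f f] ff by simp
      then have "T.twist f = \<zero>\<^bsub>K.RG\<^esub>"
        by (rule K.reduced[OF no_solution T.twist_closed[OF f], rotated 3])
      then have "T.twist f q = \<zero>\<^bsub>K\<^esub>" by (simp add: K.RG_zero)
      then show "(\<Oplus>\<^bsub>K\<^esub>a\<in>carrier A. \<iota> (f (q, a)) \<otimes>\<^bsub>K\<^esub> \<zeta> [^]\<^bsub>K\<^esub> l a) = \<zero>\<^bsub>K\<^esub>"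
        by (simp add: T.twist_def)
    qed (use f \<iota>_closed in auto)
    then show "f = \<zero>\<^bsub>FG.RG\<^esub>"
      using f zero_if by (intro FG.RG_eqI) (auto simp: FG.RG_zero)
  next
    fix e assume e: "e \<in> carrier FG.RG" and ee: "e \<otimes>\<^bsub>FG.RG\<^esub> e = e"
    have odd_eq: "e ((False, u), a) = e ((True, u), a)" if u: "u \<noteq> U1" and a: "a \<in> carrier A" for u a
    proof -
      have eF: "e (q, a) \<in> carrier F" if "a \<in> carrier A" for q a using e that by auto
      have "\<iota> (e ((False, u), a) \<ominus>\<^bsub>F\<^esub> e ((True, u), a)) = \<zero>\<^bsub>K\<^esub>"
      proof (rule AC.characters_separate[OF _ _ a, where f = "\<lambda>a. \<iota> (e ((False, u), a) \<ominus>\<^bsub>F\<^esub> e ((True, u), a))"])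
        fix l assume l: "additive_mod A m (carrier A) l"
        interpret T: character_twist F K Q8 A \<iota> "\<lambda>a. \<zeta> [^]\<^bsub>K\<^esub> l a" by (rule twist[OF l])
        have "T.twist e (False, u) = T.twist e (True, u)"
          using T.twist_mult[OF e e] ee
          by (intro K.idempotent_symmetric no_solution T.twist_closed e u) auto
        moreover have "(\<Oplus>\<^bsub>K\<^esub>a\<in>carrier A. \<iota> (e ((False, u), a) \<ominus>\<^bsub>F\<^esub> e ((True, u), a)) \<otimes>\<^bsub>K\<^esub> \<zeta> [^]\<^bsub>K\<^esub> l a)
            = (\<Oplus>\<^bsub>K\<^esub>a\<in>carrier A. \<iota> (e ((False, u), a)) \<otimes>\<^bsub>K\<^esub> \<zeta> [^]\<^bsub>K\<^esub> l a \<ominus>\<^bsub>K\<^esub> \<iota> (e ((True, u), a)) \<otimes>\<^bsub>K\<^esub> \<zeta> [^]\<^bsub>K\<^esub> l a)"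
          using eF \<zeta> by (intro K.finsum_cong') (auto simp: F.minus_eq K.minus_eq K.l_distr K.l_minus \<iota>_closed)
        moreover have "\<dots> = T.twist e (False, u) \<ominus>\<^bsub>K\<^esub> T.twist e (True, u)"
          using eF \<zeta> A(2) by (subst K.finsum_minus) (auto simp: T.twist_def \<iota>_closed)
        ultimately show "(\<Oplus>\<^bsub>K\<^esub>a\<in>carrier A. \<iota> (e ((False, u), a) \<ominus>\<^bsub>F\<^esub> e ((True, u), a)) \<otimes>\<^bsub>K\<^esub> \<zeta> [^]\<^bsub>K\<^esub> l a) = \<zero>\<^bsub>K\<^esub>"
          using K.RG_closed[OF T.twist_closed[OF e], of "(True, u)"] by (simp add: K.minus_eq K.r_neg)
      qed (use eF \<iota>_closed in auto)
      then have "e ((False, u), a) \<ominus>\<^bsub>F\<^esub> e ((True, u), a) = \<zero>\<^bsub>F\<^esub>"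
        using eF a by (intro zero_if) auto
      then show ?thesis using eF a by simp
    qed
    have "e (canonical_involution (Q8 \<times>\<times> A) x) = e x" if x: "x \<in> carrier (Q8 \<times>\<times> A)" for x
    proof -
      obtain b u a where eq: "x = ((b, u), a)" "a \<in> carrier A" using x by auto
      show ?thesis
        using odd_eq[of u a] eq(2) unfolding eq(1) canonical_involution_Q8_times[OF A(1) eq(2)] inv_Q8
        by (cases "u = U1"; cases b) auto
    qed
    then have "linear_extension F (Q8 \<times>\<times> A) (canonical_involution (Q8 \<times>\<times> A)) e
        = restrict e (carrier (Q8 \<times>\<times> A))"
      unfolding linear_extension_Q8_times[OF F.cring_axioms A e] by (rule restrict_ext)
    also have "\<dots> = e"
      using e FG.RG_memI[of e] by (intro FG.RG_eqI) auto
    finally show "linear_extension F (Q8 \<times>\<times> A) (canonical_involution (Q8 \<times>\<times> A)) e = e" .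
  qed
qed


text \<open>
  The image is a subring of \<open>K\<close> that contains the generators. It is a subfield: if
  \<open>k = \<phi> f\<close> is not zero, then applying \<open>\<phi>\<close> to a relation
  \<open>f\<^sup>m = f\<^sup>m f q\<close> and cancelling \<open>k\<^sup>m\<close> shows that
  \<open>\<phi> q\<close> is the inverse of \<open>k\<close>.
\<close>

lemma evaluation_onto_cyclotomic_extension:
  assumes F: "field F" and A: "comm_group A" "finite (carrier A)"
    and K: "field K" and \<iota>: "\<iota> \<in> ring_hom F K"
    and gen: "carrier K = generate_field K (insert \<zeta> (\<iota> ` carrier F))"
    and \<chi>: "\<And>a. a \<in> carrier A \<Longrightarrow> \<chi> a \<in> carrier K"
      "\<And>a b. a \<in> carrier A \<Longrightarrow> b \<in> carrier A \<Longrightarrow> \<chi> (a \<otimes>\<^bsub>A\<^esub> b) = \<chi> a \<otimes>\<^bsub>K\<^esub> \<chi> b"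
      "\<chi> \<one>\<^bsub>A\<^esub> = \<one>\<^bsub>K\<^esub>"
    and g: "g \<in> carrier A" "\<chi> g = \<zeta>" and y: "y \<in> carrier K"
  shows "\<exists>f\<in>carrier (group_ring F A). (\<Oplus>\<^bsub>K\<^esub>a\<in>carrier A. \<iota> (f a) \<otimes>\<^bsub>K\<^esub> \<chi> a) = y"
proof -
  interpret F: field F by fact
  interpret A: comm_group A by fact
  interpret K: field K by fact
  interpret FA: finite_group_ring F A
    by (intro finite_group_ring.intro finite_group_ring_axioms.intro F.cring_axioms A.group_axioms A)
  interpret S: ring FA.RG by (rule FA.ring_RG)
  interpret \<iota>: ring_hom_cring F K \<iota> by unfold_locales (rule \<iota>)
  define \<phi> where "\<phi> f = (\<Oplus>\<^bsub>K\<^esub>a\<in>carrier A. \<iota> (f a) \<otimes>\<^bsub>K\<^esub> \<chi> a)" for f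
  have \<phi>: "\<phi> \<in> ring_hom FA.RG K"
    unfolding \<phi>_def by (rule FA.evaluation_ring_hom[OF K.cring_axioms \<iota>]) (use \<chi> in auto)
  interpret \<phi>: ring_hom_ring FA.RG K \<phi>
    by (intro ring_hom_ringI2 \<phi> S.ring_axioms K.ring_axioms)
  have "subfield (\<phi> ` carrier FA.RG) K"
  proof (rule K.subfieldI')
    show "subring (\<phi> ` carrier FA.RG) K"
      by (rule \<phi>.img_is_subring[OF S.carrier_is_subring])
    fix k assume k: "k \<in> \<phi> ` carrier FA.RG - {\<zero>\<^bsub>K\<^esub>}"
    then obtain f where f: "f \<in> carrier FA.RG" "k = \<phi> f" by blast
    obtain m q where q: "q \<in> carrier FA.RG" and pow: "f [^]\<^bsub>FA.RG\<^esub> m = f [^]\<^bsub>FA.RG\<^esub> Suc m \<otimes>\<^bsub>FA.RG\<^esub> q"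
      using FA.strongly_pi_regular[OF F f(1)] by blast
    have hom_pow: "\<phi> (f [^]\<^bsub>FA.RG\<^esub> j) = k [^]\<^bsub>K\<^esub> j" for j :: nat
      using f by (induction j) auto
    have kc: "k \<in> carrier K" "k \<noteq> \<zero>\<^bsub>K\<^esub>" using k f by auto
    have "\<phi> (f [^]\<^bsub>FA.RG\<^esub> m) = \<phi> (f [^]\<^bsub>FA.RG\<^esub> Suc m \<otimes>\<^bsub>FA.RG\<^esub> q)"
      by (rule arg_cong[OF pow])
    also have "\<dots> = \<phi> (f [^]\<^bsub>FA.RG\<^esub> Suc m) \<otimes>\<^bsub>K\<^esub> \<phi> q"
      using f q by (intro \<phi>.hom_mult) auto
    finally have "k [^]\<^bsub>K\<^esub> m \<otimes>\<^bsub>K\<^esub> \<one>\<^bsub>K\<^esub> = k [^]\<^bsub>K\<^esub> m \<otimes>\<^bsub>K\<^esub> (k \<otimes>\<^bsub>K\<^esub> \<phi> q)"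
      unfolding hom_pow using kc q by (simp add: K.m_assoc)
    moreover have "k [^]\<^bsub>K\<^esub> m \<noteq> \<zero>\<^bsub>K\<^esub>"
      using kc by (induction m) (auto dest: K.integral)
    ultimately have "k \<otimes>\<^bsub>K\<^esub> \<phi> q = \<one>\<^bsub>K\<^esub>"
      using kc q K.m_lcancel[of "k [^]\<^bsub>K\<^esub> m" "\<one>\<^bsub>K\<^esub>" "k \<otimes>\<^bsub>K\<^esub> \<phi> q"] by auto
    then have "inv\<^bsub>K\<^esub> k = \<phi> q" using kc q by (intro K.comm_inv_char) auto
    then show "inv\<^bsub>K\<^esub> k \<in> \<phi> ` carrier FA.RG" using q by auto
  qed
  moreover have "\<phi> (\<lambda>x\<in>carrier A. if x = h then c else \<zero>\<^bsub>F\<^esub>) = \<iota> c \<otimes>\<^bsub>K\<^esub> \<chi> h"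
    "(\<lambda>x\<in>carrier A. if x = h then c else \<zero>\<^bsub>F\<^esub>) \<in> carrier FA.RG"
    if hc: "h \<in> carrier A" "c \<in> carrier F" for h c
  proof -
    have "\<phi> (\<lambda>x\<in>carrier A. if x = h then c else \<zero>\<^bsub>F\<^esub>)
        = (\<Oplus>\<^bsub>K\<^esub>x\<in>carrier A. if h = x then \<iota> c \<otimes>\<^bsub>K\<^esub> \<chi> x else \<zero>\<^bsub>K\<^esub>)"
      unfolding \<phi>_def using hc \<chi> by (intro K.finsum_cong') auto
    also have "\<dots> = \<iota> c \<otimes>\<^bsub>K\<^esub> \<chi> h"
      using hc \<chi> A(2) by (intro K.finsum_singleton) auto
    finally show "\<phi> (\<lambda>x\<in>carrier A. if x = h then c else \<zero>\<^bsub>F\<^esub>) = \<iota> c \<otimes>\<^bsub>K\<^esub> \<chi> h" .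
    show "(\<lambda>x\<in>carrier A. if x = h then c else \<zero>\<^bsub>F\<^esub>) \<in> carrier FA.RG"
      using hc by (intro FA.RG_memI) auto
  qed
  note single = this
  have "\<zeta> \<in> \<phi> ` carrier FA.RG"
    using single[OF g(1) F.one_closed] g \<chi>(1)[OF g(1)] by (intro image_eqI) auto
  moreover have "\<iota> c \<in> \<phi> ` carrier FA.RG" if "c \<in> carrier F" for c
    using single[OF A.one_closed that] that by (intro image_eqI) (auto simp: \<chi>(3))
  moreover have "\<zeta> \<in> carrier K" using g \<chi>(1) by blast
  ultimately have "generate_field K (insert \<zeta> (\<iota> ` carrier F)) \<subseteq> \<phi> ` carrier FA.RG"
    by (intro K.generate_field_min_subfield1) auto
  then show ?thesis using y gen by (auto simp: \<phi>_def)
qed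

text \<open>
  The exponents \<open>l\<close> are additive modulo \<open>m\<close>, hence modulo
  \<open>d\<close>, and \<open>l g = 1\<close> makes the resulting character hit
  \<open>\<zeta>\<close>. So \<open>twist\<close> is onto, and an element \<open>\<alpha>\<close>
  with the quaternion part excluded by \<open>not_unit_plus_projection\<close> exists.
\<close>

lemma not_star_clean_Q8_times:
  assumes F: "field F" and A: "comm_group A" "finite (carrier A)"
    and K: "field K" and \<iota>: "\<iota> \<in> ring_hom F K" and root: "primitive_root_of_one K d \<zeta>"
    and gen: "carrier K = generate_field K (insert \<zeta> (\<iota> ` carrier F))"
    and l: "additive_mod A m (carrier A) l" and dm: "d dvd m" and g: "g \<in> carrier A" "[l g = 1] (mod m)"
    and two: "\<one>\<^bsub>K\<^esub> \<oplus>\<^bsub>K\<^esub> \<one>\<^bsub>K\<^esub> \<noteq> \<zero>\<^bsub>K\<^esub>"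
    and xyz: "x \<in> carrier K" "y \<in> carrier K" "z \<in> carrier K"
      "x \<otimes>\<^bsub>K\<^esub> x \<oplus>\<^bsub>K\<^esub> y \<otimes>\<^bsub>K\<^esub> y \<oplus>\<^bsub>K\<^esub> z \<otimes>\<^bsub>K\<^esub> z \<oplus>\<^bsub>K\<^esub> \<one>\<^bsub>K\<^esub> = \<zero>\<^bsub>K\<^esub>"
  shows "\<not> star_clean (group_ring F (Q8 \<times>\<times> A))
    (linear_extension F (Q8 \<times>\<times> A) (canonical_involution (Q8 \<times>\<times> A)))"
proof
  assume clean: "star_clean (group_ring F (Q8 \<times>\<times> A))
    (linear_extension F (Q8 \<times>\<times> A) (canonical_involution (Q8 \<times>\<times> A)))"
  interpret F: field F by fact
  interpret A: comm_group A by fact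
  interpret K: odd_quaternion_group_ring K
    by (intro odd_quaternion_group_ring.intro quaternion_group_ring.intro odd_quaternion_group_ring_axioms.intro K two)
  define \<chi> where "\<chi> a = \<zeta> [^]\<^bsub>K\<^esub> l a" for a
  interpret T: character_twist F K Q8 A \<iota> \<chi>
    unfolding \<chi>_def by (rule character_twist_of_additive[OF F K A \<iota> root l dm])
  interpret FA: finite_group_ring F A
    by (intro finite_group_ring.intro finite_group_ring_axioms.intro F.cring_axioms A.group_axioms A)
  have \<zeta>: "\<zeta> \<in> carrier K" using root by (simp add: primitive_root_of_one_def)
  have "\<chi> g = \<zeta> [^]\<^bsub>K\<^esub> (1::nat)"
    unfolding \<chi>_def K.primitive_root_power_eq_iff[OF root] by (rule cong_dvd_modulus_nat[OF g(2) dm])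
  then have "\<chi> g = \<zeta>" using \<zeta> by simp
  note onto = evaluation_onto_cyclotomic_extension[OF F A K \<iota> gen T.\<chi>_closed T.\<chi>_mult T.\<chi>_one g(1) this]
  define h where "h = inv\<^bsub>K\<^esub> (\<one>\<^bsub>K\<^esub> \<oplus>\<^bsub>K\<^esub> \<one>\<^bsub>K\<^esub>)"
  have h: "h \<in> carrier K" "(\<one>\<^bsub>K\<^esub> \<oplus>\<^bsub>K\<^esub> \<one>\<^bsub>K\<^esub>) \<otimes>\<^bsub>K\<^esub> h = \<one>\<^bsub>K\<^esub>"
    using two by (auto simp: h_def K.field_Units)
  then have hh: "h \<oplus>\<^bsub>K\<^esub> h = \<one>\<^bsub>K\<^esub>" by (simp add: K.l_distr)
  define c where "c u = (case u of U1 \<Rightarrow> h | UI \<Rightarrow> h \<otimes>\<^bsub>K\<^esub> x | UJ \<Rightarrow> h \<otimes>\<^bsub>K\<^esub> y | UK \<Rightarrow> h \<otimes>\<^bsub>K\<^esub> z)" for u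
  have "c u \<in> carrier K" for u using h xyz by (auto simp: c_def split: quat_unit.split)
  then have "\<exists>f\<in>carrier FA.RG. (\<Oplus>\<^bsub>K\<^esub>a\<in>carrier A. \<iota> (f a) \<otimes>\<^bsub>K\<^esub> \<chi> a) = c u" for u
    by (intro onto)
  then obtain f where f: "\<And>u. f u \<in> carrier FA.RG" "\<And>u. (\<Oplus>\<^bsub>K\<^esub>a\<in>carrier A. \<iota> (f u a) \<otimes>\<^bsub>K\<^esub> \<chi> a) = c u"
    by metis
  define \<alpha> where "\<alpha> = (\<lambda>x\<in>carrier (Q8 \<times>\<times> A). case x of ((b, u), a) \<Rightarrow> if b then \<zero>\<^bsub>F\<^esub> else f u a)"
  have \<alpha>: "\<alpha> \<in> carrier T.FG.RG"
    unfolding \<alpha>_def using f(1) by (intro T.FG.RG_memI) (auto intro: FA.RG_closed)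
  have twist_\<alpha>: "T.twist \<alpha> (False, u) = c u" "T.twist \<alpha> (True, u) = \<zero>\<^bsub>K\<^esub>" for u
  proof -
    have "T.twist \<alpha> (False, u) = (\<Oplus>\<^bsub>K\<^esub>a\<in>carrier A. \<iota> (f u a) \<otimes>\<^bsub>K\<^esub> \<chi> a)"
      unfolding T.twist_def using f(1) by (auto simp: \<alpha>_def intro!: K.finsum_cong')
    then show "T.twist \<alpha> (False, u) = c u" by (simp add: f)
    have "(\<Oplus>\<^bsub>K\<^esub>a\<in>carrier A. \<iota> (\<alpha> ((True, u), a)) \<otimes>\<^bsub>K\<^esub> \<chi> a) = \<zero>\<^bsub>K\<^esub>"
      by (rule K.add.finprod_one_eqI) (simp add: \<alpha>_def)
    then show "T.twist \<alpha> (True, u) = \<zero>\<^bsub>K\<^esub>" by (simp add: T.twist_def)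
  qed
  obtain U P where U: "U \<in> Units T.FG.RG" and sum: "\<alpha> = U \<oplus>\<^bsub>T.FG.RG\<^esub> P"
    and P: "P \<in> carrier T.FG.RG" "P \<otimes>\<^bsub>T.FG.RG\<^esub> P = P"
      "linear_extension F (Q8 \<times>\<times> A) (canonical_involution (Q8 \<times>\<times> A)) P = P"
    using clean \<alpha> by (auto simp: star_clean_def projections_def)
  have Uc: "U \<in> carrier T.FG.RG" using U by (auto simp: Units_def)
  have P_eq: "P (canonical_involution (Q8 \<times>\<times> A) x) = P x" if "x \<in> carrier (Q8 \<times>\<times> A)" for x
    using fun_cong[OF P(3), of x] that unfolding linear_extension_Q8_times[OF F.cring_axioms A P(1)]
    by (simp only: restrict_apply')
  have P_sym: "P ((False, u), a) = P ((True, u), a)" if "u \<noteq> U1" "a \<in> carrier A" for u a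
    using P_eq[of "((True, u), a)"] that by (simp add: canonical_involution_Q8_times[OF A(1)] inv_Q8)
  have twist_sum: "T.twist \<alpha> = T.twist U \<oplus>\<^bsub>K.RG\<^esub> T.twist P"
    unfolding sum using ring_hom_add[OF T.twist_ring_hom Uc P(1)] .
  have odd: "K.odd_part (T.twist U \<oplus>\<^bsub>K.RG\<^esub> T.twist P) u = c u" for u
    using h xyz unfolding twist_sum[symmetric] K.odd_part_def twist_\<alpha>
    by (auto simp: K.minus_eq c_def split: quat_unit.split)
  show False
  proof (rule K.not_unit_plus_projection[OF xyz h(1) hh])
    show "T.twist U \<in> Units K.RG" by (rule ring_hom_Units[OF T.twist_ring_hom U])
    show "T.twist P \<in> carrier K.RG" by (rule T.twist_closed[OF P(1)])
    show "T.twist P \<otimes>\<^bsub>K.RG\<^esub> T.twist P = T.twist P" using T.twist_mult[OF P(1,1)] P(2) by simp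
    show "T.twist P (False, u) = T.twist P (True, u)" if "u \<noteq> U1" for u
      using that P_sym P(1) unfolding T.twist_def by (auto intro!: K.finsum_cong')
  qed (simp_all add: odd c_def)
qed


section \<open>Finite products of rings\<close>

lemma nth_RDirProd_list_hom:
  assumes "\<And>i. i < length Rs \<Longrightarrow> ring (Rs ! i)" "i < length Rs"
  shows "(\<lambda>as. as ! i) \<in> ring_hom (RDirProd_list Rs) (Rs ! i)"
  using assms
proof (induction Rs arbitrary: i)
  case (Cons R Rs)
  let ?S = "RDirProd R (RDirProd_list Rs)" and ?c = "\<lambda>(a, as). a # as"
  note hom = RDirProd_list_hom1[of R Rs]
  have mem: "\<exists>a as'. as = a # as' \<and> a \<in> carrier R \<and> as' \<in> carrier (RDirProd_list Rs)"
    if "as \<in> carrier (RDirProd_list (R # Rs))" for as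
    using that by (auto simp: RDirProd_list_carrier)
  have mult: "(a # as) \<otimes>\<^bsub>RDirProd_list (R # Rs)\<^esub> (b # bs) = (a \<otimes>\<^bsub>R\<^esub> b) # (as \<otimes>\<^bsub>RDirProd_list Rs\<^esub> bs)"
    and add: "(a # as) \<oplus>\<^bsub>RDirProd_list (R # Rs)\<^esub> (b # bs) = (a \<oplus>\<^bsub>R\<^esub> b) # (as \<oplus>\<^bsub>RDirProd_list Rs\<^esub> bs)"
    if "a \<in> carrier R" "as \<in> carrier (RDirProd_list Rs)" "b \<in> carrier R" "bs \<in> carrier (RDirProd_list Rs)"
    for a as b bs
    using ring_hom_mult[OF hom, of "(a, as)" "(b, bs)"] ring_hom_add[OF hom, of "(a, as)" "(b, bs)"] that
    by (simp_all add: RDirProd_carrier) (simp_all add: RDirProd_def DirProd_def monoid.defs)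
  have one: "\<one>\<^bsub>RDirProd_list (R # Rs)\<^esub> = \<one>\<^bsub>R\<^esub> # \<one>\<^bsub>RDirProd_list Rs\<^esub>"
    by (simp add: RDirProd_list_one)
  show ?case
  proof (cases i)
    case 0
    show ?thesis
      by (rule ring_hom_memI) (auto simp: 0 one mult add dest!: mem)
  next
    case (Suc j)
    have "ring (Rs ! k)" if "k < length Rs" for k using Cons.prems(1)[of "Suc k"] that by simp
    then have IH: "(\<lambda>as. as ! j) \<in> ring_hom (RDirProd_list Rs) (Rs ! j)"
      using Cons.IH[of j] Cons.prems(2) Suc by simp
    show ?thesis
      by (rule ring_hom_memI)
        (auto simp: Suc one mult add ring_hom_closed[OF IH] ring_hom_mult[OF IH] ring_hom_add[OF IH] ring_hom_one[OF IH] dest!: mem)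
  qed
qed simp

lemma cring_RDirProd_list:
  assumes "\<And>i. i < length Rs \<Longrightarrow> cring (Rs ! i)"
  shows "cring (RDirProd_list Rs)"
proof -
  have ring: "ring (Rs ! i)" if "i < length Rs" for i using assms[OF that] by (simp add: cring_def)
  interpret ring "RDirProd_list Rs" using ring by (rule RDirProd_list_is_ring)
  show ?thesis
  proof
    fix x y assume xy: "x \<in> carrier (RDirProd_list Rs)" "y \<in> carrier (RDirProd_list Rs)"
    show "x \<otimes>\<^bsub>RDirProd_list Rs\<^esub> y = y \<otimes>\<^bsub>RDirProd_list Rs\<^esub> x"
    proof (rule nth_equalityI)
      show "length (x \<otimes>\<^bsub>RDirProd_list Rs\<^esub> y) = length (y \<otimes>\<^bsub>RDirProd_list Rs\<^esub> x)"
        by (simp only: RDirProd_list_carrier_mem(1)[OF m_closed[OF xy]]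
            RDirProd_list_carrier_mem(1)[OF m_closed[OF xy(2,1)]])
      fix i assume "i < length (x \<otimes>\<^bsub>RDirProd_list Rs\<^esub> y)"
      then have i: "i < length Rs" by (simp only: RDirProd_list_carrier_mem(1)[OF m_closed[OF xy]])
      interpret Ri: cring "Rs ! i" by (rule assms[OF i])
      note hom = nth_RDirProd_list_hom[OF ring i]
      show "(x \<otimes>\<^bsub>RDirProd_list Rs\<^esub> y) ! i = (y \<otimes>\<^bsub>RDirProd_list Rs\<^esub> x) ! i"
        using xy ring_hom_mult[OF hom xy] ring_hom_mult[OF hom xy(2,1)] Ri.m_comm
          ring_hom_closed[OF hom xy(1)] ring_hom_closed[OF hom xy(2)] by simp
    qed
  qed
qed

lemma coefficientwise_ring_hom:
  assumes "finite_group_ring R G" "finite_group_ring F G" and p: "p \<in> ring_hom R F"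
  shows "(\<lambda>f. \<lambda>x\<in>carrier G. p (f x)) \<in> ring_hom (group_ring R G) (group_ring F G)"
proof -
  interpret R: finite_group_ring R G by fact
  interpret F: finite_group_ring F G by fact
  interpret p: ring_hom_cring R F p by unfold_locales (rule p)
  have closed: "(\<lambda>x\<in>carrier G. p (f x)) \<in> carrier F.RG" if "f \<in> carrier R.RG" for f
    using that by (intro F.RG_memI) auto
  show ?thesis
  proof (rule ring_hom_memI)
    fix f h assume fh: "f \<in> carrier R.RG" "h \<in> carrier R.RG"
    show "(\<lambda>x\<in>carrier G. p ((f \<otimes>\<^bsub>R.RG\<^esub> h) x))
        = (\<lambda>x\<in>carrier G. p (f x)) \<otimes>\<^bsub>F.RG\<^esub> (\<lambda>x\<in>carrier G. p (h x))"
    proof (rule F.RG_eqI)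
      fix x assume x: "x \<in> carrier G"
      have "p ((f \<otimes>\<^bsub>R.RG\<^esub> h) x) = (\<Oplus>\<^bsub>F\<^esub>y\<in>carrier G. p (f y \<otimes>\<^bsub>R\<^esub> h (inv\<^bsub>G\<^esub> y \<otimes>\<^bsub>G\<^esub> x)))"
        using fh x by (subst R.RG_mult) (auto simp: p.hom_finsum comp_def)
      also have "\<dots> = ((\<lambda>x\<in>carrier G. p (f x)) \<otimes>\<^bsub>F.RG\<^esub> (\<lambda>x\<in>carrier G. p (h x))) x"
        unfolding F.RG_mult[OF closed[OF fh(1)] closed[OF fh(2)] x]
        using fh x by (intro F.finsum_cong') auto
      finally show "(\<lambda>x\<in>carrier G. p ((f \<otimes>\<^bsub>R.RG\<^esub> h) x)) x
          = ((\<lambda>x\<in>carrier G. p (f x)) \<otimes>\<^bsub>F.RG\<^esub> (\<lambda>x\<in>carrier G. p (h x))) x"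
        using x by simp
    qed (use closed fh in auto)
    show "(\<lambda>x\<in>carrier G. p ((f \<oplus>\<^bsub>R.RG\<^esub> h) x))
        = (\<lambda>x\<in>carrier G. p (f x)) \<oplus>\<^bsub>F.RG\<^esub> (\<lambda>x\<in>carrier G. p (h x))"
      using fh by (intro F.RG_eqI closed) (auto simp: R.RG_add F.RG_add intro!: closed)
  next
    show "(\<lambda>x\<in>carrier G. p (\<one>\<^bsub>R.RG\<^esub> x)) = \<one>\<^bsub>F.RG\<^esub>"
      by (intro F.RG_eqI closed) (auto simp: R.RG_one F.RG_one)
  qed (rule closed)
qed

lemma star_clean_Q8_times_RDirProd_list:
  assumes Rs: "\<And>i. i < length Rs \<Longrightarrow> cring (Rs ! i)" and A: "comm_group A" "finite (carrier A)"
  defines "G \<equiv> Q8 \<times>\<times> A"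
  shows "star_clean (group_ring (RDirProd_list Rs) G) (linear_extension (RDirProd_list Rs) G (canonical_involution G)) \<longleftrightarrow>
    (\<forall>i\<in>{..<length Rs}. star_clean (group_ring (Rs ! i) G) (linear_extension (Rs ! i) G (canonical_involution G)))"
proof -
  let ?R = "RDirProd_list Rs"
  have R: "cring ?R" using Rs by (rule cring_RDirProd_list)
  have fgr: "finite_group_ring ?R G" "\<And>i. i < length Rs \<Longrightarrow> finite_group_ring (Rs ! i) G"
    unfolding G_def using finite_group_ring_Q8_times[OF _ A] R Rs by auto
  interpret RG: finite_group_ring ?R G by (rule fgr)
  have ring: "ring (Rs ! i)" if "i < length Rs" for i using Rs[OF that] by (simp add: cring_def)
  note nth_hom = nth_RDirProd_list_hom[OF ring]
  note coeff_hom = coefficientwise_ring_hom[OF fgr(1) fgr(2) nth_hom]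
  note inv = ring_involution_Q8_times[OF _ A, folded G_def]
  note lin = linear_extension_Q8_times[OF _ A, folded G_def]
  note anti = canonical_involution_Q8_times_anti[OF A(1), folded G_def]
  show ?thesis
  proof (rule star_clean_product[where h = "\<lambda>i f. \<lambda>x\<in>carrier G. f x ! i"])
    show "ring RG.RG" by (rule RG.ring_RG)
    show "ring_involution RG.RG (linear_extension ?R G (canonical_involution G))" by (rule inv[OF R])
    fix i assume i: "i \<in> {..<length Rs}"
    then have il: "i < length Rs" by simp
    show "ring (group_ring (Rs ! i) G)" by (rule finite_group_ring.ring_RG[OF fgr(2)[OF il]])
    show "ring_involution (group_ring (Rs ! i) G) (linear_extension (Rs ! i) G (canonical_involution G))"
      by (rule inv[OF Rs[OF il]])
    show hom: "(\<lambda>f. \<lambda>x\<in>carrier G. f x ! i) \<in> ring_hom RG.RG (group_ring (Rs ! i) G)"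
      by (rule coeff_hom[OF il _ il])
    fix f assume f: "f \<in> carrier RG.RG"
    show "(\<lambda>x\<in>carrier G. linear_extension ?R G (canonical_involution G) f x ! i)
        = linear_extension (Rs ! i) G (canonical_involution G) (\<lambda>x\<in>carrier G. f x ! i)"
      unfolding lin[OF R f] lin[OF Rs[OF il] ring_hom_closed[OF hom f]]
      using anti(1) by (intro restrict_ext) simp
  next
    fix f h assume fh: "f \<in> carrier RG.RG" "h \<in> carrier RG.RG"
      and eq: "\<And>i. i \<in> {..<length Rs} \<Longrightarrow> (\<lambda>x\<in>carrier G. f x ! i) = (\<lambda>x\<in>carrier G. h x ! i)"
    show "f = h"
    proof (rule RG.RG_eqI[OF fh])
      fix x assume x: "x \<in> carrier G"
      have len: "length (f x) = length Rs" "length (h x) = length Rs"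
        using RG.RG_closed[OF fh(1) x] RG.RG_closed[OF fh(2) x] by (auto simp: RDirProd_list_carrier_mem(1))
      show "f x = h x"
      proof (rule nth_equalityI)
        fix i assume "i < length (f x)"
        then show "f x ! i = h x ! i" using fun_cong[OF eq[of i], of x] x len by simp
      qed (simp add: len)
    qed
  next
    fix y assume y: "\<And>i. i \<in> {..<length Rs} \<Longrightarrow> y i \<in> carrier (group_ring (Rs ! i) G)"
    define f where "f = (\<lambda>x\<in>carrier G. map (\<lambda>i. y i x) [0..<length Rs])"
    have "f \<in> carrier RG.RG"
      unfolding f_def using y
      by (intro RG.RG_memI RDirProd_list_carrier_memI) (simp_all add: finite_group_ring.RG_closed[OF fgr(2)])
    moreover have "(\<lambda>x\<in>carrier G. f x ! i) = y i" if i: "i \<in> {..<length Rs}" for i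
    proof -
      interpret Fi: finite_group_ring "Rs ! i" G using i fgr(2) by simp
      show ?thesis
        using y[OF i] i by (intro Fi.RG_eqI Fi.RG_memI) (auto simp: f_def)
    qed
    ultimately show "\<exists>f\<in>carrier RG.RG. \<forall>i\<in>{..<length Rs}. (\<lambda>x\<in>carrier G. f x ! i) = y i" by blast
  qed
qed

section \<open>The criterion\<close>

theorem theoremC:
  fixes F :: "nat \<Rightarrow> ('r, 'm) ring_scheme"
    and n :: nat
    and R :: "'r list ring"
    and A :: "('a, 'l) monoid_scheme"
    and G :: "((bool \<times> quat_unit) \<times> 'a) monoid"
    and K :: "nat \<Rightarrow> nat \<Rightarrow> 'k ring"
  assumes "n \<ge> 1"
    and "\<And>i. i \<in> {1..n} \<Longrightarrow> field (F i)"
    and "R = RDirProd_list (map F [1..<Suc n])"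
    and "comm_group A" and "finite (carrier A)"
    and "G = Q8 \<times>\<times> A"
    and "\<And>i. i \<in> {1..n} \<Longrightarrow> \<not> ring_characteristic (F i) dvd order G"
    and "\<And>i d. \<lbrakk>i \<in> {1..n}; d > 0; \<exists>a \<in> carrier A. group.ord A a = d\<rbrakk>
            \<Longrightarrow> cyclotomic_extension (F i) d (K i d)"
  shows "star_clean (group_ring R G) (linear_extension R G (canonical_involution G)) \<longleftrightarrow>
    (\<forall>i \<in> {1..n}. \<forall>d > 0. (\<exists>a \<in> carrier A. group.ord A a = d) \<longrightarrow>
       \<not> (\<exists>x \<in> carrier (K i d). \<exists>y \<in> carrier (K i d). \<exists>z \<in> carrier (K i d).
            x [^]\<^bsub>K i d\<^esub> (2::nat) \<oplus>\<^bsub>K i d\<^esub> y [^]\<^bsub>K i d\<^esub> (2::nat)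
              \<oplus>\<^bsub>K i d\<^esub> z [^]\<^bsub>K i d\<^esub> (2::nat) \<oplus>\<^bsub>K i d\<^esub> \<one>\<^bsub>K i d\<^esub> = \<zero>\<^bsub>K i d\<^esub>))"
proof -
  interpret A: comm_group A by fact
  define sol where "sol i d \<longleftrightarrow> (\<exists>x \<in> carrier (K i d). \<exists>y \<in> carrier (K i d). \<exists>z \<in> carrier (K i d).
            x [^]\<^bsub>K i d\<^esub> (2::nat) \<oplus>\<^bsub>K i d\<^esub> y [^]\<^bsub>K i d\<^esub> (2::nat)
              \<oplus>\<^bsub>K i d\<^esub> z [^]\<^bsub>K i d\<^esub> (2::nat) \<oplus>\<^bsub>K i d\<^esub> \<one>\<^bsub>K i d\<^esub> = \<zero>\<^bsub>K i d\<^esub>)" for i d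
  let ?clean = "\<lambda>R. star_clean (group_ring R G) (linear_extension R G (canonical_involution G))"
  have nth: "map F [1..<Suc n] ! i = F (Suc i)" if "i < n" for i
    using that by (simp del: upt_Suc)
  have "?clean R \<longleftrightarrow> (\<forall>i\<in>{..<n}. ?clean (F (Suc i)))"
  proof -
    have "cring (map F [1..<Suc n] ! i)" if "i < length (map F [1..<Suc n])" for i
      using assms(2)[of "Suc i"] that nth[of i] by (auto simp: field_def domain_def simp del: upt_Suc)
    from star_clean_Q8_times_RDirProd_list[OF this assms(4,5)]
    show ?thesis unfolding assms(3,6) by (simp add: nth del: upt_Suc)
  qed
  also have "\<dots> \<longleftrightarrow> (\<forall>i\<in>{1..n}. ?clean (F i))"
    unfolding image_Suc_lessThan[symmetric] by simp
  finally have components: "?clean R \<longleftrightarrow> (\<forall>i\<in>{1..n}. ?clean (F i))" .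
  obtain g where g: "g \<in> carrier A" and ord_dvd: "\<And>a. a \<in> carrier A \<Longrightarrow> A.ord a dvd A.ord g"
    using A.exists_ord_exponent[OF assms(5)] by blast
  define m where "m = A.ord g"
  have m: "m > 0" "\<exists>a\<in>carrier A. A.ord a = m" using g A.ord_ge_1[OF assms(5) g] by (auto simp: m_def)
  have exponent: "a [^]\<^bsub>A\<^esub> m = \<one>\<^bsub>A\<^esub>" if "a \<in> carrier A" for a
    using ord_dvd[OF that] that by (simp add: A.pow_eq_id m_def)
  have order: "order G = card (UNIV :: (bool \<times> quat_unit) set) * order A"
    by (simp add: assms(6) order_def card_cartesian_product)
  have card: "card (UNIV :: (bool \<times> quat_unit) set) = 2 * 4"
    unfolding UNIV_Times_UNIV[symmetric] card_cartesian_product by (simp add: UNIV_quat_unit)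
  have "2 dvd order G" unfolding order card by simp
  have "m dvd order G" unfolding order m_def using A.ord_dvd_group_order[OF g] by simp
  have criterion: "?clean (F i) \<longleftrightarrow> (\<forall>d > 0. (\<exists>a \<in> carrier A. A.ord a = d) \<longrightarrow> \<not> sol i d)" if i: "i \<in> {1..n}" for i
  proof -
    have F: "field (F i)" using assms(2) i .
    have ext: "\<exists>\<iota> \<zeta>. field (K i d) \<and> \<iota> \<in> ring_hom (F i) (K i d) \<and> primitive_root_of_one (K i d) d \<zeta>
        \<and> carrier (K i d) = generate_field (K i d) (insert \<zeta> (\<iota> ` carrier (F i)))
        \<and> \<one>\<^bsub>K i d\<^esub> \<oplus>\<^bsub>K i d\<^esub> \<one>\<^bsub>K i d\<^esub> \<noteq> \<zero>\<^bsub>K i d\<^esub> \<and> [m] \<cdot>\<^bsub>K i d\<^esub> \<one>\<^bsub>K i d\<^esub> \<noteq> \<zero>\<^bsub>K i d\<^esub>"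
      if d: "d > 0" "\<exists>a \<in> carrier A. A.ord a = d" for d
    proof -
      obtain \<iota> \<zeta> where *: "field (K i d)" "\<iota> \<in> ring_hom (F i) (K i d)" "primitive_root_of_one (K i d) d \<zeta>"
        "carrier (K i d) = generate_field (K i d) (insert \<zeta> (\<iota> ` carrier (F i)))"
        using assms(8)[OF i d] unfolding cyclotomic_extension_def by blast
      interpret Kd: field "K i d" by fact
      note nonzero = multiple_of_one_nonzero[OF F *(1,2) assms(7)[OF i]]
      have "add_pow (K i d) (2::nat) \<one>\<^bsub>K i d\<^esub> = \<one>\<^bsub>K i d\<^esub> \<oplus>\<^bsub>K i d\<^esub> \<one>\<^bsub>K i d\<^esub>"
        by (simp add: numeral_2_eq_2)
      then show ?thesis using * nonzero[OF \<open>2 dvd order G\<close>] nonzero[OF \<open>m dvd order G\<close>] by metis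
    qed
    have sol_iff: "sol i d \<longleftrightarrow> (\<exists>x \<in> carrier (K i d). \<exists>y \<in> carrier (K i d). \<exists>z \<in> carrier (K i d).
            x \<otimes>\<^bsub>K i d\<^esub> x \<oplus>\<^bsub>K i d\<^esub> y \<otimes>\<^bsub>K i d\<^esub> y \<oplus>\<^bsub>K i d\<^esub> z \<otimes>\<^bsub>K i d\<^esub> z \<oplus>\<^bsub>K i d\<^esub> \<one>\<^bsub>K i d\<^esub> = \<zero>\<^bsub>K i d\<^esub>)"
      if "field (K i d)" for d
    proof -
      interpret Kd: field "K i d" by fact
      show ?thesis unfolding sol_def by (simp add: numeral_2_eq_2)
    qed
    obtain \<iota> \<zeta> where Km: "field (K i m)" "\<iota> \<in> ring_hom (F i) (K i m)" "primitive_root_of_one (K i m) m \<zeta>"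
      "\<one>\<^bsub>K i m\<^esub> \<oplus>\<^bsub>K i m\<^esub> \<one>\<^bsub>K i m\<^esub> \<noteq> \<zero>\<^bsub>K i m\<^esub>" "[m] \<cdot>\<^bsub>K i m\<^esub> \<one>\<^bsub>K i m\<^esub> \<noteq> \<zero>\<^bsub>K i m\<^esub>"
      using ext[OF m] by blast
    interpret AC: abelian_characters "K i m" A m \<zeta>
      by (intro abelian_characters.intro abelian_characters_axioms.intro Km assms exponent)
    obtain l where l: "additive_mod A m (carrier A) l" "[l g = 1] (mod m)"
      using AC.exists_character_of_generator[OF g] m_def by auto
    show ?thesis
    proof (intro iffI allI impI)
      fix d assume clean: "?clean (F i)" and d: "d > 0" "\<exists>a \<in> carrier A. A.ord a = d"
      have "d dvd m" using d(2) ord_dvd by (auto simp: m_def)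
      obtain \<iota>' \<zeta>' where Kd: "field (K i d)" "\<iota>' \<in> ring_hom (F i) (K i d)" "primitive_root_of_one (K i d) d \<zeta>'"
        "carrier (K i d) = generate_field (K i d) (insert \<zeta>' (\<iota>' ` carrier (F i)))"
        "\<one>\<^bsub>K i d\<^esub> \<oplus>\<^bsub>K i d\<^esub> \<one>\<^bsub>K i d\<^esub> \<noteq> \<zero>\<^bsub>K i d\<^esub>"
        using ext[OF d] by blast
      show "\<not> sol i d"
        using not_star_clean_Q8_times[OF F assms(4,5) Kd(1-4) l(1) \<open>d dvd m\<close> g l(2) Kd(5)] clean
        unfolding sol_iff[OF Kd(1)] assms(6) by blast
    next
      assume "\<forall>d > 0. (\<exists>a \<in> carrier A. A.ord a = d) \<longrightarrow> \<not> sol i d"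
      then have "\<not> sol i m" using m by blast
      then show "?clean (F i)"
        unfolding sol_iff[OF Km(1)] assms(6)
        by (intro star_clean_Q8_times[OF F assms(4,5) Km(1-3) exponent Km(4,5)]) blast+
    qed
  qed
  show ?thesis
    unfolding components using criterion by (simp add: sol_def)
qed

end
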